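(* For every $n\ge1$, the map $\Delta^{-1}\circ\mathrm{F}$ is a bijection from the set of tree-tableaux of size $n$ to the set of EW-tableaux of size $n$, and the map $\Gamma^{-1}\circ\mathrm{F}$ is a bijection from the set of tree-tableaux of size $n$ to the set of NEW-tableaux of size $n$.
   Context: A Ferrers diagram is a left-aligned array of cells whose row lengths weakly decrease from top to bottom. Tree-tableau: a filling of a Ferrers diagram (nonempty rows) in which each cell is empty or contains a dot, such that (1) the top left cell has a dot; (2) every other dotted cell has a dot above it in the same column or a dot to its left in the same row, but not both; (3) every row and every column has a dot. Its size is (number of rows) + (number of columns) $-1$. EW-tableau: a 0/1-filling of a Ferrers diagram with nonempty rows such that the top row is all 1s, every other row has at least one 0, and no four cells forming the corners of a rectangle have 0s in two diagonally opposite corners and 1s in the other two. Its size is (number of rows) + (number of columns) $-1$. NEW-tableau: a 0/1-filling of a Ferrers diagram, possibly with empty bottom rows, such that every column has a 1 and no four cells forming the corners of a rectangle have 0s in two diagonally opposite corners and 1s in the other two. Le-tableau: a 0/1-filling of a Ferrers diagram, possibly with empty bottom rows, such that every column has a 1, and any cell with a 1 above it in its column and a 1 to its left in its row contains a 1. The size of a NEW- or Le-tableau is (number of rows) + (number of columns), empty rows included. The map $\mathrm{F}$ from tree-tableaux to Le-tableaux: fill a cell with 1 if it has a dot (strictly) to its left in its row and a dot weakly above it in its column (in the cell itself or above it); otherwise fill it with 0; finally delete the leftmost column, keeping all rows. Labels: number the unit steps of the southeast border, from the northeast to the southwest corner, by $0,1,\dots,n$ for an EW-tableau of size $n$, and by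 $1,\dots,n$ for a NEW- or Le-tableau of size $n$; the vertical step at the right end of a row is that row's label (also for empty rows), the horizontal step at the bottom of a column is that column's label. The map $\Psi$ (from EW-tableaux, or from NEW-tableaux, of size $n$ to permutations of $\{1,\dots,n\}$): for an EW-tableau only, first delete all entries of the top row and disregard the label 0. Then repeat until all labels have been read: (i) write down the labels of all unread columns containing no 1s, from right to left, and delete their entries; (ii) write down the labels of all unread rows containing no 0s (empty rows included), from bottom to top, and delete their entries. $\mathrm{DE}:\mathcal{S}_n\to\mathcal{S}_n$ (a bijection): for $\pi=a_1\dots a_n$ put $a_0=0$ and $\mathrm{DE}(\pi)=b_1\dots b_n$, where for each $1\le i\le n$: if $a_i>a_j$ for some $j>i$ then $b_{a_{i+1}}=a_i$; otherwise let $a_k$ ($0\le k<i$) be the rightmost letter smaller than $a_i$ and set $b_{a_{k+1}}=a_i$. $\mathcal{R}$ is the cyclic right shift $a_1\dots a_n\mapsto a_na_1\dots a_{n-1}$; $\mathcal{S}$ is the cyclic down-shift, subtracting 1 from each letter and changing the resulting 0 to $n$. $\Phi$ is the known bijection from Le-tableaux of size $n$ to permutations of $\{1,\dots,n\}$: copy each row label to the left end of the row and each column label to the top of the column. From label $\ell$ on the left or top border, enter the tableau (heading right, respectively down) and move straight through 0s; at each 1, turn to head right if heading down, and to head down if heading right. The label on the southeast border where the path exits is the letter in place $\ell$ of $\Phi(\mathcal{L})$ (for an empty row $\ell$ it is $\ell$). $\Delta=\Phi^{-1}\circ\mathcal{R}\circ\mathrm{DE}\circ\Psi$ is a bijection from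 EW-tableaux of size $n$ to Le-tableaux of size $n$, and $\Gamma=\Phi^{-1}\circ\mathcal{S}\circ\mathrm{DE}\circ\Psi$ is a bijection from NEW-tableaux of size $n$ to Le-tableaux of size $n$. *)

theory Defs
  imports Main "HOL-Library.While_Combinator"
begin

text \<open>
  A diagram is the list of its row lengths from top to bottom; zeros are empty rows. A cell is
  a pair (row, column), both counted from 0. A filling is a diagram together with the set of
  its cells that carry a dot (tree-tableaux) or a 1 (all other tableaux).
\<close>

type_synonym shape = "nat list"
type_synonym cell = "nat \<times> nat"
type_synonym tableau = "shape \<times> cell set"

definition ferrers :: "shape \<Rightarrow> bool" where
  "ferrers sh \<longleftrightarrow> sorted_wrt (\<ge>) sh"

definition cells :: "shape \<Rightarrow> cell set" where
  "cells sh = {(i, j). i < length sh \<and> j < sh ! i}"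

definition filling :: "tableau \<Rightarrow> bool" where
  "filling = (\<lambda>(sh, T). ferrers sh \<and> T \<subseteq> cells sh)"

definition nrows :: "shape \<Rightarrow> nat" where
  "nrows sh = length sh"

definition ncols :: "shape \<Rightarrow> nat" where
  "ncols sh = (case sh of [] \<Rightarrow> 0 | l # _ \<Rightarrow> l)"

definition nonempty_rows :: "shape \<Rightarrow> bool" where
  "nonempty_rows sh \<longleftrightarrow> (\<forall>i < nrows sh. sh ! i > 0)"

definition tree_tableau :: "tableau \<Rightarrow> bool" where
  "tree_tableau = (\<lambda>(sh, D). filling (sh, D) \<and> nonempty_rows sh \<and>
     (0, 0) \<in> D \<and>
     (\<forall>(i, j) \<in> D - {(0, 0)}. (\<exists>i' < i. (i', j) \<in> D) \<noteq> (\<exists>j' < j. (i, j') \<in> D)) \<and>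
     (\<forall>i < nrows sh. \<exists>j. (i, j) \<in> D) \<and>
     (\<forall>j < ncols sh. \<exists>i. (i, j) \<in> D))"

definition no_bad_rectangle :: "tableau \<Rightarrow> bool" where
  "no_bad_rectangle = (\<lambda>(sh, T). \<forall>i i' j j'. i < i' \<and> j < j' \<and>
     {(i, j), (i, j'), (i', j), (i', j')} \<subseteq> cells sh \<longrightarrow>
       \<not> ((i, j) \<notin> T \<and> (i', j') \<notin> T \<and> (i, j') \<in> T \<and> (i', j) \<in> T) \<and>
       \<not> ((i, j) \<in> T \<and> (i', j') \<in> T \<and> (i, j') \<notin> T \<and> (i', j) \<notin> T))"

definition EW_tableau :: "tableau \<Rightarrow> bool" where
  "EW_tableau = (\<lambda>(sh, T). filling (sh, T) \<and> nonempty_rows sh \<and>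
     (\<forall>j < ncols sh. (0, j) \<in> T) \<and>
     (\<forall>i < nrows sh. i > 0 \<longrightarrow> (\<exists>j < sh ! i. (i, j) \<notin> T)) \<and>
     no_bad_rectangle (sh, T))"

definition NEW_tableau :: "tableau \<Rightarrow> bool" where
  "NEW_tableau = (\<lambda>(sh, T). filling (sh, T) \<and>
     (\<forall>j < ncols sh. \<exists>i. (i, j) \<in> T) \<and> no_bad_rectangle (sh, T))"

definition Le_tableau :: "tableau \<Rightarrow> bool" where
  "Le_tableau = (\<lambda>(sh, T). filling (sh, T) \<and>
     (\<forall>j < ncols sh. \<exists>i. (i, j) \<in> T) \<and>
     (\<forall>(i, j) \<in> cells sh.
        (\<exists>i' < i. (i', j) \<in> T) \<and> (\<exists>j' < j. (i, j') \<in> T) \<longrightarrow> (i, j) \<in> T))"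

definition tree_tableaux :: "nat \<Rightarrow> tableau set" where
  "tree_tableaux n = {(sh, D). tree_tableau (sh, D) \<and> nrows sh + ncols sh - 1 = n}"

definition EW_tableaux :: "nat \<Rightarrow> tableau set" where
  "EW_tableaux n = {(sh, T). EW_tableau (sh, T) \<and> nrows sh + ncols sh - 1 = n}"

definition NEW_tableaux :: "nat \<Rightarrow> tableau set" where
  "NEW_tableaux n = {(sh, T). NEW_tableau (sh, T) \<and> nrows sh + ncols sh = n}"

definition Le_tableaux :: "nat \<Rightarrow> tableau set" where
  "Le_tableaux n = {(sh, T). Le_tableau (sh, T) \<and> nrows sh + ncols sh = n}"

text \<open>The shift in the column index comes from the deletion of the leftmost column.\<close>

definition F_map :: "tableau \<Rightarrow> tableau" where
  "F_map = (\<lambda>(sh, D). (map (\<lambda>l. l - 1) sh,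
     {(i, j). (i, Suc j) \<in> cells sh \<and>
        (\<exists>j' < Suc j. (i, j') \<in> D) \<and> (\<exists>i' \<le> i. (i', Suc j) \<in> D)}))"

text \<open>
  \<open>Row i\<close> is the vertical border step at the right end of row \<open>i\<close>, \<open>Col j\<close> the horizontal step
  at the bottom of column \<open>j\<close>. In \<open>border_from i w ls\<close>, the walk along the border stands at the
  right end of the top edge of row \<open>i\<close>, with \<open>w\<close> columns still to its left, and \<open>ls\<close> are the
  lengths of the rows from \<open>i\<close> on.
\<close>

datatype border_step = Row nat | Col nat

fun border_from :: "nat \<Rightarrow> nat \<Rightarrow> nat list \<Rightarrow> border_step list" where
  "border_from i w [] = map Col (rev [0..<w])"
| "border_from i w (l # ls) = map Col (rev [l..<w]) @ Row i # border_from (Suc i) l ls"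

definition border :: "shape \<Rightarrow> border_step list" where
  "border sh = border_from 0 (ncols sh) sh"

text \<open>
  The number of border steps before \<open>s\<close>. This is the label of \<open>s\<close> in an EW-tableau; in NEW- and
  Le-tableaux, where the numbering starts at 1, the label is its successor.
\<close>

definition label0 :: "shape \<Rightarrow> border_step \<Rightarrow> nat" where
  "label0 sh s = length (takeWhile (\<lambda>t. t \<noteq> s) (border sh))"

definition label1 :: "shape \<Rightarrow> border_step \<Rightarrow> nat" where
  "label1 sh s = Suc (label0 sh s)"

text \<open>
  Permutations of \<open>{1..n}\<close> are written as words, i.e. lists. The state \<open>(U, V, w)\<close> consists of
  the unread rows, from bottom to top, the unread columns, from right to left, and the word
  written so far. The entries not yet deleted are those in a row of \<open>U\<close> and a column of \<open>V\<close>.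
\<close>

type_synonym psi_state = "nat list \<times> nat list \<times> nat list"

definition psi_round :: "(border_step \<Rightarrow> nat) \<Rightarrow> tableau \<Rightarrow> psi_state \<Rightarrow> psi_state" where
  "psi_round lab = (\<lambda>(sh, T) (U, V, w).
     let no_ones = (\<lambda>j. \<forall>i \<in> set U. (i, j) \<in> cells sh \<longrightarrow> (i, j) \<notin> T);
         V' = filter (\<lambda>j. \<not> no_ones j) V;
         no_zeros = (\<lambda>i. \<forall>j \<in> set V'. (i, j) \<in> cells sh \<longrightarrow> (i, j) \<in> T);
         U' = filter (\<lambda>i. \<not> no_zeros i) U
     in (U', V', w @ map (\<lambda>j. lab (Col j)) (filter no_ones V)
                   @ map (\<lambda>i. lab (Row i)) (filter no_zeros U)))"

definition psi_loop :: "(border_step \<Rightarrow> nat) \<Rightarrow> tableau \<Rightarrow> psi_state \<Rightarrow> nat list" where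
  "psi_loop lab T s =
     (case while (\<lambda>(U, V, w). U \<noteq> [] \<or> V \<noteq> []) (psi_round lab T) s of (U, V, w) \<Rightarrow> w)"

definition Psi_EW :: "tableau \<Rightarrow> nat list" where
  "Psi_EW = (\<lambda>(sh, T).
     psi_loop (label0 sh) (sh, T) (rev [1..<nrows sh], rev [0..<ncols sh], []))"

definition Psi_NEW :: "tableau \<Rightarrow> nat list" where
  "Psi_NEW = (\<lambda>(sh, T).
     psi_loop (label1 sh) (sh, T) (rev [0..<nrows sh], rev [0..<ncols sh], []))"

text \<open>
  \<open>(0 # \<pi>) ! i\<close> is the letter \<open>a\<^sub>i\<close>, with \<open>a\<^sub>0 = 0\<close>. \<open>DE_place \<pi> i\<close> is the place which the letter
  \<open>a\<^sub>i\<close> occupies in the image of \<open>\<pi>\<close>.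
\<close>

definition DE_place :: "nat list \<Rightarrow> nat \<Rightarrow> nat" where
  "DE_place \<pi> i = (let a = (\<lambda>m. (0 # \<pi>) ! m) in
     if \<exists>j. i < j \<and> j \<le> length \<pi> \<and> a i > a j then a (i + 1)
     else a (Max {k. k < i \<and> a k < a i} + 1))"

definition DE :: "nat list \<Rightarrow> nat list" where
  "DE \<pi> = map (\<lambda>p. THE b. \<exists>i \<in> {1..length \<pi>}. DE_place \<pi> i = p \<and> b = (0 # \<pi>) ! i)
             [1..<length \<pi> + 1]"

definition right_shift :: "nat list \<Rightarrow> nat list" where
  "right_shift \<pi> = last \<pi> # butlast \<pi>"

definition down_shift :: "nat list \<Rightarrow> nat list" where
  "down_shift \<pi> = map (\<lambda>x. if x - 1 = 0 then length \<pi> else x - 1) \<pi>"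

datatype heading = Rightward | Downward

fun turn :: "heading \<Rightarrow> heading" where
  "turn Rightward = Downward"
| "turn Downward = Rightward"

text \<open>
  \<open>travel sh T d i j\<close> is the border step at which the path that is about to enter the cell
  \<open>(i, j)\<close> with heading \<open>d\<close> leaves the diagram.
\<close>

function travel :: "shape \<Rightarrow> cell set \<Rightarrow> heading \<Rightarrow> nat \<Rightarrow> nat \<Rightarrow> border_step" where
  "travel sh T d i j =
     (if (i, j) \<notin> cells sh then (case d of Rightward \<Rightarrow> Row i | Downward \<Rightarrow> Col j)
      else (case (if (i, j) \<in> T then turn d else d) of
              Rightward \<Rightarrow> travel sh T Rightward i (Suc j)
            | Downward \<Rightarrow> travel sh T Downward (Suc i) j))"
  by pat_completeness auto
termination
proof (relation "measure (\<lambda>(sh, T, d, i, j). length sh + sum_list sh - (i + j))", simp)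
  have *: "i + j < length sh + sum_list sh" if "(i, j) \<in> cells sh" for i j and sh :: shape
    using that elem_le_sum_list[of i sh] by (auto simp: cells_def)
  show "((sh, T, Rightward, i, Suc j), (sh, T, d, i, j))
      \<in> measure (\<lambda>(sh, T, d, i, j). length sh + sum_list sh - (i + j))"
    if "\<not> (i, j) \<notin> cells sh" for sh T d i j
    using *[of i j sh] that by auto
  show "((sh, T, Downward, Suc i, j), (sh, T, d, i, j))
      \<in> measure (\<lambda>(sh, T, d, i, j). length sh + sum_list sh - (i + j))"
    if "\<not> (i, j) \<notin> cells sh" for sh T d i j
    using *[of i j sh] that by auto
qed

declare travel.simps [simp del]

fun exit_from :: "tableau \<Rightarrow> border_step \<Rightarrow> border_step" where
  "exit_from (sh, T) (Row i) = travel sh T Rightward i 0"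
| "exit_from (sh, T) (Col j) = travel sh T Downward 0 j"

text \<open>The list \<open>border sh\<close> is ordered by labels, so its entry with label \<open>l\<close> yields place \<open>l\<close>.\<close>

definition Phi :: "tableau \<Rightarrow> nat list" where
  "Phi = (\<lambda>(sh, T). map (\<lambda>s. label1 sh (exit_from (sh, T) s)) (border sh))"

definition Delta :: "nat \<Rightarrow> tableau \<Rightarrow> tableau" where
  "Delta n = inv_into (Le_tableaux n) Phi \<circ> right_shift \<circ> DE \<circ> Psi_EW"

definition Gamma :: "nat \<Rightarrow> tableau \<Rightarrow> tableau" where
  "Gamma n = inv_into (Le_tableaux n) Phi \<circ> down_shift \<circ> DE \<circ> Psi_NEW"

end

theory Submission
  imports Defs "HOL-Combinatorics.Multiset_Permutations"
begin

text \<open>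
  Every map in the statement is a bijection onto the expected set: \<open>F_map\<close> carries tree-tableaux to
  Le-tableaux (\<open>F_bij\<close>), \<open>Phi\<close> carries Le-tableaux of size \<open>n\<close> to permutations of \<open>{1..n}\<close>
  (\<open>Phi_bij\<close>), the two readings carry EW- and NEW-tableaux to the same permutations
  (\<open>Psi_from_bij\<close>), and \<open>DE\<close> (\<open>DE_bij\<close>) and the two shifts permute the permutations. Hence \<open>Delta n\<close>
  and \<open>Gamma n\<close> are bijections onto the Le-tableaux, and so are their inverses composed with \<open>F_map\<close>.

  \<^emph>\<open>Tree-tableaux.\<close> Besides the root, each dot is either the topmost dot of its column or the
  leftmost dot of its row, never both, so these two families of dots determine the tableau. The
  topmost dots of the columns after the first are the topmost 1s of the image. In a row of a
  Le-tableau, look only at the cells that have a 1 weakly above them: by the Le-condition the 0s come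
  before the 1s, and the leftmost dot of the row sits at the last such 0 (or in the first column, if
  there is none). This is an explicit inverse.

  \<^emph>\<open>The map Phi.\<close> A Le-tableau is built along its border from northeast to southwest: a row step
  appends an empty row, a column step appends a new leftmost column whose 1s occupy a nonempty set
  \<open>A\<close> of rows. The Le-condition holds afterwards iff each row in \<open>A\<close> is free, that is, has no
  0 below a 1. On words, a row step appends a fixed point, and a column step composes the word with
  the cycle that runs through the new place and the labels of \<open>A\<close> in increasing order. The free rows
  correspond to the left-to-right maxima of the word, and \<open>A\<close> consists of those maxima that exceed
  the last letter, so each step can be undone and every permutation arises.

  \<^emph>\<open>The readings.\<close> A 1 says that its row is read before its column, a 0 the opposite. The letters
  alternate between increasing blocks of column labels and decreasing blocks of row labels, and a
  letter labels a row exactly if it is smaller than its predecessor; the word therefore determines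
  shape and filling. The reading never gets stuck because, in a Ferrers diagram without bad
  rectangles, the relation of being read before has no cycles. Conversely each permutation, cut at its
  ascents and descents, defines a tableau, and the word compatible with a given tableau is unique.

  \<^emph>\<open>The map DE.\<close> Cutting a permutation after its right-to-left minima gives blocks, and the image is
  the permutation whose cycles are the blocks, traversed backwards. The blocks can be recovered since
  the minima of the cycles have to occur in increasing order.
\<close>

section \<open>Ferrers shapes and their borders\<close>

fun shift_col :: "border_step \<Rightarrow> border_step" where
  "shift_col (Row i) = Row i"
| "shift_col (Col j) = Col (Suc j)"

lemma shift_col_eq_iff [simp]: "shift_col s = shift_col t \<longleftrightarrow> s = t"
  by (cases s; cases t) auto

lemma shift_col_neq_Col0 [simp]: "shift_col s \<noteq> Col 0" "Col 0 \<noteq> shift_col s"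
  by (cases s; auto)+

fun is_row :: "border_step \<Rightarrow> bool" where
  "is_row (Row i) = True"
| "is_row (Col j) = False"

lemma is_row_shift_col [simp]: "is_row (shift_col s) = is_row s"
  by (cases s) auto

lemma ferrers_Nil [simp]: "ferrers []"
  by (simp add: ferrers_def)

lemma ferrers_snoc0 [simp]: "ferrers (sh @ [0]) \<longleftrightarrow> ferrers sh"
  by (auto simp: ferrers_def sorted_wrt_append)

lemma ferrers_map_Suc [simp]: "ferrers (map Suc sh) \<longleftrightarrow> ferrers sh"
  by (simp add: ferrers_def sorted_wrt_map)

lemma ncols_simps [simp]:
  "ncols [] = 0" "ncols (sh @ [0]) = ncols sh" "sh \<noteq> [] \<Longrightarrow> ncols (map Suc sh) = Suc (ncols sh)"
  by (cases sh; auto simp: ncols_def)+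

lemma nrows_simps [simp]:
  "nrows [] = 0" "nrows (sh @ [0]) = Suc (nrows sh)" "nrows (map f sh) = nrows sh"
  by (auto simp: nrows_def)

lemma ferrers_nth_mono: "ferrers sh \<Longrightarrow> i \<le> i' \<Longrightarrow> i' < nrows sh \<Longrightarrow> sh ! i' \<le> sh ! i"
  unfolding ferrers_def nrows_def by (cases "i = i'") (auto simp: sorted_wrt_iff_nth_less)

lemma ncols_nth: "sh \<noteq> [] \<Longrightarrow> ncols sh = sh ! 0"
  by (cases sh) (auto simp: ncols_def)

lemma ferrers_nth_le: "ferrers sh \<Longrightarrow> i < nrows sh \<Longrightarrow> sh ! i \<le> ncols sh"
  using ferrers_nth_mono[of sh 0 i] by (cases "sh = []") (auto simp: ncols_nth)

text \<open>
  The last border step is a row step iff the bottom row is empty; removing that step leaves a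
  smaller Ferrers shape. Induction on this decomposition reduces all facts about labels to the way in
  which \<open>border\<close> and \<open>label0\<close> change under one step.
\<close>
lemma ferrers_cases:
  assumes "ferrers sh"
  obtains (empty) "sh = []"
  | (row) sh' where "ferrers sh'" "sh = sh' @ [0]"
  | (col) sh' where "ferrers sh'" "sh' \<noteq> []" "sh = map Suc sh'"
proof (cases "sh = []")
  case False
  then have sh: "sh = butlast sh @ [last sh]" by simp
  show ?thesis
  proof (cases "last sh = 0")
    case True
    then show ?thesis using row[of "butlast sh"] sh assms by (metis ferrers_snoc0)
  next
    case l: False
    have "x > 0" if "x \<in> set sh" for x
    proof -
      have "sorted_wrt (\<ge>) (butlast sh @ [last sh])" using assms sh by (simp add: ferrers_def)
      then have "x \<ge> last sh" using that sh by (metis (no_types, lifting) Un_iff sorted_wrt_append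
        set_append list.set_intros(1) set_ConsD empty_iff empty_set order_refl)
      then show ?thesis using l by simp
    qed
    then have "sh = map Suc (map (\<lambda>l. l - 1) sh)" by (simp add: map_idI)
    then show ?thesis using col[of "map (\<lambda>l. l - 1) sh"] False assms
      by (metis ferrers_map_Suc map_is_Nil_conv)
  qed
qed (use empty in auto)

lemma ferrers_induct [consumes 1, case_names empty row col]:
  assumes "ferrers sh"
    and "P []"
    and "\<And>sh. ferrers sh \<Longrightarrow> P sh \<Longrightarrow> P (sh @ [0])"
    and "\<And>sh. ferrers sh \<Longrightarrow> sh \<noteq> [] \<Longrightarrow> P sh \<Longrightarrow> P (map Suc sh)"
  shows "P sh"
  using assms(1)
proof (induction "nrows sh + ncols sh" arbitrary: sh rule: less_induct)
  case less
  from less.prems show ?case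
  proof (cases rule: ferrers_cases)
    case (row sh')
    then show ?thesis using less.hyps[of sh'] assms(3) by auto
  next
    case (col sh')
    then show ?thesis using less.hyps[of sh'] assms(4) by auto
  qed (use assms(2) in auto)
qed

lemma border_from_snoc0: "border_from i w (ls @ [0]) = border_from i w ls @ [Row (i + length ls)]"
  by (induction i w ls rule: border_from.induct) auto

lemma map_Col_Suc: "map Col (rev [Suc l..<Suc w]) = map shift_col (map Col (rev [l..<w]))"
  by (simp add: map_Suc_upt[symmetric] rev_map comp_def del: map_Suc_upt upt_Suc)

lemma border_from_map_Suc:
  "border_from i (Suc w) (map Suc ls) = map shift_col (border_from i w ls) @ [Col 0]"
proof (induction i w ls rule: border_from.induct)
  case (1 i w)
  have "rev [0..<Suc w] = rev [Suc 0..<Suc w] @ [0]"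
    by (subst upt_conv_Cons) auto
  then show ?case using map_Col_Suc[of 0 w] by (simp del: upt_Suc)
next
  case (2 i w l ls)
  then show ?case using map_Col_Suc[of l w] by (simp del: upt_Suc)
qed

lemma border_Nil [simp]: "border [] = []"
  by (simp add: border_def)

lemma border_snoc0 [simp]: "border (sh @ [0]) = border sh @ [Row (nrows sh)]"
  by (simp add: border_def border_from_snoc0 nrows_def)

lemma border_map_Suc [simp]: "sh \<noteq> [] \<Longrightarrow> border (map Suc sh) = map shift_col (border sh) @ [Col 0]"
  by (simp add: border_def border_from_map_Suc)

lemma set_border: "ferrers sh \<Longrightarrow> set (border sh) = Row ` {..<nrows sh} \<union> Col ` {..<ncols sh}"
proof (induction rule: ferrers_induct)
  case (col sh)
  then show ?case by (simp add: image_Un image_image lessThan_Suc_eq_insert_0)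
qed (auto simp: lessThan_Suc)

lemma distinct_border: "ferrers sh \<Longrightarrow> distinct (border sh)"
proof (induction rule: ferrers_induct)
  case (col sh)
  then show ?case by (auto simp: distinct_map inj_on_def)
qed (auto simp: set_border)

lemma length_border: "ferrers sh \<Longrightarrow> length (border sh) = nrows sh + ncols sh"
  by (induction rule: ferrers_induct) auto

lemma label0_less: "s \<in> set (border sh) \<Longrightarrow> label0 sh s < length (border sh)"
proof -
  assume "s \<in> set (border sh)"
  then have "takeWhile (\<lambda>t. t \<noteq> s) (border sh) \<noteq> border sh"
    by (metis (mono_tags, lifting) takeWhile_eq_all_conv)
  then show ?thesis
    unfolding label0_def
    by (metis length_append less_add_same_cancel1 length_greater_0_conv takeWhile_dropWhile_id
        append_Nil2)
qed

lemma border_label0: "s \<in> set (border sh) \<Longrightarrow> border sh ! label0 sh s = s"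
  using label0_less[of s sh] nth_length_takeWhile[of "\<lambda>t. t \<noteq> s" "border sh"] unfolding label0_def
  by simp

lemma label0_border: "ferrers sh \<Longrightarrow> p < length (border sh) \<Longrightarrow> label0 sh (border sh ! p) = p"
  using border_label0[of "border sh ! p" sh] label0_less[of "border sh ! p" sh] distinct_border[of sh]
  by (simp add: nth_eq_iff_index_eq)

lemma label0_inj:
  "s \<in> set (border sh) \<Longrightarrow> t \<in> set (border sh) \<Longrightarrow> label0 sh s = label0 sh t \<longleftrightarrow> s = t"
  by (metis border_label0)

lemma label0_snoc0 [simp]:
  "s \<in> set (border sh) \<Longrightarrow> label0 (sh @ [0]) s = label0 sh s"
  by (simp add: label0_def takeWhile_append1)

lemma label0_snoc0_new: "ferrers sh \<Longrightarrow> label0 (sh @ [0]) (Row (nrows sh)) = length (border sh)"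
  unfolding label0_def border_snoc0 by (subst takeWhile_append2) (auto simp: set_border)

lemma label0_map_Suc [simp]:
  "sh \<noteq> [] \<Longrightarrow> s \<in> set (border sh) \<Longrightarrow> label0 (map Suc sh) (shift_col s) = label0 sh s"
  unfolding label0_def border_map_Suc
  by (subst takeWhile_append1[of "shift_col s"]) (auto simp: takeWhile_map comp_def)

lemma label0_map_Suc_new: "sh \<noteq> [] \<Longrightarrow> label0 (map Suc sh) (Col 0) = length (border sh)"
  unfolding label0_def border_map_Suc by (subst takeWhile_append2) auto

lemma label0_map_Suc_Row:
  "ferrers sh \<Longrightarrow> i < nrows sh \<Longrightarrow> label0 (map Suc sh) (Row i) = label0 sh (Row i)"
  using label0_map_Suc[of sh "Row i"] by (cases "sh = []") (auto simp: set_border)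

lemma label0_map_Suc_Col:
  "ferrers sh \<Longrightarrow> j < ncols sh \<Longrightarrow> label0 (map Suc sh) (Col (Suc j)) = label0 sh (Col j)"
  using label0_map_Suc[of sh "Col j"] by (cases "sh = []") (auto simp: set_border)

lemma label0_snoc0_Row:
  "ferrers sh \<Longrightarrow> i < nrows sh \<Longrightarrow> label0 (sh @ [0]) (Row i) = label0 sh (Row i)"
  by (simp add: set_border)

lemma label0_snoc0_Col:
  "ferrers sh \<Longrightarrow> j < ncols sh \<Longrightarrow> label0 (sh @ [0]) (Col j) = label0 sh (Col j)"
  by (simp add: set_border)

lemma label0_bound_Row: "ferrers sh \<Longrightarrow> i < nrows sh \<Longrightarrow> label0 sh (Row i) < nrows sh + ncols sh"
  using label0_less[of "Row i" sh] by (auto simp: set_border length_border)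

lemma label0_bound_Col: "ferrers sh \<Longrightarrow> j < ncols sh \<Longrightarrow> label0 sh (Col j) < nrows sh + ncols sh"
  using label0_less[of "Col j" sh] by (auto simp: set_border length_border)

lemmas label0_simps = label0_map_Suc_Row label0_map_Suc_Col label0_map_Suc_new
  label0_snoc0_Row label0_snoc0_Col label0_snoc0_new label0_bound_Row label0_bound_Col length_border

lemma label0_Row_mono:
  "ferrers sh \<Longrightarrow> i < i' \<Longrightarrow> i' < nrows sh \<Longrightarrow> label0 sh (Row i) < label0 sh (Row i')"
proof (induction arbitrary: i i' rule: ferrers_induct)
  case (row sh)
  then show ?case by (cases "i' = nrows sh") (auto simp: label0_simps)
qed (auto simp: label0_simps)

lemma label0_Col_antimono:
  "ferrers sh \<Longrightarrow> j < j' \<Longrightarrow> j' < ncols sh \<Longrightarrow> label0 sh (Col j') < label0 sh (Col j)"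
proof (induction arbitrary: j j' rule: ferrers_induct)
  case (col sh)
  then show ?case by (cases j; cases j') (auto simp: label0_simps)
qed (auto simp: label0_simps)

text \<open>
  The geometric meaning of the labels: a row meets a column iff the right end of the row comes
  before the bottom of the column on the border.
\<close>
lemma label0_cell:
  "ferrers sh \<Longrightarrow> i < nrows sh \<Longrightarrow> j < ncols sh \<Longrightarrow>
    label0 sh (Row i) < label0 sh (Col j) \<longleftrightarrow> (i, j) \<in> cells sh"
proof (induction arbitrary: i j rule: ferrers_induct)
  case (row sh)
  have *: "\<not> nrows sh + ncols sh < label0 sh (Col j)" using label0_bound_Col[of sh j] row by simp
  show ?case using row * by (cases "i = nrows sh")
    (auto simp: label0_simps cells_def nth_append nrows_def[symmetric])
next
  case (col sh)
  then show ?case using label0_bound_Row[of sh i]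
    by (cases j) (auto simp: label0_simps cells_def nrows_def)
qed auto

lemma label0_Row0: "sh \<noteq> [] \<Longrightarrow> label0 sh (Row 0) = 0"
  by (cases sh) (auto simp: label0_def border_def ncols_def)

lemma shape_unique:
  "ferrers sh \<Longrightarrow> ferrers sh' \<Longrightarrow> map is_row (border sh) = map is_row (border sh') \<Longrightarrow> sh = sh'"
proof (induction arbitrary: sh' rule: ferrers_induct)
  case empty
  then have "border sh' = []" by simp
  then show ?case using length_border[OF empty(1)] by (simp add: nrows_def)
next
  case (row sh)
  from row.prems(1) show ?case
    by (cases rule: ferrers_cases) (use row in \<open>auto simp: comp_def\<close>)
next
  case (col sh)
  from col.prems(1) show ?case
    by (cases rule: ferrers_cases) (use col in \<open>auto simp: comp_def\<close>)
qed

text \<open>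
  The first step has to be a row step: \<open>ncols\<close> is the length of the first row, so a
  shape cannot have columns to the right of that row.
\<close>
lemma shape_exists:
  "bs \<noteq> [] \<Longrightarrow> hd bs \<Longrightarrow> \<exists>sh. ferrers sh \<and> sh \<noteq> [] \<and> map is_row (border sh) = bs"
proof (induction bs rule: rev_induct)
  case (snoc b bs)
  show ?case
  proof (cases "bs = []")
    case True
    then show ?thesis using snoc.prems
      by (intro exI[of _ "[] @ [0]"], simp only: ferrers_snoc0 border_snoc0) auto
  next
    case False
    then obtain sh where sh: "ferrers sh" "sh \<noteq> []" "map is_row (border sh) = bs"
      using snoc by (auto simp: hd_append)
    then show ?thesis
      by (intro exI[of _ "if b then sh @ [0] else map Suc sh"]) (auto simp: comp_def)
  qed
qed auto

section \<open>Tree-tableaux and Le-tableaux\<close>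

text \<open>
  The column in which the tree-tableau has its leftmost dot of row \<open>i\<close>. Column \<open>j\<close> of the
  Le-tableau is column \<open>Suc j\<close> of the tree-tableau, and the deleted column 0 is the default.
\<close>
definition leftmost :: "tableau \<Rightarrow> nat \<Rightarrow> nat" where
  "leftmost = (\<lambda>(sh, S) i.
     Max (insert 0 (Suc ` {j. j < sh ! i \<and> (\<exists>i'<i. (i', j) \<in> S) \<and> (i, j) \<notin> S})))"

definition F_inv :: "tableau \<Rightarrow> tableau" where
  "F_inv = (\<lambda>(sh, S). (map Suc sh, {(i, leftmost (sh, S) i) | i. i < nrows sh} \<union>
     {(i, Suc j) | i j. (i, j) \<in> S \<and> (\<forall>i'<i. (i', j) \<notin> S)}))"

lemma leftmost_ge:
  "j < sh ! i \<Longrightarrow> i' < i \<Longrightarrow> (i', j) \<in> S \<Longrightarrow> (i, j) \<notin> S \<Longrightarrow> Suc j \<le> leftmost (sh, S) i"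
  unfolding leftmost_def by (auto intro!: Max_ge)

lemma leftmost_cases:
  obtains "leftmost (sh, S) i = 0"
  | j where "leftmost (sh, S) i = Suc j" "j < sh ! i" "\<exists>i'<i. (i', j) \<in> S" "(i, j) \<notin> S"
proof -
  let ?Z = "insert 0 (Suc ` {j. j < sh ! i \<and> (\<exists>i'<i. (i', j) \<in> S) \<and> (i, j) \<notin> S})"
  have "Max ?Z \<in> ?Z" by (rule Max_in) auto
  then show ?thesis using that by (auto simp: leftmost_def)
qed

lemma F_map_map_Suc:
  "F_map (map Suc sh, D) = (sh, {(i, j). (i, j) \<in> cells sh \<and>
     (\<exists>j'\<le>j. (i, j') \<in> D) \<and> (\<exists>i'\<le>i. (i', Suc j) \<in> D)})"
  by (auto simp: F_map_def cells_def less_Suc_eq_le comp_def)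

lemma first_above:
  assumes "(i, j) \<in> (S :: cell set)"
  obtains i0 where "i0 \<le> i" "(i0, j) \<in> S" "\<forall>i'<i0. (i', j) \<notin> S"
  using assms LeastI[of "\<lambda>i. (i, j) \<in> S" i] Least_le[of "\<lambda>i. (i, j) \<in> S"] not_less_Least[of _ "\<lambda>i. (i, j) \<in> S"]
  by blast

context
  fixes sh D
  assumes tree: "tree_tableau (map Suc sh, D)"
begin

lemma tree_cells: "(i, j) \<in> D \<Longrightarrow> (i, j) \<in> cells (map Suc sh)"
  using tree by (auto simp: tree_tableau_def filling_def)

lemma tree_xor:
  assumes "(i, j) \<in> D" "(i, j) \<noteq> (0, 0)"
  shows "(\<exists>i'<i. (i', j) \<in> D) \<longleftrightarrow> \<not> (\<exists>j'<j. (i, j') \<in> D)"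
proof -
  have "\<forall>(i, j) \<in> D - {(0, 0)}. (\<exists>i' < i. (i', j) \<in> D) \<noteq> (\<exists>j' < j. (i, j') \<in> D)"
    using tree by (simp add: tree_tableau_def)
  then show ?thesis using assms by blast
qed

lemma tree_row: "i < nrows sh \<Longrightarrow> \<exists>j. (i, j) \<in> D"
  and tree_root: "(0, 0) \<in> D"
  and tree_ferrers: "ferrers sh"
  using tree by (auto simp: tree_tableau_def filling_def)

lemma tree_nonempty: "sh \<noteq> []"
  using tree_cells[OF tree_root] by (auto simp: cells_def)

lemma tree_col: "j < ncols sh \<Longrightarrow> \<exists>i. (i, Suc j) \<in> D"
  using tree tree_nonempty by (auto simp: tree_tableau_def)

text \<open>
  The topmost dot of a column other than the first has a dot to its left, so its cell receives a
  1; hence the topmost 1 and the topmost dot of a column coincide.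
\<close>
lemma F_above:
  "(\<exists>i'\<le>i. (i', j) \<in> snd (F_map (map Suc sh, D))) \<longleftrightarrow> (\<exists>i'\<le>i. (i', Suc j) \<in> D)"
proof
  assume "\<exists>i'\<le>i. (i', Suc j) \<in> D"
  then obtain i' where i': "i' \<le> i" "(i', Suc j) \<in> D" by blast
  from i'(2) obtain i0 where i0: "i0 \<le> i'" "(i0, Suc j) \<in> D" "\<forall>i'<i0. (i', Suc j) \<notin> D"
    by (rule first_above)
  then obtain j' where "j' < Suc j" "(i0, j') \<in> D" using tree_xor[of i0 "Suc j"] by auto
  then have "(i0, j) \<in> snd (F_map (map Suc sh, D))"
    using i0 tree_cells[OF i0(2)] by (auto simp: F_map_map_Suc cells_def less_Suc_eq_le)
  then show "\<exists>i'\<le>i. (i', j) \<in> snd (F_map (map Suc sh, D))" using i0 i' le_trans by blast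
qed (auto simp: F_map_map_Suc intro: le_trans)

lemma F_above_strict:
  "(\<exists>i'<i. (i', j) \<in> snd (F_map (map Suc sh, D))) \<longleftrightarrow> (\<exists>i'<i. (i', Suc j) \<in> D)"
  using F_above[of "i - 1" j] by (cases i) (auto simp: less_Suc_eq_le)

lemma F_Le: "Le_tableau (F_map (map Suc sh, D))"
proof -
  define S where "S = snd (F_map (map Suc sh, D))"
  have X: "F_map (map Suc sh, D) = (sh, S)" by (simp add: S_def F_map_map_Suc)
  have "S \<subseteq> cells sh" by (auto simp: S_def F_map_map_Suc)
  moreover have "\<exists>i. (i, j) \<in> S" if "j < ncols sh" for j
    using tree_col[OF that] F_above[of _ j] by (auto simp: S_def)
  moreover have "(i, j) \<in> S" if "(i, j) \<in> cells sh" "i' < i" "(i', j) \<in> S" "j' < j" "(i, j') \<in> S" for i j i' j'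
    using that by (auto simp: S_def F_map_map_Suc) (meson le_trans less_imp_le)+
  ultimately show ?thesis unfolding X using tree_ferrers
    by (auto simp: Le_tableau_def filling_def)
qed

lemma F_inv_F: "F_inv (F_map (map Suc sh, D)) = (map Suc sh, D)"
proof -
  define S where "S = snd (F_map (map Suc sh, D))"
  have X: "F_map (map Suc sh, D) = (sh, S)" by (simp add: S_def F_map_map_Suc)
  have S: "(i, j) \<in> S \<longleftrightarrow> (i, j) \<in> cells sh \<and> (\<exists>j'\<le>j. (i, j') \<in> D) \<and> (\<exists>i'\<le>i. (i', Suc j) \<in> D)" for i j
    by (auto simp: S_def F_map_map_Suc)
  note above = F_above[folded S_def] and above' = F_above_strict[folded S_def]
  have top: "(i, j) \<in> S \<and> (\<forall>i'<i. (i', j) \<notin> S) \<longleftrightarrow> (i, Suc j) \<in> D \<and> (\<exists>j'<Suc j. (i, j') \<in> D)" for i j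
  proof
    assume *: "(i, j) \<in> S \<and> (\<forall>i'<i. (i', j) \<notin> S)"
    then have "\<not> (\<exists>i'<i. (i', Suc j) \<in> D)" using above' by blast
    then show "(i, Suc j) \<in> D \<and> (\<exists>j'<Suc j. (i, j') \<in> D)"
      using * S by (auto simp: le_less less_Suc_eq_le)
  next
    assume *: "(i, Suc j) \<in> D \<and> (\<exists>j'<Suc j. (i, j') \<in> D)"
    then have "\<not> (\<exists>i'<i. (i', Suc j) \<in> D)" using tree_xor[of i "Suc j"] by auto
    then have "\<forall>i'<i. (i', j) \<notin> S" using above' by blast
    then show "(i, j) \<in> S \<and> (\<forall>i'<i. (i', j) \<notin> S)"
      using * S tree_cells[of i "Suc j"] by (auto simp: less_Suc_eq_le cells_def)
  qed
  have left: "(i, leftmost (sh, S) i) \<in> D \<and> \<not> (\<exists>j'<leftmost (sh, S) i. (i, j') \<in> D)"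
    if i: "i < nrows sh" for i
  proof -
    define m where "m = (LEAST j. (i, j) \<in> D)"
    have m: "(i, m) \<in> D" unfolding m_def using tree_row[OF i] by (rule LeastI_ex)
    have m_le: "j \<ge> m" if "(i, j) \<in> D" for j unfolding m_def using that by (rule Least_le)
    have "leftmost (sh, S) i = m"
      unfolding leftmost_def prod.case
    proof (rule Max_eqI)
      fix y assume "y \<in> insert 0 (Suc ` {j. j < sh ! i \<and> (\<exists>i'<i. (i', j) \<in> S) \<and> (i, j) \<notin> S})"
      then consider "y = 0" | j i' where "y = Suc j" "j < sh ! i" "i' < i" "(i', j) \<in> S" "(i, j) \<notin> S"
        by blast
      then show "y \<le> m"
      proof cases
        case 2
        then have "\<exists>i'<i. (i', Suc j) \<in> D" using above' by blast
        then have "\<not> m \<le> j" using 2 S[of i j] m i by (auto simp: cells_def nrows_def intro: less_imp_le)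
        then show ?thesis using 2 by simp
      qed simp
    next
      show "m \<in> insert 0 (Suc ` {j. j < sh ! i \<and> (\<exists>i'<i. (i', j) \<in> S) \<and> (i, j) \<notin> S})"
      proof (cases m)
        case (Suc j)
        then have "\<exists>i'<i. (i', Suc j) \<in> D" using tree_xor[of i m] m m_le by (auto simp: not_le[symmetric])
        then have "\<exists>i'<i. (i', j) \<in> S" using above' by blast
        moreover have "(i, j) \<notin> S" using S[of i j] m_le Suc by fastforce
        moreover have "j < sh ! i" using tree_cells[OF m] Suc by (auto simp: cells_def)
        ultimately show ?thesis using Suc by auto
      qed simp
    qed simp
    then show ?thesis using m m_le by (auto simp: not_le[symmetric])
  qed
  have "(i, j) \<in> snd (F_inv (sh, S)) \<longleftrightarrow> (i, j) \<in> D" for i j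
  proof
    assume "(i, j) \<in> snd (F_inv (sh, S))"
    then show "(i, j) \<in> D" using left top by (auto simp: F_inv_def)
  next
    assume D: "(i, j) \<in> D"
    have i: "i < nrows sh" using tree_cells[OF D] by (simp add: cells_def nrows_def)
    show "(i, j) \<in> snd (F_inv (sh, S))"
    proof (cases "\<exists>j'<j. (i, j') \<in> D")
      case True
      then obtain k where "j = Suc k" by (cases j) auto
      then show ?thesis using top[of i k] D True by (auto simp: F_inv_def)
    next
      case False
      then have "j = leftmost (sh, S) i" using left[OF i] D by (metis linorder_neqE_nat)
      then show ?thesis using i by (auto simp: F_inv_def)
    qed
  qed
  then have "snd (F_inv (sh, S)) = D" by auto
  moreover have "fst (F_inv (sh, S)) = map Suc sh" by (simp add: F_inv_def)
  ultimately show ?thesis unfolding X by (metis prod.collapse)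
qed

end

context
  fixes sh S
  assumes Le: "Le_tableau (sh, S)" and ne: "sh \<noteq> []"
begin

lemma Le_cell: "(i, j) \<in> S \<Longrightarrow> i < nrows sh \<and> j < sh ! i"
  using Le by (auto simp: Le_tableau_def filling_def cells_def nrows_def)

lemma Le_fill:
  "i < nrows sh \<Longrightarrow> j < sh ! i \<Longrightarrow> i' < i \<Longrightarrow> (i', j) \<in> S \<Longrightarrow> j' < j \<Longrightarrow> (i, j') \<in> S \<Longrightarrow> (i, j) \<in> S"
  using Le by (fastforce simp: Le_tableau_def cells_def nrows_def)

text \<open>
  This is where the Le-condition enters: a 0 with a 1 above it cannot lie to the right of a 1
  of the same row.
\<close>
lemma leftmost_le_one:
  assumes "(i, j) \<in> S"
  shows "leftmost (sh, S) i \<le> j"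
proof (cases rule: leftmost_cases[of sh S i])
  case (2 k)
  then have "\<not> j \<le> k" using Le_fill[of i k _ j] assms Le_cell[OF assms] by (auto simp: le_less)
  then show ?thesis using 2 by simp
qed simp

lemma F_inv_mem:
  "(i, j) \<in> snd (F_inv (sh, S)) \<longleftrightarrow> (i < nrows sh \<and> j = leftmost (sh, S) i) \<or>
    (\<exists>k. j = Suc k \<and> (i, k) \<in> S \<and> (\<forall>i'<i. (i', k) \<notin> S))"
  by (auto simp: F_inv_def)

lemma F_inv_above:
  "(\<exists>i'\<le>i. (i', Suc j) \<in> snd (F_inv (sh, S))) \<longleftrightarrow> (\<exists>i'\<le>i. (i', j) \<in> S)"
proof
  assume "\<exists>i'\<le>i. (i', Suc j) \<in> snd (F_inv (sh, S))"
  then obtain i' where i': "i' \<le> i" "(i', Suc j) \<in> snd (F_inv (sh, S))" by blast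
  show "\<exists>i'\<le>i. (i', j) \<in> S"
  proof (cases "(i', j) \<in> S")
    case False
    then have *: "leftmost (sh, S) i' = Suc j" using i'(2) F_inv_mem[of i' "Suc j"] by auto
    show ?thesis by (cases rule: leftmost_cases[of sh S i']) (use * i' in \<open>auto intro: less_imp_le less_le_trans\<close>)
  qed (use i' in auto)
next
  assume "\<exists>i'\<le>i. (i', j) \<in> S"
  then obtain i' where i': "i' \<le> i" "(i', j) \<in> S" by blast
  from i'(2) obtain i0 where "i0 \<le> i'" "(i0, j) \<in> S" "\<forall>i'<i0. (i', j) \<notin> S" by (rule first_above)
  then show "\<exists>i'\<le>i. (i', Suc j) \<in> snd (F_inv (sh, S))"
    using F_inv_mem[of i0 "Suc j"] i'(1) by (auto intro: le_trans)
qed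

lemma F_inv_above_strict:
  "(\<exists>i'<i. (i', Suc j) \<in> snd (F_inv (sh, S))) \<longleftrightarrow> (\<exists>i'<i. (i', j) \<in> S)"
  using F_inv_above[of "i - 1" j] by (cases i) (auto simp: less_Suc_eq_le)

lemma F_F_inv: "F_map (F_inv (sh, S)) = (sh, S)"
proof -
  define D where "D = snd (F_inv (sh, S))"
  have X: "F_inv (sh, S) = (map Suc sh, D)" by (simp add: D_def F_inv_def)
  have "(i, j) \<in> cells sh \<and> (\<exists>j'\<le>j. (i, j') \<in> D) \<and> (\<exists>i'\<le>i. (i', Suc j) \<in> D) \<longleftrightarrow> (i, j) \<in> S" for i j
  proof
    assume ij: "(i, j) \<in> S"
    then have "i < nrows sh" "j < sh ! i" using Le_cell by auto
    moreover have "(i, leftmost (sh, S) i) \<in> D" using calculation by (auto simp: D_def F_inv_mem)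
    moreover have "\<exists>i'\<le>i. (i', Suc j) \<in> D" using F_inv_above ij by (auto simp: D_def)
    ultimately show "(i, j) \<in> cells sh \<and> (\<exists>j'\<le>j. (i, j') \<in> D) \<and> (\<exists>i'\<le>i. (i', Suc j) \<in> D)"
      using leftmost_le_one[OF ij] by (auto simp: cells_def nrows_def)
  next
    assume *: "(i, j) \<in> cells sh \<and> (\<exists>j'\<le>j. (i, j') \<in> D) \<and> (\<exists>i'\<le>i. (i', Suc j) \<in> D)"
    then obtain j' where j': "j' \<le> j" "(i, j') \<in> D" by blast
    have ij: "i < nrows sh" "j < sh ! i" using * by (auto simp: cells_def nrows_def)
    show "(i, j) \<in> S"
    proof (rule ccontr)
      assume n: "(i, j) \<notin> S"
      obtain i' where i': "i' \<le> i" "(i', j) \<in> S" using F_inv_above * D_def by blast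
      then have "i' < i" using n by (cases "i' = i") auto
      then have "Suc j \<le> leftmost (sh, S) i" using leftmost_ge[OF ij(2)] i' n by blast
      then obtain k where "j' = Suc k" "(i, k) \<in> S" using j' by (auto simp: D_def F_inv_mem)
      then have "(i, j) \<in> S" using Le_fill[OF ij \<open>i' < i\<close> i'(2), of k] j' by auto
      then show False using n by simp
    qed
  qed
  then show ?thesis unfolding X F_map_map_Suc by auto
qed

lemma tree_F_inv: "tree_tableau (F_inv (sh, S))"
proof -
  define D where "D = snd (F_inv (sh, S))"
  have X: "F_inv (sh, S) = (map Suc sh, D)" by (simp add: D_def F_inv_def)
  note D = F_inv_mem[folded D_def]
  have "ferrers sh" using Le by (simp add: Le_tableau_def filling_def)
  moreover have "D \<subseteq> cells (map Suc sh)"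
  proof clarify
    fix i j assume "(i, j) \<in> D"
    then consider "i < nrows sh" "j = leftmost (sh, S) i" | k where "j = Suc k" "(i, k) \<in> S"
      using D by auto
    then show "(i, j) \<in> cells (map Suc sh)"
    proof cases
      case 1
      then show ?thesis
        by (cases rule: leftmost_cases[of sh S i]) (auto simp: cells_def nrows_def)
    next
      case 2
      then show ?thesis using Le_cell by (auto simp: cells_def nrows_def)
    qed
  qed
  moreover have "nonempty_rows (map Suc sh)" by (simp add: nonempty_rows_def nrows_def)
  moreover have root: "(0, 0) \<in> D"
  proof -
    have "leftmost (sh, S) 0 = 0" by (cases rule: leftmost_cases[of sh S 0]) auto
    then show ?thesis using ne by (auto simp: D nrows_def)
  qed
  moreover have "(\<exists>i'<i. (i', j) \<in> D) \<noteq> (\<exists>j'<j. (i, j') \<in> D)" if ij: "(i, j) \<in> D" "(i, j) \<noteq> (0, 0)" for i j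
  proof -
    consider (left) "i < nrows sh" "j = leftmost (sh, S) i"
      | (top) k where "j = Suc k" "(i, k) \<in> S" "\<forall>i'<i. (i', k) \<notin> S"
      using D ij by auto
    then show ?thesis
    proof cases
      case left
      show ?thesis
      proof (cases rule: leftmost_cases[of sh S i])
        case 1
        then show ?thesis using root left ij by auto
      next
        case (2 k)
        have False if j': "j' < j" "(i, j') \<in> D" for j'
        proof -
          obtain k' where "j' = Suc k'" "(i, k') \<in> S" using j' left D by auto
          then show False using 2 j' left Le_fill[of i k _ k'] by auto
        qed
        moreover have "\<exists>i'<i. (i', j) \<in> D" using F_inv_above_strict[of i k] 2 left by (auto simp: D_def)
        ultimately show ?thesis by blast
      qed
    next
      case top
      have "(i, leftmost (sh, S) i) \<in> D" "leftmost (sh, S) i < j"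
        using leftmost_le_one[OF top(2)] Le_cell[OF top(2)] top(1) D by auto
      moreover have "\<not> (\<exists>i'<i. (i', j) \<in> D)" using F_inv_above_strict[of i k] top by (auto simp: D_def)
      ultimately show ?thesis by blast
    qed
  qed
  moreover have "\<exists>j. (i, j) \<in> D" if "i < nrows sh" for i using D that by blast
  moreover have "\<exists>i. (i, j) \<in> D" if "j < ncols (map Suc sh)" for j
  proof (cases j)
    case 0
    then show ?thesis using root by auto
  next
    case (Suc k)
    then have "k < ncols sh" using that ne by simp
    then obtain i where "(i, k) \<in> S" using Le by (auto simp: Le_tableau_def)
    then show ?thesis using F_inv_above[of i k] Suc by (auto simp: D_def)
  qed
  ultimately show ?thesis unfolding X by (auto simp: tree_tableau_def filling_def)
qed

end

theorem F_bij:
  assumes "n \<ge> 1"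
  shows "bij_betw F_map (tree_tableaux n) (Le_tableaux n)"
proof (rule bij_betw_byWitness[where f' = F_inv])
  have tree: "\<exists>sh' D. X = (map Suc sh', D) \<and> tree_tableau (map Suc sh', D) \<and>
      nrows sh' + ncols sh' = n" if X0: "X \<in> tree_tableaux n" for X
  proof -
    obtain sh D where X: "X = (sh, D)" "tree_tableau (sh, D)" "nrows sh + ncols sh - 1 = n"
      using X0 by (cases X) (auto simp: tree_tableaux_def)
    have "sh = map Suc (map (\<lambda>l. l - 1) sh)"
      using X(2) by (auto simp: tree_tableau_def nonempty_rows_def nrows_def intro!: nth_equalityI)
    moreover have "sh \<noteq> []" using X(3) assms by (auto simp: nrows_def)
    ultimately show ?thesis using X
      by (intro exI[of _ "map (\<lambda>l. l - 1) sh"] exI[of _ D])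
        (metis (no_types, lifting) add_Suc_right diff_Suc_1 map_is_Nil_conv ncols_simps(3) nrows_simps(3))
  qed
  have Le: "\<exists>sh S. X = (sh, S) \<and> Le_tableau (sh, S) \<and> sh \<noteq> [] \<and> nrows sh + ncols sh = n"
    if "X \<in> Le_tableaux n" for X
    using that assms by (auto simp: Le_tableaux_def nrows_def)
  show "\<forall>X\<in>tree_tableaux n. F_inv (F_map X) = X" using tree F_inv_F by blast
  show "\<forall>X\<in>Le_tableaux n. F_map (F_inv X) = X" using Le F_F_inv by blast
  show "F_map ` tree_tableaux n \<subseteq> Le_tableaux n"
  proof (rule image_subsetI)
    fix X assume "X \<in> tree_tableaux n"
    then obtain sh D where "X = (map Suc sh, D)" "tree_tableau (map Suc sh, D)" "nrows sh + ncols sh = n"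
      using tree by blast
    then show "F_map X \<in> Le_tableaux n"
      using F_Le[of sh D] by (simp add: Le_tableaux_def F_map_map_Suc)
  qed
  show "F_inv ` Le_tableaux n \<subseteq> tree_tableaux n"
  proof (rule image_subsetI)
    fix X assume "X \<in> Le_tableaux n"
    then obtain sh S where "X = (sh, S)" "Le_tableau (sh, S)" "sh \<noteq> []" "nrows sh + ncols sh = n"
      using Le by blast
    then show "F_inv X \<in> tree_tableaux n"
      using tree_F_inv[of sh S] by (simp add: tree_tableaux_def F_inv_def)
  qed
qed

section \<open>Inserting a cycle into a permutation\<close>

text \<open>
  The permutations of \<open>{1..n}\<close> as words; places are counted from 0 here, so
  left-to-right maxima are sets of places in \<open>{..<n}\<close>.
\<close>
lemma perm_iff_nth:
  "w \<in> permutations_of_set {1..n} \<longleftrightarrow> length w = n \<and> bij_betw ((!) w) {..<n} {1..n}"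
proof
  assume w: "w \<in> permutations_of_set {1..n}"
  then have "length w = n" using length_finite_permutations_of_set by fastforce
  then show "length w = n \<and> bij_betw ((!) w) {..<n} {1..n}"
    using w bij_betw_nth[of w "{..<n}" "{1..n}"] by (auto simp: permutations_of_set_def)
next
  assume w: "length w = n \<and> bij_betw ((!) w) {..<n} {1..n}"
  then have "set w = {1..n}" by (auto simp: bij_betw_def set_conv_nth)
  moreover have "distinct w" using w by (auto simp: bij_betw_def distinct_conv_nth inj_on_def)
  ultimately show "w \<in> permutations_of_set {1..n}" by (simp add: permutations_of_set_def)
qed

lemma perm_length: "w \<in> permutations_of_set {1..n} \<Longrightarrow> length w = n"
  unfolding perm_iff_nth by blast

lemma perm_snoc_max:
  "w @ [Suc n] \<in> permutations_of_set {1..Suc n} \<longleftrightarrow> w \<in> permutations_of_set {1..n}"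
proof -
  have "set w = {1..n} \<longleftrightarrow> insert (Suc n) (set w) = {1..Suc n}" if "Suc n \<notin> set w"
    using that insert_ident[of "Suc n" "set w" "{1..n}"] by (simp add: atLeastAtMostSuc_conv)
  moreover have "Suc n \<notin> {1..n}" by simp
  ultimately show ?thesis unfolding permutations_of_set_def by auto
qed

definition records :: "nat list \<Rightarrow> nat set" where
  "records w = {p. p < length w \<and> (\<forall>q<p. w ! q < w ! p)}"

text \<open>
  The cyclic permutation of the places \<open>P\<close> together with the new place \<open>n\<close>: each place
  goes to the next larger one, and \<open>n\<close> goes back to the smallest. It describes how a path turns
  in the new leftmost column, where it descends from one 1 to the next.
\<close>
definition cycle_on :: "nat set \<Rightarrow> nat \<Rightarrow> nat \<Rightarrow> nat" where
  "cycle_on P n p = (if p = n then Min P else if p \<in> P then Min {q \<in> insert n P. p < q} else p)"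

definition insert_cycle :: "nat set \<Rightarrow> nat list \<Rightarrow> nat list" where
  "insert_cycle P w =
     map (\<lambda>p. (w @ [Suc (length w)]) ! cycle_on P (length w) p) [0..<Suc (length w)]"

lemma cycle_on_in:
  assumes "P \<subseteq> {..<n}" "p \<in> P"
  shows "p < cycle_on P n p" "cycle_on P n p \<in> insert n P"
    "\<And>q. q \<in> insert n P \<Longrightarrow> p < q \<Longrightarrow> cycle_on P n p \<le> q"
proof -
  have p: "p < n" using assms by auto
  let ?Q = "{q \<in> insert n P. p < q}"
  have c: "cycle_on P n p = Min ?Q" using assms p by (simp add: cycle_on_def)
  have fin: "finite ?Q" using assms(1) finite_subset[of P "{..<n}"] by auto
  moreover have "?Q \<noteq> {}" using p by auto
  ultimately have "Min ?Q \<in> ?Q" by (rule Min_in)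
  then show "p < cycle_on P n p" "cycle_on P n p \<in> insert n P" using c by auto
  show "cycle_on P n p \<le> q" if "q \<in> insert n P" "p < q" for q
    using that fin c by (auto intro: Min_le)
qed

lemma cycle_on_out: "p \<notin> P \<Longrightarrow> p \<noteq> n \<Longrightarrow> cycle_on P n p = p"
  by (simp add: cycle_on_def)

lemma cycle_on_last:
  assumes "P \<subseteq> {..<n}" "P \<noteq> {}"
  shows "cycle_on P n n \<in> P" "\<And>q. q \<in> P \<Longrightarrow> cycle_on P n n \<le> q"
proof -
  have "finite P" using assms(1) finite_subset by blast
  then show "cycle_on P n n \<in> P" "\<And>q. q \<in> P \<Longrightarrow> cycle_on P n n \<le> q"
    using assms(2) by (auto simp: cycle_on_def)
qed

lemma cycle_on_bij:
  assumes P: "P \<subseteq> {..<n}" "P \<noteq> {}"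
  shows "bij_betw (cycle_on P n) {..n} {..n}"
proof -
  have to: "cycle_on P n ` {..n} \<subseteq> {..n}"
  proof clarify
    fix p assume "p \<le> n"
    then show "cycle_on P n p \<le> n"
      using cycle_on_in(2)[OF P(1), of p] cycle_on_out[of p P n] cycle_on_last(1)[OF P] P(1)
      by (cases "p = n"; cases "p \<in> P") auto
  qed
  have *: "cycle_on P n p \<noteq> cycle_on P n q" if "p < q" "q \<le> n" for p q
  proof (cases "p \<in> P")
    case True
    note p = cycle_on_in[OF P(1) True]
    show ?thesis
    proof (cases "q \<in> P")
      case True
      then show ?thesis using p(3)[of q] cycle_on_in(1)[OF P(1) True] that by auto
    next
      case False
      then show ?thesis using p cycle_on_out[of q P n] cycle_on_last(2)[OF P \<open>p \<in> P\<close>] that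
        by (cases "q = n") auto
    qed
  next
    case False
    then have "cycle_on P n p = p" using that by (simp add: cycle_on_out)
    then show ?thesis using False that cycle_on_in(1)[OF P(1), of q] cycle_on_out[of q P n]
        cycle_on_last(1)[OF P] by (cases "q = n"; cases "q \<in> P") auto
  qed
  have "inj_on (cycle_on P n) {..n}"
    by (rule linorder_inj_onI) (use * in auto)
  then show ?thesis using endo_inj_surj[OF _ to] by (simp add: bij_betw_def)
qed

lemma length_insert_cycle [simp]: "length (insert_cycle P w) = Suc (length w)"
  by (simp add: insert_cycle_def)

lemma insert_cycle_nth:
  "p \<le> length w \<Longrightarrow> insert_cycle P w ! p = (w @ [Suc (length w)]) ! cycle_on P (length w) p"
  by (simp add: insert_cycle_def del: upt_Suc)

lemma insert_cycle_perm:
  assumes w: "w \<in> permutations_of_set {1..n}" and P: "P \<subseteq> {..<n}" "P \<noteq> {}"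
  shows "insert_cycle P w \<in> permutations_of_set {1..Suc n}"
proof -
  have n: "length w = n" using w by (rule perm_length)
  have "bij_betw ((!) (w @ [Suc n]) \<circ> cycle_on P n) {..n} {1..Suc n}"
    by (rule bij_betw_trans[OF cycle_on_bij[OF P]])
      (use iffD2[OF perm_snoc_max w] in \<open>simp only: perm_iff_nth lessThan_Suc_atMost\<close>)
  then have "bij_betw ((!) (insert_cycle P w)) {..<Suc n} {1..Suc n}"
    unfolding lessThan_Suc_atMost
    by (rule iffD1[OF bij_betw_cong, rotated]) (simp add: insert_cycle_nth n)
  then show ?thesis unfolding perm_iff_nth by (simp add: n)
qed

lemma records_snoc_max:
  assumes "w \<in> permutations_of_set {1..n}"
  shows "records (w @ [Suc n]) = insert n (records w)"
proof -
  have "w ! q < Suc n" if "q < n" for q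
    using assms that bij_betw_apply[of "(!) w" "{..<n}" "{1..n}" q] unfolding perm_iff_nth by auto
  then show ?thesis using perm_length[OF assms]
    by (auto simp: records_def nth_append less_Suc_eq)
qed

text \<open>
  Since \<open>P\<close> consists of left-to-right maxima, replacing the letter at each place of \<open>P\<close> by
  the letter at the next place of \<open>P\<close> makes it larger. A left-to-right maximum strictly between two
  places of \<open>P\<close> (or after the last one) is thereby overtaken by the letter at the previous place of
  \<open>P\<close>, those before \<open>Min P\<close> are unaffected, and the smallest letter from \<open>P\<close> moves to the end. So
  \<open>P\<close> can be read off from the result.
\<close>
lemma records_insert_cycle:
  assumes w: "w \<in> permutations_of_set {1..n}" and P: "P \<subseteq> records w" "P \<noteq> {}"
  shows "records (insert_cycle P w) = {p \<in> records w. p \<in> P \<or> (\<forall>a\<in>P. p < a)}"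
    and "P = {p \<in> records (insert_cycle P w). insert_cycle P w ! n < insert_cycle P w ! p}"
    and "insert_cycle P w ! n \<noteq> Suc n"
proof -
  define v where "v = w @ [Suc n]"
  define w' where "w' = insert_cycle P w"
  have n: "length w = n" using w by (rule perm_length)
  have Pn: "P \<subseteq> {..<n}" using P(1) n by (auto simp: records_def)
  have rec_v: "v ! q < v ! p" if "p \<in> insert n P" "q < p" for p q
    using that records_snoc_max[OF w] P(1) by (auto simp: records_def v_def)
  have w'_nth: "w' ! p = v ! cycle_on P n p" if "p \<le> n" for p
    using that insert_cycle_nth[of p w P] by (simp add: w'_def v_def n)
  have v_nth: "v ! p = w ! p" if "p < n" for p using that n by (simp add: v_def nth_append)
  note last = cycle_on_last[OF Pn P(2)]
  have above: "w' ! n < w' ! p" if "p \<in> P" for p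
  proof -
    have "cycle_on P n n < cycle_on P n p" using last(2)[OF that] cycle_on_in(1)[OF Pn that] by simp
    then show ?thesis using rec_v[of "cycle_on P n p"] cycle_on_in(2)[OF Pn that] w'_nth that Pn
      by auto
  qed
  have rec1: "p \<in> records w'" if "p \<in> P" for p
  proof -
    have "w' ! q < w' ! p" if q: "q < p" for q
    proof -
      have "cycle_on P n q < cycle_on P n p"
        using cycle_on_in(3)[OF Pn, of q p] cycle_on_in(1)[OF Pn \<open>p \<in> P\<close>] cycle_on_out[of q P n]
          \<open>p \<in> P\<close> q Pn by (cases "q \<in> P") auto
      then show ?thesis
        using rec_v[OF cycle_on_in(2)[OF Pn \<open>p \<in> P\<close>]] w'_nth[of p] w'_nth[of q] \<open>p \<in> P\<close> q Pn
        by auto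
    qed
    then show ?thesis using that Pn by (auto simp: records_def w'_def n)
  qed
  have low: "w' ! p = w ! p" if "p < n" "\<forall>a\<in>P. p < a" for p
    using that w'_nth[of p] v_nth[of p] cycle_on_out[of p P n] by auto
  have rec2: "p \<in> records w' \<longleftrightarrow> p \<in> records w" if "p < n" "\<forall>a\<in>P. p < a" for p
    using low that by (auto simp: records_def w'_def n) (metis less_trans)+
  have rec3: "p \<notin> records w'" if p: "p \<le> n" "p \<notin> P" "a \<in> P" "a < p" for p a
  proof (cases "p = n")
    case True
    then show ?thesis using above[of a] that by (auto simp: records_def)
  next
    case False
    define b where "b = Max {q \<in> P. q < p}"
    have fin: "finite {q \<in> P. q < p}" by auto
    have "b \<in> {q \<in> P. q < p}" unfolding b_def by (rule Max_in[OF fin]) (use p in auto)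
    then have b: "b \<in> P" "b < p" by auto
    have "\<not> cycle_on P n b \<le> p"
    proof
      assume "cycle_on P n b \<le> p"
      then have "cycle_on P n b \<in> {q \<in> P. q < p}"
        using cycle_on_in(2)[OF Pn b(1)] False p by (auto simp: le_less)
      then show False using Max_ge[OF fin] cycle_on_in(1)[OF Pn b(1)] by (auto simp: b_def not_le[symmetric])
    qed
    then have "v ! p < v ! cycle_on P n b" using rec_v cycle_on_in(2)[OF Pn b(1)] by auto
    then have "w' ! p < w' ! b" using w'_nth[of p] w'_nth[of b] cycle_on_out[of p P n] p b False by auto
    then show ?thesis using b by (auto simp: records_def)
  qed
  have length_perm: "p \<in> records w' \<Longrightarrow> p \<le> n" for p by (auto simp: records_def w'_def n)
  have "p \<in> records w' \<longleftrightarrow> p \<in> records w \<and> (p \<in> P \<or> (\<forall>a\<in>P. p < a))" for p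
  proof (cases "p \<in> P")
    case True
    then show ?thesis using rec1 P by auto
  next
    case False
    note F = this
    show ?thesis
    proof (cases "\<forall>a\<in>P. p < a")
      case True
      then have "p < n" using Pn P(2) by (meson equals0I lessThan_iff less_trans subsetD)
      then show ?thesis using True rec2 by auto
    next
      case False
      then obtain a where "a \<in> P" "a < p" using F by (metis linorder_neqE_nat)
      then show ?thesis using rec3[of p a] length_perm F False by auto
    qed
  qed
  then show *: "records (insert_cycle P w) = {p \<in> records w. p \<in> P \<or> (\<forall>a\<in>P. p < a)}"
    by (auto simp: w'_def)
  have "\<not> w' ! n < w' ! p" if "p \<in> records w" "\<forall>a\<in>P. p < a" for p
  proof -
    have "p < n" using that n by (auto simp: records_def)
    moreover have "v ! p < v ! cycle_on P n n" using rec_v last(1) that(2) by auto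
    ultimately show ?thesis using low[of p] that w'_nth[of n] v_nth[of p] by auto
  qed
  then show "P = {p \<in> records (insert_cycle P w). insert_cycle P w ! n < insert_cycle P w ! p}"
    using * above rec1 by (auto simp: w'_def)
  show "insert_cycle P w ! n \<noteq> Suc n"
  proof -
    have "insert_cycle P w \<in> permutations_of_set {1..Suc n}"
      by (rule insert_cycle_perm[OF w Pn P(2)])
    moreover obtain p where "p \<in> P" using P(2) by auto
    moreover have "p < n" using Pn calculation(2) by auto
    ultimately show ?thesis
      using above[of p] bij_betw_apply[of "(!) w'" "{..<Suc n}" "{1..Suc n}" p]
      unfolding w'_def perm_iff_nth by auto
  qed
qed

lemma insert_cycle_inj:
  assumes "length u = length w" "P \<subseteq> {..<length w}" "P \<noteq> {}" "insert_cycle P u = insert_cycle P w"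
  shows "u = w"
proof -
  let ?n = "length w"
  have "u ! p = w ! p" if "p < ?n" for p
  proof -
    obtain q where "q \<le> ?n" "cycle_on P ?n q = p"
      using cycle_on_bij[OF assms(2,3)] \<open>p < ?n\<close> unfolding bij_betw_def
      by (metis (no_types, lifting) atMost_iff image_iff less_imp_le)
    then show ?thesis using insert_cycle_nth[of q u P] insert_cycle_nth[of q w P] assms that
      by (auto simp: nth_append)
  qed
  then show ?thesis using assms(1) by (auto intro: nth_equalityI)
qed

lemma record_above:
  assumes "q < length (w :: nat list)"
  shows "\<exists>r\<le>q. r \<in> records w \<and> w ! q \<le> w ! r"
  using assms
proof (induction q rule: less_induct)
  case (less q)
  show ?case
  proof (cases "q \<in> records w")
    case False
    then obtain p where "p < q" "w ! q \<le> w ! p" using less.prems by (auto simp: records_def not_less)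
    then show ?thesis using less.IH[of p] less.prems by (meson le_trans less_imp_le less_trans)
  qed auto
qed

text \<open>
  The previous lemma dictates the choice of \<open>P\<close>. That \<open>P\<close> consists of left-to-right maxima
  of the word with the cycle removed holds because a larger letter at an earlier place would be
  dominated by a left-to-right maximum of \<open>w'\<close>, which belongs to \<open>P\<close>.
\<close>
lemma insert_cycle_surj:
  assumes w': "w' \<in> permutations_of_set {1..Suc n}" and nlast: "w' ! n \<noteq> Suc n"
  shows "\<exists>w P. w \<in> permutations_of_set {1..n} \<and> P \<subseteq> records w \<and> P \<noteq> {} \<and> w' = insert_cycle P w"
proof -
  define P where "P = {p \<in> records w'. w' ! n < w' ! p}"
  have length_perm: "length w' = Suc n" using w' by (rule perm_length)
  have inj: "inj_on ((!) w') {..<Suc n}" and im: "(!) w' ` {..<Suc n} = {1..Suc n}"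
    using w' unfolding perm_iff_nth bij_betw_def by auto
  have Pn: "P \<subseteq> {..<n}" using length_perm by (auto simp: P_def records_def less_Suc_eq)
  have le: "w' ! p \<le> Suc n" if "p \<le> n" for p using im that by (auto simp: lessThan_Suc_atMost)
  have "Suc n \<in> (!) w' ` {..<Suc n}" using im by auto
  then obtain m where m: "m \<le> n" "w' ! m = Suc n" by (metis imageE lessThan_iff less_Suc_eq_le)
  have mP: "m \<in> P"
  proof -
    have "w' ! q < w' ! m" if "q < m" for q
    proof -
      have "w' ! q \<noteq> w' ! m" using inj_onD[OF inj, of q m] that m by auto
      then show ?thesis using le[of q] that m by auto
    qed
    moreover have "w' ! n < w' ! m" using nlast le[of n] m by auto
    ultimately show ?thesis using m length_perm by (auto simp: P_def records_def)
  qed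
  then have P0: "P \<noteq> {}" by auto
  note bij = cycle_on_bij[OF Pn P0]
  \<comment> \<open>The predecessor along the cycle: composing with \<open>c\<close> undoes the insertion.\<close>
  define c where "c = inv_into {..n} (cycle_on P n)"
  have c: "c p \<le> n \<and> cycle_on P n (c p) = p" if "p \<le> n" for p
    using bij that inv_into_into[of p "cycle_on P n" "{..n}"] f_inv_into_f[of p "cycle_on P n" "{..n}"]
    by (auto simp: c_def bij_betw_def)
  have c_cycle: "c (cycle_on P n p) = p" if "p \<le> n" for p
    using bij that by (simp add: c_def bij_betw_def)
  have cbij: "bij_betw c {..n} {..n}" unfolding c_def by (rule bij_betw_inv_into[OF bij])
  define v where "v = map (\<lambda>p. w' ! c p) [0..<Suc n]"
  define w where "w = butlast v"
  have "bij_betw ((!) w' \<circ> c) {..n} {1..Suc n}"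
    by (rule bij_betw_trans[OF cbij]) (use w' in \<open>simp only: perm_iff_nth lessThan_Suc_atMost\<close>)
  then have "bij_betw ((!) v) {..n} {1..Suc n}"
    by (rule iffD1[OF bij_betw_cong, rotated]) (simp add: v_def del: upt_Suc)
  then have v_perm: "v \<in> permutations_of_set {1..Suc n}"
    unfolding perm_iff_nth by (simp add: v_def lessThan_Suc_atMost)
  have "cycle_on P n m = n"
  proof (rule ccontr)
    assume "cycle_on P n m \<noteq> n"
    then have "cycle_on P n m \<in> P" using cycle_on_in(2)[OF Pn mP] by auto
    then have "w' ! m < w' ! cycle_on P n m" "cycle_on P n m \<le> n"
      using cycle_on_in(1)[OF Pn mP] Pn by (auto simp: P_def records_def)
    then show False using le m by fastforce
  qed
  then have "c n = m" using c_cycle[OF m(1)] by simp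
  then have v: "v = w @ [Suc n]" using m by (simp add: v_def w_def)
  have w: "w \<in> permutations_of_set {1..n}" using v_perm unfolding v perm_snoc_max .
  have lw: "length w = n" using w by (rule perm_length)
  have v_nth: "v ! p = w' ! c p" if "p \<le> n" for p using that by (simp add: v_def del: upt_Suc)
  have "w' = insert_cycle P w"
  proof (rule nth_equalityI)
    fix p assume "p < length w'"
    then have p: "p \<le> n" using length_perm by simp
    have "cycle_on P n p \<le> n" using bij p by (auto simp: bij_betw_def)
    then show "w' ! p = insert_cycle P w ! p"
      using insert_cycle_nth[of p w P] v_nth c_cycle[OF p] p v lw by simp
  qed (use length_perm lw in auto)
  moreover have "P \<subseteq> records w"
  proof
    fix p assume p: "p \<in> P"
    have "w ! q < w ! p" if "q < p" for q
    proof (rule ccontr)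
      assume "\<not> w ! q < w ! p"
      have qn: "q \<le> n" "p \<le> n" "q < n" "p < n" using p that Pn by auto
      have "inj_on ((!) w) {..<n}" using w unfolding perm_iff_nth bij_betw_def by blast
      then have "w ! q \<noteq> w ! p" using that qn by (auto simp: inj_on_def)
      then have "w ! p < w ! q" using \<open>\<not> w ! q < w ! p\<close> by simp
      then have less: "w' ! c p < w' ! c q" using v_nth v lw qn by (metis nth_append)
      have cp: "c p \<in> insert n P"
        using c[OF qn(2)] p cycle_on_out[of "c p" P n] by (metis insert_iff)
      then have ge: "w' ! n \<le> w' ! c p" by (auto simp: P_def)
      then have "c q \<noteq> n" using less by auto
      then have cq: "c q \<le> q"
        using c[OF qn(1)] cycle_on_in(1)[OF Pn, of "c q"] cycle_on_out[of "c q" P n]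
        by (cases "c q \<in> P") auto
      obtain r where r: "r \<le> c q" "r \<in> records w'" "w' ! c q \<le> w' ! r"
        using record_above[of "c q" w'] c[OF qn(1)] length_perm by auto
      have rP: "r \<in> P" using r less ge by (auto simp: P_def)
      have rp: "r < p" using r cq that by auto
      show False
      proof (cases "c p = n")
        case True
        then show ?thesis using cycle_on_last(2)[OF Pn P0 rP] c[OF qn(2)] rp by auto
      next
        case False
        then have cpP: "c p \<in> P" using cp by auto
        have "\<not> c p < r" using cycle_on_in(3)[OF Pn cpP, of r] c[OF qn(2)] rp rP by auto
        then have "r < c p \<or> r = c p" by auto
        then have "w' ! r \<le> w' ! c p" using cpP by (auto simp: P_def records_def less_imp_le)
        then show False using r less by simp
      qed
    qed
    then show "p \<in> records w" using p Pn lw by (auto simp: records_def)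
  qed
  ultimately show ?thesis using w P0 by blast
qed

section \<open>Le-tableaux and the bijection Phi\<close>

definition add_row :: "tableau \<Rightarrow> tableau" where
  "add_row = (\<lambda>(sh, T). (sh @ [0], T))"

definition add_col :: "nat set \<Rightarrow> tableau \<Rightarrow> tableau" where
  "add_col A = (\<lambda>(sh, T). (map Suc sh, {(i, 0) | i. i \<in> A} \<union> {(i, Suc j) | i j. (i, j) \<in> T}))"

text \<open>
  The rows that may receive a 1 in a new leftmost column: a 1 at the left end of a row forces a
  1 in each cell of the row that lies below some 1.
\<close>
definition free_rows :: "tableau \<Rightarrow> nat set" where
  "free_rows = (\<lambda>(sh, T). {i. i < nrows sh \<and>
     (\<forall>j < sh ! i. (\<exists>i'<i. (i', j) \<in> T) \<longrightarrow> (i, j) \<in> T)})"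

lemma in_add_col [simp]:
  "(i, 0) \<in> snd (add_col A (sh, T)) \<longleftrightarrow> i \<in> A"
  "(i, Suc j) \<in> snd (add_col A (sh, T)) \<longleftrightarrow> (i, j) \<in> T"
  "fst (add_col A (sh, T)) = map Suc sh"
  by (auto simp: add_col_def)

lemma cells_snoc0 [simp]: "cells (sh @ [0]) = cells sh"
  by (auto simp: cells_def nth_append split: if_splits)

lemma cells_map_Suc [simp]:
  "(i, 0) \<in> cells (map Suc sh) \<longleftrightarrow> i < nrows sh"
  "(i, Suc j) \<in> cells (map Suc sh) \<longleftrightarrow> (i, j) \<in> cells sh"
  by (auto simp: cells_def nrows_def)

lemma Le_add_row: "Le_tableau (sh @ [0], T) \<longleftrightarrow> Le_tableau (sh, T)"
  by (simp add: Le_tableau_def filling_def)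

lemma free_rows_add_row:
  "Le_tableau (sh, T) \<Longrightarrow> free_rows (sh @ [0], T) = insert (nrows sh) (free_rows (sh, T))"
  by (auto simp: free_rows_def nth_append nrows_def less_Suc_eq)

lemma Le_Ball_split:
  "(\<forall>(i, j) \<in> cells (map Suc sh). Q i j) \<longleftrightarrow>
     (\<forall>i < nrows sh. Q i 0) \<and> (\<forall>(i, j) \<in> cells sh. Q i (Suc j))"
proof -
  have "cells (map Suc sh) = (\<lambda>i. (i, 0)) ` {..<nrows sh} \<union> (\<lambda>(i, j). (i, Suc j)) ` cells sh"
    by (auto simp: cells_def nrows_def image_iff) (metis Suc_less_eq not0_implies_Suc)
  then show ?thesis by auto
qed

lemma All_less_Suc_split: "(\<forall>j < Suc n. Q j) \<longleftrightarrow> Q 0 \<and> (\<forall>j < n. Q (Suc j))"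
  using less_Suc_eq_0_disj by auto

lemma Ex_less_Suc_split: "(\<exists>j < Suc n. Q j) \<longleftrightarrow> Q 0 \<or> (\<exists>j < n. Q (Suc j))"
  using less_Suc_eq_0_disj by auto

lemma Le_add_col:
  assumes "sh \<noteq> []"
  shows "Le_tableau (add_col A (sh, T)) \<longleftrightarrow>
    Le_tableau (sh, T) \<and> A \<noteq> {} \<and> A \<subseteq> free_rows (sh, T)"
proof -
  define S where "S = snd (add_col A (sh, T))"
  have S0: "(i, 0) \<in> S \<longleftrightarrow> i \<in> A" and S1: "(i, Suc j) \<in> S \<longleftrightarrow> (i, j) \<in> T" for i j
    by (auto simp: S_def)
  have X: "add_col A (sh, T) = (map Suc sh, S)" by (simp add: S_def add_col_def)
  have sub: "S \<subseteq> cells (map Suc sh) \<longleftrightarrow> T \<subseteq> cells sh \<and> A \<subseteq> {..<nrows sh}"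
  proof
    assume *: "S \<subseteq> cells (map Suc sh)"
    show "T \<subseteq> cells sh \<and> A \<subseteq> {..<nrows sh}"
      using * S0 S1 cells_map_Suc by (metis (no_types, lifting) lessThan_iff subrelI subsetD subsetI)
  next
    assume *: "T \<subseteq> cells sh \<and> A \<subseteq> {..<nrows sh}"
    show "S \<subseteq> cells (map Suc sh)"
    proof clarify
      fix i j assume "(i, j) \<in> S" then show "(i, j) \<in> cells (map Suc sh)"
        using * S0 S1 by (cases j) auto
    qed
  qed
  have free: "A \<subseteq> free_rows (sh, T) \<longleftrightarrow> A \<subseteq> {..<nrows sh} \<and>
      (\<forall>(i, j) \<in> cells sh. (\<exists>i'<i. (i', j) \<in> T) \<and> i \<in> A \<longrightarrow> (i, j) \<in> T)"
    by (auto simp: free_rows_def cells_def nrows_def)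
  show ?thesis
    unfolding X Le_tableau_def filling_def prod.case Le_Ball_split sub free
    using assms by (auto simp: S0 S1 All_less_Suc_split Ex_less_Suc_split)
qed

lemma free_rows_add_col:
  assumes "A \<subseteq> free_rows (sh, T)"
  shows "free_rows (add_col A (sh, T)) = {i \<in> free_rows (sh, T). i \<in> A \<or> (\<forall>a\<in>A. i < a)}"
proof -
  have 1: "i \<in> free_rows (add_col A (sh, T)) \<longleftrightarrow> i < nrows sh \<and> ((\<exists>i'<i. i' \<in> A) \<longrightarrow> i \<in> A) \<and>
      (\<forall>j < sh ! i. (\<exists>i'<i. (i', j) \<in> T) \<longrightarrow> (i, j) \<in> T)" for i
    by (cases "i < nrows sh") (simp_all add: free_rows_def add_col_def nrows_def All_less_Suc_split)
  have 2: "i \<in> free_rows (sh, T) \<longleftrightarrow> i < nrows sh \<and>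
      (\<forall>j < sh ! i. (\<exists>i'<i. (i', j) \<in> T) \<longrightarrow> (i, j) \<in> T)" for i
    by (simp add: free_rows_def)
  have 3: "((\<exists>i'<i. i' \<in> A) \<longrightarrow> i \<in> A) \<longleftrightarrow> (i \<in> A \<or> (\<forall>a\<in>A. i < a))" for i
    by (metis less_asym linorder_neqE_nat)
  show ?thesis unfolding set_eq_iff mem_Collect_eq 1 2 3 by blast
qed

lemma Le_cases:
  assumes "Le_tableau (sh, T)"
  obtains (empty) "sh = []" "T = {}"
  | (row) sh' where "Le_tableau (sh', T)" "(sh, T) = add_row (sh', T)"
  | (col) sh' T' A where "Le_tableau (sh', T')" "sh' \<noteq> []" "A \<noteq> {}" "A \<subseteq> free_rows (sh', T')"
      "(sh, T) = add_col A (sh', T')"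
proof -
  have "ferrers sh" using assms by (auto simp: Le_tableau_def filling_def)
  then show ?thesis
  proof (cases rule: ferrers_cases)
    case empty
    then show ?thesis using assms that(1) by (auto simp: Le_tableau_def filling_def cells_def)
  next
    case (row sh')
    then show ?thesis using that(2)[of sh'] assms by (auto simp: add_row_def Le_add_row)
  next
    case (col sh')
    define A where "A = {i. (i, 0) \<in> T}"
    define T' where "T' = {(i, j). (i, Suc j) \<in> T}"
    have "(i, j) \<in> T \<longleftrightarrow> (i, j) \<in> snd (add_col A (sh', T'))" for i j
      by (cases j) (auto simp: A_def T'_def)
    then have "T = snd (add_col A (sh', T'))" by auto
    then have eq: "(sh, T) = add_col A (sh', T')" using col by (simp add: add_col_def)
    then show ?thesis using that(3)[of sh' T' A] assms col Le_add_col[of sh' A T'] by simp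
  qed
qed

lemma travel_snoc0: "travel (sh @ [0]) T d i j = travel sh T d i j"
proof (induction sh T d i j rule: travel.induct)
  case (1 sh T d i j)
  then show ?case
    by (subst (1 2) travel.simps) (simp split: heading.split)
qed

lemma travel_shift:
  "travel (map Suc sh) (snd (add_col A (sh, T))) d i (Suc j) = shift_col (travel sh T d i j)"
proof (induction sh T d i j rule: travel.induct)
  case (1 sh T d i j)
  then show ?case
    by (subst (1 2) travel.simps) (simp split: heading.split)
qed

text \<open>
  A path that descends in the new column leaves it at the next 1 and then follows that row of
  the old tableau.
\<close>
lemma travel_down_col0:
  assumes "A \<subseteq> {..<nrows sh}" "i \<le> nrows sh"
  shows "travel (map Suc sh) (snd (add_col A (sh, T))) Downward i 0 =
    (if \<exists>r\<in>A. i \<le> r then shift_col (travel sh T Rightward (Min {r \<in> A. i \<le> r}) 0) else Col 0)"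
  using assms(2)
proof (induction rule: inc_induct)
  case base
  then show ?case using assms(1) by (subst travel.simps) auto
next
  case (step i)
  show ?case
  proof (cases "i \<in> A")
    case True
    have "Min {r \<in> A. i \<le> r} = i"
      by (rule Min_eqI) (use True finite_subset[OF assms(1)] in auto)
    then show ?thesis using True step.hyps travel_shift[of sh A T Rightward i 0]
      by (subst travel.simps) auto
  next
    case False
    then have "i \<le> r \<longleftrightarrow> Suc i \<le> r" if "r \<in> A" for r using that by (metis Suc_leI le_less Suc_leD)
    then have "{r \<in> A. i \<le> r} = {r \<in> A. Suc i \<le> r}" "(\<exists>r\<in>A. i \<le> r) \<longleftrightarrow> (\<exists>r\<in>A. Suc i \<le> r)"
      by auto
    then show ?thesis using False step by (subst travel.simps) auto
  qed
qed

lemma exit_add_col: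
  assumes "A \<subseteq> {..<nrows sh}"
  shows "exit_from (add_col A (sh, T)) (Col (Suc j)) = shift_col (exit_from (sh, T) (Col j))"
    and "A \<noteq> {} \<Longrightarrow> exit_from (add_col A (sh, T)) (Col 0) = shift_col (exit_from (sh, T) (Row (Min A)))"
    and "i < nrows sh \<Longrightarrow> exit_from (add_col A (sh, T)) (Row i) =
      (if i \<in> A
       then if \<exists>r\<in>A. i < r then shift_col (exit_from (sh, T) (Row (Min {r \<in> A. i < r}))) else Col 0
       else shift_col (exit_from (sh, T) (Row i)))"
proof -
  have X: "add_col A (sh, T) = (map Suc sh, snd (add_col A (sh, T)))" by (simp add: add_col_def)
  show "exit_from (add_col A (sh, T)) (Col (Suc j)) = shift_col (exit_from (sh, T) (Col j))"
    by (subst X) (simp add: travel_shift)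
  show "exit_from (add_col A (sh, T)) (Col 0) = shift_col (exit_from (sh, T) (Row (Min A)))"
    if "A \<noteq> {}"
    using travel_down_col0[OF assms, of 0 T] that by (subst X) auto
  show "exit_from (add_col A (sh, T)) (Row i) =
      (if i \<in> A
       then if \<exists>r\<in>A. i < r then shift_col (exit_from (sh, T) (Row (Min {r \<in> A. i < r}))) else Col 0
       else shift_col (exit_from (sh, T) (Row i)))" if "i < nrows sh"
  proof -
    have "travel (map Suc sh) (snd (add_col A (sh, T))) Rightward i 0 =
      (if i \<in> A then travel (map Suc sh) (snd (add_col A (sh, T))) Downward (Suc i) 0
       else travel (map Suc sh) (snd (add_col A (sh, T))) Rightward i (Suc 0))"
      by (subst travel.simps) (simp add: that)
    then show ?thesis
    using travel_down_col0[OF assms, of "Suc i" T] travel_shift[of sh A T Rightward i 0] that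
    by (subst X) (auto simp: Suc_le_eq)
  qed
qed

lemma travel_in_border:
  "ferrers sh \<Longrightarrow> (d = Rightward \<longrightarrow> i < nrows sh) \<Longrightarrow> (d = Downward \<longrightarrow> j < ncols sh) \<Longrightarrow>
    travel sh T d i j \<in> set (border sh)"
proof (induction sh T d i j rule: travel.induct)
  case (1 sh T d i j)
  have "i < nrows sh \<and> j < ncols sh" if "(i, j) \<in> cells sh"
    using that ferrers_nth_le[OF 1(3), of i] by (auto simp: cells_def nrows_def)
  then show ?case using 1
    by (subst travel.simps) (auto simp: set_border split: heading.split)
qed

lemma exit_in_border:
  "ferrers sh \<Longrightarrow> s \<in> set (border sh) \<Longrightarrow> exit_from (sh, T) s \<in> set (border sh)"
  by (cases s; simp; rule travel_in_border; auto simp: set_border)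

lemma length_Phi: "ferrers sh \<Longrightarrow> length (Phi (sh, T)) = nrows sh + ncols sh"
  by (simp add: Phi_def length_border)

lemma Phi_nth:
  "s \<in> set (border sh) \<Longrightarrow> Phi (sh, T) ! label0 sh s = label1 sh (exit_from (sh, T) s)"
  by (simp add: Phi_def label0_less border_label0)

lemma Phi_add_row:
  assumes "ferrers sh"
  shows "Phi (add_row (sh, T)) = Phi (sh, T) @ [Suc (nrows sh + ncols sh)]"
proof -
  have "exit_from (sh @ [0], T) s = exit_from (sh, T) s" for s
    by (cases s) (auto simp: travel_snoc0)
  moreover have "exit_from (sh, T) (Row (nrows sh)) = Row (nrows sh)"
    by (simp, subst travel.simps, simp add: cells_def nrows_def)
  ultimately show ?thesis
    using assms exit_in_border[OF assms]
    by (auto simp: Phi_def add_row_def label1_def label0_snoc0_new length_border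
        simp del: exit_from.simps)
qed

text \<open>
  A path that enters row \<open>i\<close> with \<open>i \<in> A\<close> turns down in the new column and continues like the
  old path of the next row in \<open>A\<close>, or leaves at the bottom of the column if there is none; the path
  entering at the top of the new column continues like the path of the first row in \<open>A\<close>. All other
  paths are unchanged. This is composition with \<open>cycle_on\<close>.
\<close>
lemma Phi_add_col:
  assumes sh: "ferrers sh" "sh \<noteq> []" and A: "A \<subseteq> {..<nrows sh}" "A \<noteq> {}"
  shows "Phi (add_col A (sh, T)) = insert_cycle ((\<lambda>i. label0 sh (Row i)) ` A) (Phi (sh, T))"
proof (rule nth_equalityI)
  define lr where "lr = (\<lambda>i. label0 sh (Row i))"
  define n where "n = nrows sh + ncols sh"
  define S where "S = snd (add_col A (sh, T))"
  have X: "add_col A (sh, T) = (map Suc sh, S)" by (simp add: S_def add_col_def)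
  have sh': "ferrers (map Suc sh)" "map Suc sh \<noteq> []" using sh by auto
  have lenP: "length (Phi (sh, T)) = n" using sh by (simp add: n_def length_Phi)
  show "length (Phi (add_col A (sh, T))) = length (insert_cycle ((\<lambda>i. label0 sh (Row i)) ` A) (Phi (sh, T)))"
    using sh by (simp add: X length_Phi)
  fix p assume "p < length (Phi (add_col A (sh, T)))"
  then have p: "p \<le> n" using sh by (simp add: X length_Phi n_def)
  have mono: "strict_mono_on {..<nrows sh} lr"
    using label0_Row_mono[OF sh(1)] by (auto simp: lr_def strict_mono_on_def)
  have lr_iff: "lr i < lr i' \<longleftrightarrow> i < i'" if "i < nrows sh" "i' < nrows sh" for i i'
    using mono that by (simp add: strict_mono_on_less)
  have lr_Min: "Min (lr ` B) = lr (Min B)" if "B \<subseteq> A" "B \<noteq> {}" for B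
  proof (rule Min_eqI)
    have fin: "finite B" using that A by (meson finite_lessThan finite_subset)
    then show "finite (lr ` B)" "lr (Min B) \<in> lr ` B" using that by auto
    fix y assume "y \<in> lr ` B"
    then obtain b where "b \<in> B" "y = lr b" by auto
    moreover have "Min B \<in> B" "Min B \<le> b" using fin \<open>b \<in> B\<close> that by auto
    ultimately show "lr (Min B) \<le> y" using lr_iff[of b "Min B"] that A by (auto simp: not_less[symmetric])
  qed
  have lr_less: "lr i < n" if "i \<in> A" for i
    using label0_bound_Row[OF sh(1), of i] A that by (auto simp: lr_def n_def)
  have Suc_lab: "label1 (map Suc sh) (shift_col s) = label1 sh s" if "s \<in> set (border sh)" for s
    using that sh by (simp add: label1_def)
  have old: "label1 (map Suc sh) (shift_col (exit_from (sh, T) s)) = Phi (sh, T) ! label0 sh s"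
    if "s \<in> set (border sh)" for s
    using Suc_lab exit_in_border[OF sh(1) that] Phi_nth[OF that] by simp
  have rowb: "Row i \<in> set (border sh)" if "i \<in> A" for i using that A by (auto simp: set_border[OF sh(1)])
  define s where "s = border (map Suc sh) ! p"
  have s: "s \<in> set (border (map Suc sh))" "label0 (map Suc sh) s = p"
    using p sh' label0_border[OF sh'(1), of p] length_border[OF sh'(1)] length_border[OF sh(1)] sh(2)
    by (auto simp: s_def n_def simp del: border_map_Suc)
  have lhs: "Phi (add_col A (sh, T)) ! p = label1 (map Suc sh) (exit_from (map Suc sh, S) s)"
    using Phi_nth[OF s(1)] s(2) by (simp add: X)
  have rhs: "insert_cycle (lr ` A) (Phi (sh, T)) ! p = (Phi (sh, T) @ [Suc n]) ! cycle_on (lr ` A) n p"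
    using insert_cycle_nth[of p "Phi (sh, T)"] p by (simp add: lenP)
  have nth: "(Phi (sh, T) @ [Suc n]) ! label0 sh t = Phi (sh, T) ! label0 sh t" if "t \<in> set (border sh)" for t
    using label0_less[OF that] length_border[OF sh(1)] by (simp add: nth_append lenP n_def)
  note exits = exit_add_col[OF A(1), where T = T, unfolded X]
  have "s = Col 0 \<or> (\<exists>t \<in> set (border sh). s = shift_col t)" using s(1) sh(2) by auto
  then have "label1 (map Suc sh) (exit_from (map Suc sh, S) s) =
      (Phi (sh, T) @ [Suc n]) ! cycle_on (lr ` A) n p"
  proof
    assume s0: "s = Col 0"
    then have "p = n" using s(2) sh by (simp add: label0_map_Suc_new n_def length_border)
    then have "cycle_on (lr ` A) n p = lr (Min A)" using lr_Min[of A] A by (simp add: cycle_on_def)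
    moreover have "Min A \<in> A" using A by (meson Min_in finite_lessThan finite_subset)
    ultimately show ?thesis using exits(2) A s0 old[OF rowb] nth[OF rowb] by (simp add: lr_def)
  next
    assume "\<exists>t \<in> set (border sh). s = shift_col t"
    then obtain t where t: "t \<in> set (border sh)" "s = shift_col t" by auto
    have pt: "p = label0 sh t" using s(2) t sh by simp
    then have "p < n" using label0_less[OF t(1)] length_border[OF sh(1)] by (simp add: n_def)
    show ?thesis
    proof (cases "\<exists>i\<in>A. t = Row i")
      case True
      then obtain i where i: "i \<in> A" "t = Row i" by auto
      have pi: "p = lr i" using pt i by (simp add: lr_def)
      have iff: "lr i < lr r \<longleftrightarrow> i < r" if "r \<in> A" for r using lr_iff[of i r] i that A by auto
      show ?thesis
      proof (cases "\<exists>r\<in>A. i < r")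
        case True
        have fin: "finite {r \<in> A. i < r}" using finite_subset[OF A(1)] by auto
        have mem: "Min {r \<in> A. i < r} \<in> {r \<in> A. i < r}" by (rule Min_in[OF fin]) (use True in auto)
        have "Min {q \<in> insert n (lr ` A). p < q} = lr (Min {r \<in> A. i < r})"
        proof (rule Min_eqI)
          show "finite {q \<in> insert n (lr ` A). p < q}" using finite_subset[OF A(1)] by auto
          show "lr (Min {r \<in> A. i < r}) \<in> {q \<in> insert n (lr ` A). p < q}" using mem iff pi by auto
          fix y assume y: "y \<in> {q \<in> insert n (lr ` A). p < q}"
          show "lr (Min {r \<in> A. i < r}) \<le> y"
          proof (cases "y = n")
            case True
            then show ?thesis using mem lr_less by (auto intro: less_imp_le)
          next
            case False
            then obtain r where r: "r \<in> A" "y = lr r" "i < r" using y iff pi by auto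
            then have "Min {r \<in> A. i < r} \<le> r" using fin by auto
            then show ?thesis using r mem lr_iff[of r "Min {r \<in> A. i < r}"] A
              by (auto simp: not_less[symmetric])
          qed
        qed
        then have "cycle_on (lr ` A) n p = lr (Min {r \<in> A. i < r})"
          using \<open>p < n\<close> pi i by (simp add: cycle_on_def)
        then show ?thesis
          using exits(3)[of i] i t True A old[OF rowb] nth[OF rowb] mem by (auto simp: lr_def)
      next
        case False
        then have "{q \<in> insert n (lr ` A). p < q} = {n}" using iff pi \<open>p < n\<close> by auto
        then have "cycle_on (lr ` A) n p = n" using \<open>p < n\<close> pi i by (simp add: cycle_on_def)
        then show ?thesis using exits(3)[of i] i t False A sh
          by (auto simp: label1_def label0_map_Suc_new length_border n_def lenP nth_append)
      qed
    next
      case False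
      have "p \<notin> lr ` A"
      proof
        assume "p \<in> lr ` A"
        then obtain i where "i \<in> A" "label0 sh t = label0 sh (Row i)" using pt by (auto simp: lr_def)
        then have "t = Row i" using label0_inj[OF t(1) rowb] by simp
        then show False using False \<open>i \<in> A\<close> by auto
      qed
      then have "cycle_on (lr ` A) n p = p" using \<open>p < n\<close> by (simp add: cycle_on_out)
      moreover have "exit_from (map Suc sh, S) s = shift_col (exit_from (sh, T) t)"
        using exits(1,3) False t by (cases t) (auto simp: set_border[OF sh(1)])
      ultimately show ?thesis using old[OF t(1)] nth[OF t(1)] pt by simp
    qed
  qed
  then show "Phi (add_col A (sh, T)) ! p = insert_cycle ((\<lambda>i. label0 sh (Row i)) ` A) (Phi (sh, T)) ! p"
    using lhs rhs by (simp add: lr_def)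
qed


lemma Le_tableaux_iff: "X \<in> Le_tableaux n \<longleftrightarrow> Le_tableau X \<and> nrows (fst X) + ncols (fst X) = n"
  by (auto simp: Le_tableaux_def)

lemma Le_tableaux_0: "Le_tableaux 0 = {([], {})}"
  by (auto simp: Le_tableaux_def Le_tableau_def filling_def cells_def nrows_def)

lemma free_rows_bound: "free_rows X \<subseteq> {..<nrows (fst X)}"
  by (auto simp: free_rows_def)

lemma ferrers_Le: "Le_tableau X \<Longrightarrow> ferrers (fst X)"
  by (auto simp: Le_tableau_def filling_def)

lemma Le_tableaux_Suc_cases:
  assumes "X \<in> Le_tableaux (Suc n)"
  obtains (row) Y where "Y \<in> Le_tableaux n" "X = add_row Y"
  | (col) Y A where "Y \<in> Le_tableaux n" "A \<noteq> {}" "A \<subseteq> free_rows Y" "X = add_col A Y"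
proof -
  obtain sh T where X: "X = (sh, T)" by (cases X)
  have Le: "Le_tableau (sh, T)" using assms X by (simp add: Le_tableaux_iff)
  then show ?thesis
  proof (cases rule: Le_cases)
    case (row sh')
    then show ?thesis using that(1)[of "(sh', T)"] assms X by (auto simp: Le_tableaux_iff add_row_def)
  next
    case (col sh' T' A)
    then show ?thesis using that(2)[of "(sh', T')" A] assms X by (auto simp: Le_tableaux_iff add_col_def)
  qed (use assms X in \<open>simp add: Le_tableaux_iff\<close>)
qed

lemma add_row_Le_tableaux: "Y \<in> Le_tableaux n \<Longrightarrow> add_row Y \<in> Le_tableaux (Suc n)"
  by (cases Y) (auto simp: Le_tableaux_iff add_row_def Le_add_row)

lemma add_col_Le_tableaux:
  assumes "Y \<in> Le_tableaux n" "A \<noteq> {}" "A \<subseteq> free_rows Y"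
  shows "add_col A Y \<in> Le_tableaux (Suc n)"
proof -
  obtain sh T where Y: "Y = (sh, T)" by (cases Y)
  have "sh \<noteq> []" using free_rows_bound[of Y] assms Y by (auto simp: nrows_def)
  then show ?thesis using assms Le_add_col[of sh A T] by (simp add: Y Le_tableaux_iff)
qed

definition row_label :: "tableau \<Rightarrow> nat \<Rightarrow> nat" where
  "row_label X i = label0 (fst X) (Row i)"

lemma row_label_mono:
  "ferrers (fst X) \<Longrightarrow> strict_mono_on {..<nrows (fst X)} (row_label X)"
  by (auto simp: strict_mono_on_def row_label_def label0_Row_mono)

lemma Phi_add_col_free:
  assumes "Y \<in> Le_tableaux n" "A \<noteq> {}" "A \<subseteq> free_rows Y"
  shows "Phi (add_col A Y) = insert_cycle (row_label Y ` A) (Phi Y)"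
proof -
  obtain sh T where Y: "Y = (sh, T)" by (cases Y)
  have "sh \<noteq> []" using free_rows_bound[of Y] assms Y by (auto simp: nrows_def)
  then show ?thesis using Phi_add_col[of sh A T] ferrers_Le[of Y] assms free_rows_bound[of Y]
    by (auto simp: Y row_label_def Le_tableaux_iff)
qed

text \<open>
  Free rows and left-to-right maxima evolve in the same way: an empty row is free and its label
  is a new maximum, and after a column step both sets lose the elements outside \<open>A\<close> that come
  after the first element of \<open>A\<close>.
\<close>
lemma Phi_perm_records:
  "X \<in> Le_tableaux n \<Longrightarrow>
    Phi X \<in> permutations_of_set {1..n} \<and> records (Phi X) = row_label X ` free_rows X"
proof (induction n arbitrary: X)
  case 0
  then show ?case
    by (auto simp: Le_tableaux_0 Phi_def records_def free_rows_def nrows_def)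
next
  case (Suc n)
  from Suc.prems show ?case
  proof (cases rule: Le_tableaux_Suc_cases)
    case (row Y)
    obtain sh T where Y: "Y = (sh, T)" by (cases Y)
    have sh: "ferrers sh" "nrows sh + ncols sh = n" "Le_tableau (sh, T)"
      using row ferrers_Le Y by (auto simp: Le_tableaux_iff)
    note IH = Suc.IH[OF row(1), THEN conjunct1] Suc.IH[OF row(1), THEN conjunct2]
    have Phi: "Phi X = Phi Y @ [Suc n]" using Phi_add_row[OF sh(1), of T] sh row Y by simp
    have "records (Phi X) = insert n (row_label Y ` free_rows Y)"
      using records_snoc_max[OF IH(1)] IH(2) Phi by simp
    also have "\<dots> = row_label X ` free_rows X"
    proof -
      have "row_label X i = row_label Y i" if "i \<in> free_rows Y" for i
        using label0_snoc0_Row[OF sh(1)] that free_rows_bound[of Y]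
        by (auto simp: row_label_def Y row(2) add_row_def)
      moreover have "row_label X (nrows sh) = n"
        using label0_snoc0_new[OF sh(1)] sh(2) length_border[OF sh(1)]
        by (simp add: row_label_def Y row(2) add_row_def)
      ultimately show ?thesis
        using free_rows_add_row[OF sh(3)] by (simp add: row(2) Y add_row_def)
    qed
    finally show ?thesis using Phi IH(1) perm_snoc_max[of "Phi Y" n] by simp
  next
    case (col Y A)
    obtain sh T where Y: "Y = (sh, T)" by (cases Y)
    have sh: "ferrers sh" "nrows sh + ncols sh = n" "Le_tableau (sh, T)"
      using col ferrers_Le[of Y] Y by (auto simp: Le_tableaux_iff)
    note IH = Suc.IH[OF col(1), THEN conjunct1] Suc.IH[OF col(1), THEN conjunct2]
    have Phi: "Phi X = insert_cycle (row_label Y ` A) (Phi Y)"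
      using Phi_add_col_free[OF col(1-3)] col(4) by simp
    have P: "row_label Y ` A \<subseteq> records (Phi Y)" "row_label Y ` A \<noteq> {}" using IH col by auto
    have Pn: "row_label Y ` A \<subseteq> {..<n}" using P(1) perm_length[OF IH(1)] by (auto simp: records_def)
    have lab: "row_label X i = row_label Y i" if "i < nrows sh" for i
      using label0_map_Suc_Row[OF sh(1) that] by (simp add: row_label_def col(4) Y)
    have "records (Phi X) = {p \<in> row_label Y ` free_rows Y. p \<in> row_label Y ` A \<or> (\<forall>a\<in>row_label Y ` A. p < a)}"
      using records_insert_cycle(1)[OF IH(1) P] IH(2) Phi by simp
    also have "\<dots> = row_label Y ` {i \<in> free_rows Y. i \<in> A \<or> (\<forall>a\<in>A. i < a)}"
    proof -
      have less: "row_label Y i < row_label Y a \<longleftrightarrow> i < a" if "i \<in> free_rows Y" "a \<in> A" for i a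
      proof -
        have "i < nrows (fst Y)" "a < nrows (fst Y)" using that col(3) free_rows_bound[of Y] by auto
        then show ?thesis using strict_mono_on_less[OF row_label_mono[of Y]] sh(1) Y by auto
      qed
      have "row_label Y i \<in> row_label Y ` A \<longleftrightarrow> i \<in> A" if "i \<in> free_rows Y" for i
        using strict_mono_on_imp_inj_on[OF row_label_mono[of Y]] sh(1) Y that col(3) free_rows_bound[of Y]
        by (subst inj_on_image_mem_iff[where B = "{..<nrows sh}"]) auto
      then show ?thesis using less by auto
    qed
    also have "\<dots> = row_label Y ` free_rows X"
      using free_rows_add_col[of A sh T] col(3,4) Y by simp
    also have "\<dots> = row_label X ` free_rows X"
      using free_rows_bound[of X] lab by (intro image_cong) (auto simp: col(4) Y)
    finally show ?thesis using Phi insert_cycle_perm[OF IH(1) Pn P(2)] by simp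
  qed
qed

lemma Phi_inj: "inj_on Phi (Le_tableaux n)"
proof (induction n)
  case 0
  then show ?case by (simp add: Le_tableaux_0)
next
  case (Suc n)
  have nonfixed: "Phi (add_col A Y) ! n \<noteq> Suc n"
    if "Y \<in> Le_tableaux n" "A \<noteq> {}" "A \<subseteq> free_rows Y" for A Y
    using Phi_add_col_free[OF that] records_insert_cycle(3)[of "Phi Y" n "row_label Y ` A"]
      Phi_perm_records[OF that(1)] that by (simp add: image_mono)
  have fixed: "Phi (add_row Y) = Phi Y @ [Suc n]" "Phi (add_row Y) ! n = Suc n"
    if "Y \<in> Le_tableaux n" for Y
  proof -
    show "Phi (add_row Y) = Phi Y @ [Suc n]"
      using Phi_add_row[of "fst Y" "snd Y"] that ferrers_Le by (auto simp: Le_tableaux_iff)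
    then show "Phi (add_row Y) ! n = Suc n"
      using Phi_perm_records[OF that] perm_length by (metis nth_append_length)
  qed
  show ?case
  proof (rule inj_onI)
    fix X X' assume X: "X \<in> Le_tableaux (Suc n)" and X': "X' \<in> Le_tableaux (Suc n)"
      and eq: "Phi X = Phi X'"
    from X show "X = X'"
    proof (cases rule: Le_tableaux_Suc_cases)
      case (row Y)
      note r = this
      from X' show ?thesis
      proof (cases rule: Le_tableaux_Suc_cases)
        case (row Y')
        then show ?thesis using r eq fixed inj_onD[OF Suc.IH, of Y Y'] by auto
      next
        case (col Y' A')
        then show ?thesis using r eq fixed(2)[of Y] nonfixed[of Y' A'] by auto
      qed
    next
      case (col Y A)
      note c = this
      from X' show ?thesis
      proof (cases rule: Le_tableaux_Suc_cases)
        case (row Y')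
        then show ?thesis using c eq fixed(2)[of Y'] nonfixed[of Y A] by auto
      next
        case (col Y' A')
        note pr = Phi_perm_records[OF c(1)] and pr' = Phi_perm_records[OF col(1)]
        have P: "row_label Y ` A \<subseteq> records (Phi Y)" "row_label Y ` A \<noteq> {}"
          and P': "row_label Y' ` A' \<subseteq> records (Phi Y')" "row_label Y' ` A' \<noteq> {}"
          using pr pr' c col by (auto simp: image_mono)
        have eq': "insert_cycle (row_label Y ` A) (Phi Y) = insert_cycle (row_label Y' ` A') (Phi Y')"
          using Phi_add_col_free[OF c(1-3)] Phi_add_col_free[OF col(1-3)] c(4) col(4) eq by simp
        have PP: "row_label Y ` A = row_label Y' ` A'"
          using records_insert_cycle(2)[OF conjunct1[OF pr] P]
            records_insert_cycle(2)[OF conjunct1[OF pr'] P'] eq' by simp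
        have "length (Phi Y) = n" "length (Phi Y') = n" using pr pr' perm_length by blast+
        moreover have "row_label Y ` A \<subseteq> {..<n}" using P calculation by (auto simp: records_def)
        ultimately have "Phi Y = Phi Y'"
          using insert_cycle_inj[of "Phi Y" "Phi Y'" "row_label Y ` A"] P eq' PP by simp
        then have YY: "Y = Y'" using inj_onD[OF Suc.IH, of Y Y'] c col by auto
        have "inj_on (row_label Y) {..<nrows (fst Y)}"
          using strict_mono_on_imp_inj_on[OF row_label_mono[of Y]] ferrers_Le c(1)
          by (auto simp: Le_tableaux_iff)
        then have "A = A'" using PP YY c(3) col(3) free_rows_bound[of Y]
          by (metis inj_on_image_eq_iff subset_trans)
        then show ?thesis using YY c col by simp
      qed
    qed
  qed
qed

lemma Phi_surj: "w \<in> permutations_of_set {1..n} \<Longrightarrow> \<exists>X \<in> Le_tableaux n. Phi X = w"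
proof (induction n arbitrary: w)
  case 0
  then show ?case by (simp add: Le_tableaux_0 Phi_def)
next
  case (Suc n)
  have length_perm: "length w = Suc n" using Suc.prems by (rule perm_length)
  show ?case
  proof (cases "w ! n = Suc n")
    case True
    then have w: "w = butlast w @ [Suc n]" using length_perm
      by (metis append_butlast_last_id diff_Suc_1 last_conv_nth length_0_conv nat.distinct(1))
    then have "butlast w \<in> permutations_of_set {1..n}" using Suc.prems perm_snoc_max by metis
    then obtain Y where Y: "Y \<in> Le_tableaux n" "Phi Y = butlast w" using Suc.IH by blast
    then have "Phi (add_row Y) = w"
      using Phi_add_row[of "fst Y" "snd Y"] ferrers_Le[of Y] w by (auto simp: Le_tableaux_iff)
    then show ?thesis using add_row_Le_tableaux[OF Y(1)] by blast
  next
    case False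
    then obtain u P where u: "u \<in> permutations_of_set {1..n}" "P \<subseteq> records u" "P \<noteq> {}"
        "w = insert_cycle P u"
      using insert_cycle_surj[OF Suc.prems] by blast
    obtain Y where Y: "Y \<in> Le_tableaux n" "Phi Y = u" using Suc.IH[OF u(1)] by blast
    have "records u = row_label Y ` free_rows Y" using Phi_perm_records[OF Y(1)] Y(2) by simp
    then obtain A where A: "A \<subseteq> free_rows Y" "P = row_label Y ` A"
      using u(2) by (metis subset_imageE)
    then have "A \<noteq> {}" using u(3) by auto
    then show ?thesis
      using Phi_add_col_free[OF Y(1) _ A(1)] add_col_Le_tableaux[OF Y(1) _ A(1)] Y(2) A(2) u(4) by blast
  qed
qed

theorem Phi_bij: "bij_betw Phi (Le_tableaux n) (permutations_of_set {1..n})"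
  unfolding bij_betw_def
proof
  show "Phi ` Le_tableaux n = permutations_of_set {1..n}"
    using Phi_perm_records Phi_surj by blast
qed (rule Phi_inj)

section \<open>The bijection DE\<close>

definition letter :: "nat list \<Rightarrow> nat \<Rightarrow> nat" where
  "letter \<pi> i = (0 # \<pi>) ! i"

text \<open>
  The default letter \<open>letter \<pi> 0 = 0\<close> makes place 0 a right-to-left minimum as well; it
  serves as the end of an empty block before the first one.
\<close>
definition rl_min :: "nat list \<Rightarrow> nat \<Rightarrow> bool" where
  "rl_min \<pi> i \<longleftrightarrow> (\<forall>j. i < j \<and> j \<le> length \<pi> \<longrightarrow> letter \<pi> i < letter \<pi> j)"

text \<open>
  The letter of place \<open>i\<close> is the image, under \<open>DE \<pi>\<close>, of the letter that follows this place:
  inside a block the next letter, at the end of a block the first letter of the same block.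
\<close>
definition cycle_source :: "nat list \<Rightarrow> nat \<Rightarrow> nat" where
  "cycle_source \<pi> i = (if rl_min \<pi> i then Max {k. k < i \<and> letter \<pi> k < letter \<pi> i} else i)"

lemma letter_bij:
  assumes "\<pi> \<in> permutations_of_set {1..n}"
  shows "bij_betw (letter \<pi>) {1..n} {1..n}"
proof -
  have 1: "bij_betw (\<lambda>i. i - 1) {1..n} {..<n}"
    by (rule bij_betw_byWitness[where f' = Suc]) auto
  have 2: "bij_betw ((!) \<pi>) {..<n} {1..n}"
    using assms by (simp only: perm_iff_nth)
  have "letter \<pi> i = ((!) \<pi> \<circ> (\<lambda>i. i - 1)) i" if "i \<in> {1..n}" for i
    using that by (simp add: letter_def)
  then show ?thesis using bij_betw_trans[OF 1 2] bij_betw_cong by metis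
qed

context
  fixes \<pi> :: "nat list" and n :: nat
  assumes perm: "\<pi> \<in> permutations_of_set {1..n}"
begin

lemma length_perm: "length \<pi> = n"
  using perm by (rule perm_length)

lemma letter_0: "letter \<pi> 0 = 0"
  by (simp add: letter_def)

lemma letter_range: "1 \<le> i \<Longrightarrow> i \<le> n \<Longrightarrow> letter \<pi> i \<in> {1..n}"
  using letter_bij[OF perm] bij_betw_apply by fastforce

lemma letter_eq_iff: "i \<le> n \<Longrightarrow> j \<le> n \<Longrightarrow> letter \<pi> i = letter \<pi> j \<longleftrightarrow> i = j"
  using inj_on_eq_iff[OF bij_betw_imp_inj_on[OF letter_bij[OF perm]], of i j]
    letter_range[of i] letter_range[of j] letter_0
  by (cases "i = 0"; cases "j = 0") auto

lemma letter_onto: "x \<in> {1..n} \<Longrightarrow> \<exists>i\<in>{1..n}. letter \<pi> i = x"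
  using bij_betw_imp_surj_on[OF letter_bij[OF perm]] by (metis imageE)

lemma rl_min_last: "rl_min \<pi> n"
  by (simp add: rl_min_def length_perm)

lemma cycle_source_rl_min:
  assumes "rl_min \<pi> i" "1 \<le> i" "i \<le> n"
  shows "cycle_source \<pi> i < i" "letter \<pi> (cycle_source \<pi> i) < letter \<pi> i"
    "\<And>k. cycle_source \<pi> i < k \<Longrightarrow> k \<le> i \<Longrightarrow> letter \<pi> i \<le> letter \<pi> k"
proof -
  let ?K = "{k. k < i \<and> letter \<pi> k < letter \<pi> i}"
  have "0 \<in> ?K" using assms letter_range[of i] letter_0 by auto
  then have "Max ?K \<in> ?K" by (intro Max_in) auto
  then show "cycle_source \<pi> i < i" "letter \<pi> (cycle_source \<pi> i) < letter \<pi> i" using assms by (auto simp: cycle_source_def)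
  show "letter \<pi> i \<le> letter \<pi> k" if "cycle_source \<pi> i < k" "k \<le> i" for k
  proof (rule ccontr)
    assume "\<not> letter \<pi> i \<le> letter \<pi> k"
    then have "k \<in> ?K" using that by (cases "k = i") auto
    then have "k \<le> Max ?K" by (intro Max_ge) auto
    then show False using that assms by (simp add: cycle_source_def)
  qed
qed

lemma rl_min_cycle_source:
  assumes "rl_min \<pi> i" "1 \<le> i" "i \<le> n"
  shows "rl_min \<pi> (cycle_source \<pi> i)"
  unfolding rl_min_def length_perm
proof (intro allI impI)
  fix j assume j: "cycle_source \<pi> i < j \<and> j \<le> n"
  note s = cycle_source_rl_min[OF assms]
  show "letter \<pi> (cycle_source \<pi> i) < letter \<pi> j"
  proof (cases "j \<le> i")
    case True
    then show ?thesis using s j by (meson le_less_trans less_le_trans)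
  next
    case False
    then have "letter \<pi> i < letter \<pi> j" using assms(1) j by (simp add: rl_min_def length_perm)
    then show ?thesis using s by simp
  qed
qed

lemma cycle_source_less: "1 \<le> i \<Longrightarrow> i \<le> n \<Longrightarrow> cycle_source \<pi> i < n"
  using cycle_source_rl_min(1)[of i] rl_min_last by (cases "rl_min \<pi> i") (auto simp: cycle_source_def le_less)

lemma cycle_source_inj: "inj_on (cycle_source \<pi>) {1..n}"
proof (rule linorder_inj_onI)
  fix i j assume ij: "i < j" "i \<in> {1..n}" "j \<in> {1..n}"
  show "cycle_source \<pi> i \<noteq> cycle_source \<pi> j"
  proof (cases "rl_min \<pi> j")
    case False
    then show ?thesis using ij cycle_source_rl_min(1)[of i] by (cases "rl_min \<pi> i") (auto simp: cycle_source_def)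
  next
    case True
    note sj = cycle_source_rl_min[OF True] rl_min_cycle_source[OF True]
    show ?thesis
    proof (cases "rl_min \<pi> i")
      case False
      then show ?thesis using sj ij by (auto simp: cycle_source_def)
    next
      case i: True
      then have "letter \<pi> i < letter \<pi> j" using ij by (simp add: rl_min_def length_perm)
      then have "\<not> cycle_source \<pi> j < i" using sj(3)[of i] ij by auto
      then show ?thesis using cycle_source_rl_min(1)[OF i] ij by auto
    qed
  qed
qed auto

lemma DE_place_eq:
  assumes "1 \<le> i" "i \<le> n"
  shows "DE_place \<pi> i = letter \<pi> (Suc (cycle_source \<pi> i))"
proof -
  have "(\<exists>j. i < j \<and> j \<le> length \<pi> \<and> letter \<pi> i > letter \<pi> j) \<longleftrightarrow> \<not> rl_min \<pi> i"
    using assms letter_eq_iff unfolding rl_min_def length_perm by (metis le_less not_le less_irrefl)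
  then show ?thesis unfolding DE_place_def cycle_source_def letter_def Let_def by simp
qed

lemma DE_place_bij: "bij_betw (DE_place \<pi>) {1..n} {1..n}"
proof -
  have "inj_on (DE_place \<pi>) {1..n}"
  proof (rule inj_onI)
    fix i j assume ij: "i \<in> {1..n}" "j \<in> {1..n}" "DE_place \<pi> i = DE_place \<pi> j"
    then have "cycle_source \<pi> i = cycle_source \<pi> j"
      using cycle_source_less[of i] cycle_source_less[of j] letter_eq_iff[of "Suc (cycle_source \<pi> i)" "Suc (cycle_source \<pi> j)"]
      by (simp add: DE_place_eq)
    then show "i = j" using inj_onD[OF cycle_source_inj] ij by blast
  qed
  moreover have "DE_place \<pi> ` {1..n} \<subseteq> {1..n}"
    using letter_range cycle_source_less by (force simp: DE_place_eq)
  ultimately show ?thesis using endo_inj_surj[of "{1..n}" "DE_place \<pi>"] by (simp add: bij_betw_def)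
qed

lemma DE_nth:
  assumes "1 \<le> i" "i \<le> n"
  shows "DE \<pi> ! (DE_place \<pi> i - 1) = letter \<pi> i"
proof -
  have p: "DE_place \<pi> i \<in> {1..n}" using bij_betw_apply[OF DE_place_bij, of i] assms by simp
  have "(THE b. \<exists>i'\<in>{1..length \<pi>}. DE_place \<pi> i' = DE_place \<pi> i \<and> b = (0 # \<pi>) ! i') = letter \<pi> i"
  proof (rule the_equality)
    show "\<exists>i'\<in>{1..length \<pi>}. DE_place \<pi> i' = DE_place \<pi> i \<and> letter \<pi> i = (0 # \<pi>) ! i'"
      by (rule bexI[of _ i]) (use assms in \<open>simp_all add: length_perm letter_def\<close>)
    fix b assume "\<exists>i'\<in>{1..length \<pi>}. DE_place \<pi> i' = DE_place \<pi> i \<and> b = (0 # \<pi>) ! i'"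
    then obtain i' where "i' \<in> {1..n}" "DE_place \<pi> i' = DE_place \<pi> i" "b = letter \<pi> i'"
      by (auto simp: length_perm letter_def)
    moreover from this have "i' = i"
      using inj_onD[OF bij_betw_imp_inj_on[OF DE_place_bij], of i' i] assms by simp
    ultimately show "b = letter \<pi> i" by simp
  qed
  moreover have "DE_place \<pi> i - 1 < n" "Suc (DE_place \<pi> i - 1) = DE_place \<pi> i" using p by auto
  ultimately show ?thesis by (simp add: DE_def length_perm del: upt_Suc)
qed

lemma length_DE: "length (DE \<pi>) = n"
  by (simp add: DE_def length_perm)

lemma DE_perm: "DE \<pi> \<in> permutations_of_set {1..n}"
proof -
  have "{1..n} \<subseteq> set (DE \<pi>)"
  proof
    fix x assume "x \<in> {1..n}"
    then obtain i where i: "i \<in> {1..n}" "letter \<pi> i = x" using letter_onto by blast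
    moreover have "DE_place \<pi> i \<in> {1..n}" using bij_betw_apply[OF DE_place_bij] i by blast
    then have "DE_place \<pi> i - 1 < length (DE \<pi>)" using length_DE by auto
    then have "DE \<pi> ! (DE_place \<pi> i - 1) \<in> set (DE \<pi>)" by (rule nth_mem)
    ultimately show "x \<in> set (DE \<pi>)" using DE_nth[of i] by simp
  qed
  moreover have "card (set (DE \<pi>)) \<le> n" using card_length[of "DE \<pi>"] length_DE by simp
  ultimately have "set (DE \<pi>) = {1..n}" by (metis card_atLeastAtMost card_seteq diff_Suc_1 List.finite_set)
  moreover from this have "distinct (DE \<pi>)" using length_DE by (simp add: card_distinct)
  ultimately show ?thesis by (simp add: permutations_of_set_def)
qed

lemma DE_eq_letter:
  assumes "k \<in> {1..n}" "i \<in> {1..n}"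
  shows "DE \<pi> ! (letter \<pi> k - 1) = letter \<pi> i \<longleftrightarrow> k = Suc (cycle_source \<pi> i)"
proof -
  obtain i' where i': "i' \<in> {1..n}" "DE_place \<pi> i' = letter \<pi> k"
    using bij_betw_imp_surj_on[OF DE_place_bij] letter_range[of k] assms(1)
    by (metis imageE atLeastAtMost_iff)
  then have "k = Suc (cycle_source \<pi> i')"
    using DE_place_eq[of i'] letter_eq_iff[of k "Suc (cycle_source \<pi> i')"] cycle_source_less[of i'] assms by auto
  moreover have "DE \<pi> ! (letter \<pi> k - 1) = letter \<pi> i'" using DE_nth[of i'] i' by simp
  moreover have "letter \<pi> i' = letter \<pi> i \<longleftrightarrow> i' = i" using letter_eq_iff[of i' i] i' assms by simp
  moreover have "cycle_source \<pi> i' = cycle_source \<pi> i \<longleftrightarrow> i' = i" using inj_on_eq_iff[OF cycle_source_inj] i' assms by blast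
  ultimately show ?thesis by auto
qed

text \<open>
  Going forward in \<open>\<pi>\<close> inside a block means going backwards along \<open>DE \<pi>\<close>, so a set closed
  under preimages contains with each letter also the minimum that ends its block.
\<close>
lemma rl_min_in_closed:
  assumes closed: "\<And>x. x \<in> {1..n} \<Longrightarrow> DE \<pi> ! (x - 1) \<in> S \<Longrightarrow> x \<in> S"
    and i: "rl_min \<pi> i" "i \<le> n"
    and j: "1 \<le> j" "j \<le> i" "letter \<pi> j \<in> S"
  shows "\<exists>t. 1 \<le> t \<and> t \<le> i \<and> rl_min \<pi> t \<and> letter \<pi> t \<in> S"
  using j(2,1,3)
proof (induction j rule: inc_induct)
  case base
  then show ?case using i by blast
next
  case (step j)
  show ?case
  proof (cases "rl_min \<pi> j")
    case True
    then show ?thesis using step by (meson less_imp_le)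
  next
    case False
    then have "DE \<pi> ! (letter \<pi> (Suc j) - 1) = letter \<pi> j"
      using DE_eq_letter[of "Suc j" j] step i by (simp add: cycle_source_def)
    then have "letter \<pi> (Suc j) \<in> S" using closed letter_range[of "Suc j"] step i by auto
    then show ?thesis using step.IH by simp
  qed
qed

text \<open>
  The block that ends at place \<open>i\<close> is a cycle of the image, so it is closed under preimages.
\<close>
lemma block_closed:
  assumes i: "rl_min \<pi> i" "1 \<le> i" "i \<le> n" and x: "x \<in> {1..n}"
    and "DE \<pi> ! (x - 1) \<in> letter \<pi> ` {cycle_source \<pi> i<..i}"
  shows "x \<in> letter \<pi> ` {cycle_source \<pi> i<..i}"
proof -
  obtain l where l: "cycle_source \<pi> i < l" "l \<le> i" "DE \<pi> ! (x - 1) = letter \<pi> l" using assms(5) by auto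
  obtain k where k: "k \<in> {1..n}" "x = letter \<pi> k" using letter_onto[OF x] by blast
  then have k_eq: "k = Suc (cycle_source \<pi> l)" using DE_eq_letter[of k l] l i by auto
  note s = cycle_source_rl_min[OF i]
  show ?thesis
  proof (cases "rl_min \<pi> l")
    case False
    then have "l \<noteq> i" "k = Suc l" using i k_eq by (auto simp: cycle_source_def)
    then show ?thesis using k l by auto
  next
    case True
    have "l = i"
    proof (rule ccontr)
      assume "l \<noteq> i"
      then have "letter \<pi> l < letter \<pi> i" using True l i by (auto simp: rl_min_def length_perm)
      then show False using s(3)[of l] l by simp
    qed
    then show ?thesis using k k_eq s(1) by auto
  qed
qed

end

text \<open>
  At the last place \<open>i\<close> where two words with the same image differ, both letters are
  right-to-left minima: otherwise one of them would be the image of the common next letter. If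
  \<open>letter \<pi> i\<close> were the smaller one, the block of \<open>\<pi>'\<close> ending at place \<open>i\<close>, all of whose letters are
  larger, would contain a letter of \<open>\<pi>\<close> from the places up to \<open>i\<close> and hence the end of its block in
  \<open>\<pi>\<close>, which is at most \<open>letter \<pi> i\<close>.
\<close>
lemma DE_inj_step:
  assumes p: "\<pi> \<in> permutations_of_set {1..n}" and p': "\<pi>' \<in> permutations_of_set {1..n}"
    and eq: "DE \<pi> = DE \<pi>'" and i: "1 \<le> i" "i \<le> n"
    and later: "\<And>j. i < j \<Longrightarrow> j \<le> n \<Longrightarrow> letter \<pi> j = letter \<pi>' j"
  shows "\<not> letter \<pi> i < letter \<pi>' i"
proof
  assume less: "letter \<pi> i < letter \<pi>' i"
  have early: "\<exists>j. 1 \<le> j \<and> j \<le> i \<and> letter q j = letter q' i'"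
    if q: "q \<in> permutations_of_set {1..n}" "q' \<in> permutations_of_set {1..n}"
      and lt: "\<And>j. i < j \<Longrightarrow> j \<le> n \<Longrightarrow> letter q j = letter q' j" and i': "1 \<le> i'" "i' \<le> i" for q q' i'
  proof -
    obtain j where j: "j \<in> {1..n}" "letter q j = letter q' i'"
      using letter_onto[OF q(1) letter_range[OF q(2), of i']] i' i by auto
    moreover have "\<not> i < j"
    proof
      assume "i < j"
      then have "letter q' j = letter q' i'" using lt[of j] j by simp
      then show False using letter_eq_iff[OF q(2), of j i'] j i i' \<open>i < j\<close> by simp
    qed
    ultimately show ?thesis by auto
  qed
  have same: "rl_min q' i"
    if q: "q \<in> permutations_of_set {1..n}" "q' \<in> permutations_of_set {1..n}" "DE q = DE q'"
      and lt: "\<And>j. i < j \<Longrightarrow> j \<le> n \<Longrightarrow> letter q j = letter q' j"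
      and ne: "letter q i \<noteq> letter q' i" for q q'
  proof (rule ccontr)
    assume nr: "\<not> rl_min q' i"
    then have "i \<noteq> n" using rl_min_last[OF q(2)] by auto
    then have "i < n" using i by simp
    have "DE q' ! (letter q' (Suc i) - 1) = letter q' i"
      using DE_eq_letter[OF q(2), of "Suc i" i] nr i \<open>i < n\<close> by (simp add: cycle_source_def)
    moreover obtain l where l: "1 \<le> l" "l \<le> i" "letter q l = letter q' i"
      using early[OF q(1,2) lt, of i] i by auto
    ultimately have "DE q ! (letter q (Suc i) - 1) = letter q l"
      using lt[of "Suc i"] q(3) \<open>i < n\<close> by simp
    then have "cycle_source q l = i" using DE_eq_letter[OF q(1), of "Suc i" l] l i \<open>i < n\<close> by simp
    moreover have "cycle_source q l \<le> l"
      using cycle_source_rl_min(1)[OF q(1), of l] l i by (cases "rl_min q l") (auto simp: cycle_source_def)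
    ultimately have "l = i" using l by simp
    then show False using l ne by simp
  qed
  have r': "rl_min \<pi>' i" using same[OF p p' eq later] less by simp
  have r: "rl_min \<pi> i" using same[OF p' p eq[symmetric]] later less by simp
  note s = cycle_source_rl_min[OF p' r' i]
  obtain j where j: "1 \<le> j" "j \<le> i" "letter \<pi> j = letter \<pi>' i" using early[OF p p' later, of i] i by auto
  have "\<exists>t. 1 \<le> t \<and> t \<le> i \<and> rl_min \<pi> t \<and> letter \<pi> t \<in> letter \<pi>' ` {cycle_source \<pi>' i<..i}"
  proof (rule rl_min_in_closed[OF p _ r i(2) j(1,2)])
    show "letter \<pi> j \<in> letter \<pi>' ` {cycle_source \<pi>' i<..i}" using j s(1) by auto
    show "x \<in> letter \<pi>' ` {cycle_source \<pi>' i<..i}"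
      if "x \<in> {1..n}" "DE \<pi> ! (x - 1) \<in> letter \<pi>' ` {cycle_source \<pi>' i<..i}" for x
      using block_closed[OF p' r' i that(1)] that(2) eq by simp
  qed
  then obtain t where t: "1 \<le> t" "t \<le> i" "rl_min \<pi> t" "letter \<pi> t \<in> letter \<pi>' ` {cycle_source \<pi>' i<..i}" by blast
  then have "letter \<pi>' i \<le> letter \<pi> t" using s(3) by auto
  moreover have "letter \<pi> t \<le> letter \<pi> i"
    using t i perm_length[OF p] by (cases "t = i") (auto simp: rl_min_def less_imp_le)
  ultimately show False using less by simp
qed

theorem DE_bij: "bij_betw DE (permutations_of_set {1..n}) (permutations_of_set {1..n})"
proof -
  let ?S = "permutations_of_set {1..n}"
  have "inj_on DE ?S"
  proof (rule inj_onI, rule ccontr)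
    fix \<pi> \<pi>' assume p: "\<pi> \<in> ?S" "\<pi>' \<in> ?S" "DE \<pi> = DE \<pi>'" "\<pi> \<noteq> \<pi>'"
    let ?D = "{i \<in> {1..n}. letter \<pi> i \<noteq> letter \<pi>' i}"
    have "?D \<noteq> {}"
    proof
      assume *: "?D = {}"
      have "\<pi> = \<pi>'"
      proof (rule nth_equalityI)
        fix i assume "i < length \<pi>"
        then have "Suc i \<in> {1..n}" using perm_length[OF p(1)] by simp
        then have "letter \<pi> (Suc i) = letter \<pi>' (Suc i)" using * by blast
        then show "\<pi> ! i = \<pi>' ! i" by (simp add: letter_def)
      qed (use p perm_length in auto)
      then show False using p by simp
    qed
    then have "Max ?D \<in> ?D" by (intro Max_in) auto
    then have m: "1 \<le> Max ?D" "Max ?D \<le> n" "letter \<pi> (Max ?D) \<noteq> letter \<pi>' (Max ?D)" by simp_all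
    have later: "letter \<pi> j = letter \<pi>' j" if "Max ?D < j" "j \<le> n" for j
    proof (rule ccontr)
      assume "letter \<pi> j \<noteq> letter \<pi>' j"
      then have "j \<in> ?D" using that by auto
      then have "j \<le> Max ?D" by (intro Max_ge) auto
      then show False using that by simp
    qed
    have "\<not> letter \<pi> (Max ?D) < letter \<pi>' (Max ?D)"
      by (rule DE_inj_step[OF p(1,2,3) m(1,2) later])
    moreover have "\<not> letter \<pi>' (Max ?D) < letter \<pi> (Max ?D)"
      by (rule DE_inj_step[OF p(2,1) p(3)[symmetric] m(1,2) later[symmetric]])
    ultimately show False using m(3) by simp
  qed
  moreover have "DE ` ?S \<subseteq> ?S" using DE_perm by blast
  ultimately show ?thesis using endo_inj_surj[of ?S DE] by (simp add: bij_betw_def)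
qed

section \<open>Reading words\<close>

text \<open>
  A letter that does not occur gets the position \<open>length w\<close>, behind all letters read so
  far; thus comparisons of positions stay correct while a word is being extended.
\<close>
definition pos :: "nat list \<Rightarrow> nat \<Rightarrow> nat" where
  "pos w x = length (takeWhile (\<lambda>y. y \<noteq> x) w)"

lemma pos_simps [simp]: "pos [] x = 0" "pos (y # w) x = (if y = x then 0 else Suc (pos w x))"
  by (auto simp: pos_def)

lemma pos_append: "pos (a @ b) x = (if x \<in> set a then pos a x else length a + pos b x)"
  by (induction a) auto

lemma pos_less: "x \<in> set w \<Longrightarrow> pos w x < length w"
  by (induction w) auto

lemma pos_notin: "x \<notin> set w \<Longrightarrow> pos w x = length w"
  by (induction w) auto

lemma pos_le: "pos w x \<le> length w"
  using pos_less pos_notin by (cases "x \<in> set w") (auto simp: less_imp_le)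

lemma pos_append_less_iff:
  "x \<in> set a \<or> y \<in> set a \<Longrightarrow> pos (a @ b) x < pos (a @ b) y \<longleftrightarrow> pos a x < pos a y"
  using pos_le[of a x] pos_le[of a y] pos_less[of x a] pos_less[of y a] pos_notin[of x a] pos_notin[of y a]
  by (auto simp: pos_append)

text \<open>
  Here \<open>R\<close> is the set of row labels and \<open>z\<close> a virtual letter before the word: descents lead to
  row labels, ascents to column labels.
\<close>
fun runs :: "nat set \<Rightarrow> nat \<Rightarrow> nat list \<Rightarrow> bool" where
  "runs R z [] = True"
| "runs R z (l # w) = ((l \<in> R \<longleftrightarrow> l < z) \<and> runs R l w)"

lemma runs_append: "runs R z (a @ b) \<longleftrightarrow> runs R z a \<and> runs R (last (z # a)) b"
  by (induction a arbitrary: z) auto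

lemma runs_unique: "runs R z w \<Longrightarrow> runs R' z w \<Longrightarrow> l \<in> set w \<Longrightarrow> l \<in> R \<longleftrightarrow> l \<in> R'"
  by (induction w arbitrary: z) auto

lemma runs_cong: "(\<And>l. l \<in> set w \<Longrightarrow> l \<in> R \<longleftrightarrow> l \<in> R') \<Longrightarrow> runs R z w \<longleftrightarrow> runs R' z w"
  by (induction w arbitrary: z) auto

lemma runs_exists: "distinct w \<Longrightarrow> \<exists>R \<subseteq> set w. runs R z w"
proof (induction w arbitrary: z)
  case (Cons l w)
  then obtain R where R: "R \<subseteq> set w" "runs R l w" by auto
  let ?R = "if l < z then insert l R else R"
  have "runs ?R l w \<longleftrightarrow> runs R l w" by (rule runs_cong) (use Cons.prems in auto)
  moreover have "l \<in> ?R \<longleftrightarrow> l < z" using R Cons.prems by auto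
  ultimately have "runs ?R z (l # w)" using R by simp
  moreover have "?R \<subseteq> set (l # w)" using R by auto
  ultimately show ?case by blast
qed auto

text \<open>
  Going back from a column label through its increasing block, one meets either the row label
  that precedes the block, which is smaller, or the beginning of the word. The statement for row labels
  is dual.
\<close>
lemma col_run:
  assumes "runs R z (v @ [c])" "c \<notin> R" "distinct (z # v @ [c])"
  shows "(\<exists>r \<in> set v \<inter> R. r < c) \<or> (\<forall>l \<in> set (z # v). l < c)"
  using assms
proof (induction v arbitrary: c rule: rev_induct)
  case (snoc l v)
  have "l < c" using snoc.prems by (auto simp: runs_append)
  show ?case
  proof (cases "l \<in> R")
    case False
    then have "(\<exists>r \<in> set v \<inter> R. r < l) \<or> (\<forall>l' \<in> set (z # v). l' < l)"
      using snoc by (auto simp: runs_append)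
    then show ?thesis using \<open>l < c\<close> by (auto intro: less_trans)
  qed (use \<open>l < c\<close> in auto)
qed auto

lemma row_run:
  assumes "runs R z (v @ [r])" "r \<in> R" "distinct (z # v @ [r])"
  shows "(\<exists>c \<in> set v - R. r < c) \<or> (\<forall>l \<in> set (z # v). r < l)"
  using assms
proof (induction v arbitrary: r rule: rev_induct)
  case (snoc l v)
  have "r < l" using snoc.prems by (auto simp: runs_append)
  show ?case
  proof (cases "l \<in> R")
    case True
    then have "(\<exists>c \<in> set v - R. l < c) \<or> (\<forall>l' \<in> set (z # v). l < l')"
      using snoc by (auto simp: runs_append)
    then show ?thesis using \<open>r < l\<close> by (auto intro: less_trans)
  qed (use \<open>r < l\<close> in auto)
qed auto

lemma runs_ascending:
  "sorted_wrt (<) (z # w) \<Longrightarrow> set w \<inter> R = {} \<Longrightarrow> runs R z w"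
  by (induction w arbitrary: z) auto

lemma runs_descending:
  "sorted_wrt (>) (z # w) \<Longrightarrow> set w \<subseteq> R \<Longrightarrow> runs R z w"
  by (induction w arbitrary: z) auto

lemma sorted_wrt_last: "sorted_wrt P w \<Longrightarrow> x \<in> set w \<Longrightarrow> x = last w \<or> P x (last w)"
  by (cases w rule: rev_cases) (auto simp: sorted_wrt_append)

text \<open>
  The words that are compatible with a filling given in terms of labels: \<open>M r c\<close> says that the
  cell in row \<open>r\<close> and column \<open>c\<close> contains a 1. Such a cell exists iff \<open>r < c\<close>.
\<close>
definition reads :: "nat set \<Rightarrow> (nat \<Rightarrow> nat \<Rightarrow> bool) \<Rightarrow> nat \<Rightarrow> nat list \<Rightarrow> bool" where
  "reads R M z w \<longleftrightarrow> distinct (z # w) \<and> runs R z w \<and>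
     (\<forall>r \<in> set w \<inter> R. \<forall>c \<in> set w - R. r < c \<longrightarrow> (M r c \<longleftrightarrow> pos w r < pos w c))"

text \<open>
  Suppose that two compatible words continue a common prefix with \<open>x < y\<close>. If both are column
  labels, the second word contains, between \<open>y\<close> and \<open>x\<close>, a row label \<open>r < x\<close>; it is read before \<open>x\<close>
  there, but after \<open>x\<close> in the first word, so the entry of this cell would be both 1 and 0. Two row
  labels are treated dually, and a row label \<open>x\<close> with a column label \<open>y\<close> clash directly. The
  remaining case is excluded because both are compared with the same preceding letter.
\<close>
lemma reads_no_branch:
  assumes r: "reads R M z w" and r': "reads R M z w'" and set: "set w = set w'"
    and w: "w = u @ x # t" and w': "w' = u @ y # t'" and less: "x < y"
  shows False
proof -
  have d: "distinct (z # w)" "distinct (z # w')" and ru: "runs R z w" "runs R z w'"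
    and M: "\<And>r c. r \<in> set w \<Longrightarrow> r \<in> R \<Longrightarrow> c \<in> set w \<Longrightarrow> c \<notin> R \<Longrightarrow> r < c \<Longrightarrow>
      (M r c \<longleftrightarrow> pos w r < pos w c) \<and> (M r c \<longleftrightarrow> pos w' r < pos w' c)"
    using r r' set by (auto simp: reads_def)
  \<comment> \<open>The letter that precedes both \<open>x\<close> and \<open>y\<close>.\<close>
  define z' where "z' = last (z # u)"
  have rx: "x \<in> R \<longleftrightarrow> x < z'" and ry: "y \<in> R \<longleftrightarrow> y < z'"
    using ru unfolding w w' runs_append z'_def by auto
  have z': "z' \<in> set (z # u)" unfolding z'_def using last_in_set[of "z # u"] by blast
  have xt': "x \<in> set t'" and yt: "y \<in> set t" using set d less unfolding w w' by auto
  have xw: "x \<in> set w" and yw: "y \<in> set w" using w yt by auto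
  show False
  proof (cases "x \<in> R")
    case xR: True
    show ?thesis
    proof (cases "y \<in> R")
      case True
      obtain v t2 where t: "t = v @ y # t2" using yt by (metis split_list)
      have "w = u @ ((x # v) @ [y]) @ t2" by (simp add: w t)
      then have "runs R z' ((x # v) @ [y])" using ru(1) by (simp only: runs_append z'_def)
      moreover have "distinct (z' # (x # v) @ [y])" using d(1) z' unfolding w t by auto
      ultimately obtain c where c: "c \<in> set (x # v)" "c \<notin> R" "y < c"
        using row_run[of R z' "x # v" y] True less by auto
      then have cv: "c \<in> set v" using xR by auto
      have "M y c \<longleftrightarrow> pos w y < pos w c" "M y c \<longleftrightarrow> pos w' y < pos w' c"
        using M[of y c] yw True c cv by (auto simp: w t)
      moreover have "\<not> pos w y < pos w c" using cv d(1) c pos_less[OF cv] unfolding w t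
        by (auto simp: pos_append)
      moreover have "pos w' y < pos w' c" using cv d c unfolding w' w t by (auto simp: pos_append)
      ultimately show ?thesis by simp
    next
      case False
      then have "pos w x < pos w y \<longleftrightarrow> pos w' x < pos w' y" using M[of x y] xR xw yw less by blast
      then show ?thesis using d less unfolding w w' by (auto simp: pos_append)
    qed
  next
    case xR: False
    show ?thesis
    proof (cases "y \<in> R")
      case True
      then show ?thesis using rx ry xR less by auto
    next
      case False
      obtain v t2 where t: "t' = v @ x # t2" using xt' by (metis split_list)
      have "w' = u @ ((y # v) @ [x]) @ t2" by (simp add: w' t)
      then have "runs R z' ((y # v) @ [x])" using ru(2) by (simp only: runs_append z'_def)
      moreover have "distinct (z' # (y # v) @ [x])" using d(2) z' unfolding w' t by auto
      ultimately obtain r where r: "r \<in> set (y # v)" "r \<in> R" "r < x"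
        using col_run[of R z' "y # v" x] xR less by auto
      then have rv: "r \<in> set v" using False by auto
      then have "r \<in> set w" using set w' t by auto
      then have "M r x \<longleftrightarrow> pos w r < pos w x" "M r x \<longleftrightarrow> pos w' r < pos w' x"
        using M[of r x] xw xR r by auto
      moreover have "pos w' r < pos w' x" using rv d(2) r unfolding w' t by (auto simp: pos_append pos_less)
      moreover have "\<not> pos w r < pos w x" using rv d r unfolding w w' t by (auto simp: pos_append)
      ultimately show ?thesis by simp
    qed
  qed
qed

lemma reads_unique:
  assumes r: "reads R M z w" "reads R M z w'" and set: "set w = set w'"
  shows "w = w'"
proof (rule ccontr)
  assume "w \<noteq> w'"
  moreover have "length w = length w'"
    using r set by (metis distinct.simps(2) distinct_card reads_def)
  ultimately obtain u x t y t' where "x \<noteq> y" "w = u @ [x] @ t" "w' = u @ [y] @ t'"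
    using same_length_different by blast
  then show False
    using reads_no_branch[OF r set, of u x t y t'] reads_no_branch[OF r(2,1) set[symmetric], of u y t' x t]
    by (cases x y rule: linorder_cases) auto
qed

section \<open>The reading algorithm\<close>

text \<open>
  A reading gets stuck only if every unread row has a 0 in an unread column and every unread
  column has a 1 in an unread row. Take the topmost row \<open>i0\<close> of \<open>U\<close> and the columns \<open>V'\<close> in which
  it has a 0. Any row with a 1 in one of these columns has its 0s only in \<open>V'\<close>, as otherwise it forms a
  bad rectangle with \<open>i0\<close>. So these rows and \<open>V'\<close> satisfy the same hypothesis, with fewer rows.
\<close>
lemma no_bad_rectangle_acyclic:
  assumes sh: "ferrers sh" and nb: "no_bad_rectangle (sh, T)" and T: "T \<subseteq> cells sh"
    and "finite U" "U \<noteq> {}"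
    and "\<And>i. i \<in> U \<Longrightarrow> \<exists>j\<in>V. (i, j) \<in> cells sh - T"
    and "\<And>j. j \<in> V \<Longrightarrow> \<exists>i\<in>U. (i, j) \<in> T"
  shows False
  using assms(4-)
proof (induction "card U" arbitrary: U V rule: less_induct)
  case less
  define i0 where "i0 = Min U"
  have i0: "i0 \<in> U" "\<And>i. i \<in> U \<Longrightarrow> i0 \<le> i" using less.prems(1,2) by (auto simp: i0_def)
  \<comment> \<open>Every column of a row in \<open>U\<close> also meets the topmost row \<open>i0\<close>, which closes the rectangles.\<close>
  define V' where "V' = {j \<in> V. (i0, j) \<in> cells sh - T}"
  define U' where "U' = {i \<in> U. \<exists>j\<in>V'. (i, j) \<in> T}"
  have "i0 \<notin> U'" by (auto simp: U'_def V'_def)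
  then have "card U' < card U" using i0 less.prems(1) by (intro psubset_card_mono) (auto simp: U'_def)
  moreover have "finite U'" using less.prems(1) by (simp add: U'_def)
  moreover have V': "\<exists>i\<in>U'. (i, j) \<in> T" if "j \<in> V'" for j
    using that less.prems(4)[of j] by (auto simp: U'_def V'_def)
  moreover have "U' \<noteq> {}" using less.prems(3)[OF i0(1)] V' by (fastforce simp: V'_def)
  moreover have "\<exists>j\<in>V'. (i, j) \<in> cells sh - T" if i: "i \<in> U'" for i
  proof -
    obtain j where j: "j \<in> V'" "(i, j) \<in> T" using i by (auto simp: U'_def)
    obtain j1 where j1: "j1 \<in> V" "(i, j1) \<in> cells sh - T" using less.prems(3)[of i] i by (auto simp: U'_def)
    have lt: "i0 < i" using i0(2)[of i] i \<open>i0 \<notin> U'\<close> by (cases "i = i0") (auto simp: U'_def)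
    have c: "(i0, j1) \<in> cells sh"
      using j1(2) ferrers_nth_mono[OF sh, of i0 i] lt by (auto simp: cells_def nrows_def)
    have cs: "{(i0, j), (i0, j1), (i, j), (i, j1)} \<subseteq> cells sh" using c j j1 T by (auto simp: V'_def)
    have "(i0, j1) \<notin> T"
    proof
      assume a: "(i0, j1) \<in> T"
      then have "j \<noteq> j1" using j by (auto simp: V'_def)
      then show False
        using nb lt cs a j j1 unfolding no_bad_rectangle_def prod.case V'_def
        by (cases j j1 rule: linorder_cases) blast+
    qed
    then have "j1 \<in> V'" using j1 c by (simp add: V'_def)
    then show ?thesis using j1 by blast
  qed
  ultimately show False using less.hyps[of U' V'] by blast
qed

text \<open>
  The algorithm depends on the diagram only through the rows \<open>U0\<close> and columns \<open>V0\<close> to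
  be read and the order of their labels, which makes one analysis serve EW-tableaux, whose top row is
  left out, and NEW-tableaux.
\<close>
locale psi_setting =
  fixes sh :: shape and T :: "cell set" and lab :: "border_step \<Rightarrow> nat"
    and U0 V0 :: "nat set" and z :: nat
  assumes sh: "ferrers sh" and nb: "no_bad_rectangle (sh, T)" and T: "T \<subseteq> cells sh"
    and lab_inj: "inj_on lab (Row ` U0 \<union> Col ` V0)"
    and lab_cell: "\<And>i j. i \<in> U0 \<Longrightarrow> j \<in> V0 \<Longrightarrow> (i, j) \<in> cells sh \<longleftrightarrow> lab (Row i) < lab (Col j)"
    and z: "z \<notin> lab ` (Row ` U0 \<union> Col ` V0)"
begin

abbreviation "lr i \<equiv> lab (Row i)"
abbreviation "lc j \<equiv> lab (Col j)"

lemma lr_eq: "i \<in> U0 \<Longrightarrow> i' \<in> U0 \<Longrightarrow> lr i = lr i' \<longleftrightarrow> i = i'"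
  and lc_eq: "j \<in> V0 \<Longrightarrow> j' \<in> V0 \<Longrightarrow> lc j = lc j' \<longleftrightarrow> j = j'"
  and lr_lc: "i \<in> U0 \<Longrightarrow> j \<in> V0 \<Longrightarrow> lr i \<noteq> lc j"
  using lab_inj by (auto simp: inj_on_def)

lemma lc_not_row: "j \<in> V0 \<Longrightarrow> lc j \<notin> lr ` U0"
  using lr_lc by (metis imageE)

definition entry :: "nat \<Rightarrow> nat \<Rightarrow> bool" where
  "entry r c \<longleftrightarrow> (\<exists>i\<in>U0. \<exists>j\<in>V0. r = lr i \<and> c = lc j \<and> (i, j) \<in> T)"

lemma entry_iff: "i \<in> U0 \<Longrightarrow> j \<in> V0 \<Longrightarrow> entry (lr i) (lc j) \<longleftrightarrow> (i, j) \<in> T"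
  by (auto simp: entry_def lr_eq lc_eq)

definition zero_free :: "nat list \<Rightarrow> nat \<Rightarrow> bool" where
  "zero_free V i \<longleftrightarrow> (\<forall>j\<in>set V. (i, j) \<in> cells sh \<longrightarrow> (i, j) \<in> T)"

definition one_free :: "nat list \<Rightarrow> nat \<Rightarrow> bool" where
  "one_free U j \<longleftrightarrow> (\<forall>i\<in>set U. (i, j) \<in> cells sh \<longrightarrow> (i, j) \<notin> T)"

text \<open>
  One round of the algorithm consists of two half-rounds that are dual to each other.
\<close>
fun col_step :: "psi_state \<Rightarrow> psi_state" where
  "col_step (U, V, w) = (U, filter (\<lambda>j. \<not> one_free U j) V, w @ map lc (filter (one_free U) V))"

fun row_step :: "psi_state \<Rightarrow> psi_state" where
  "row_step (U, V, w) = (filter (\<lambda>i. \<not> zero_free V i) U, V, w @ map lr (filter (zero_free V) U))"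

lemma psi_round_eq: "psi_round lab (sh, T) s = row_step (col_step s)"
  by (cases s) (simp add: psi_round_def Let_def one_free_def[abs_def] zero_free_def[abs_def])

text \<open>
  The invariant of both half-rounds: up to the letters still missing, the word is compatible
  with the filling. The condition on positions concerns the cells with at least one label read.
\<close>
definition partly_read :: "psi_state \<Rightarrow> bool" where
  "partly_read = (\<lambda>(U, V, w). set U \<subseteq> U0 \<and> set V \<subseteq> V0 \<and>
     sorted_wrt (\<lambda>i i'. lr i > lr i') U \<and> sorted_wrt (\<lambda>j j'. lc j < lc j') V \<and>
     distinct w \<and> set w = lr ` (U0 - set U) \<union> lc ` (V0 - set V) \<and> runs (lr ` U0) z w \<and>
     (\<forall>i\<in>U0. \<forall>j\<in>V0. (i, j) \<in> cells sh \<and> (i \<notin> set U \<or> j \<notin> set V) \<longrightarrow>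
        ((i, j) \<in> T \<longleftrightarrow> pos w (lr i) < pos w (lc j))))"

text \<open>
  The two conditions that alternate between half-rounds. Before columns are read, no unread
  row is free of 0s, and the columns about to be read have labels above the last letter, so the
  ascents come out right; \<open>rows_next\<close> is the dual condition. A NEW-tableau starts in the second one,
  and then the first half-round reads nothing.
\<close>
definition cols_next :: "psi_state \<Rightarrow> bool" where
  "cols_next = (\<lambda>(U, V, w). (\<forall>i\<in>set U. \<not> zero_free V i) \<and>
     (\<forall>j\<in>set V. one_free U j \<longrightarrow> last (z # w) < lc j))"

definition rows_next :: "psi_state \<Rightarrow> bool" where
  "rows_next = (\<lambda>(U, V, w). (\<forall>j\<in>set V. \<not> one_free U j) \<and>
     (\<forall>i\<in>set U. zero_free V i \<longrightarrow> lr i < last (z # w)))"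

text \<open>
  A row that loses its last 0 in this half-round meets a column just read. Its label is thus
  smaller than that of this column and smaller than the last letter of the block, as \<open>rows_next\<close>
  demands.
\<close>
lemma col_step_partly_read:
  assumes p: "partly_read (U, V, w)" and nxt: "cols_next (U, V, w) \<or> rows_next (U, V, w)"
  shows "partly_read (col_step (U, V, w)) \<and> rows_next (col_step (U, V, w))"
proof -
  define C where "C = filter (one_free U) V"
  define V' where "V' = filter (\<lambda>j. \<not> one_free U j) V"
  have step: "col_step (U, V, w) = (U, V', w @ map lc C)" by (simp add: C_def V'_def)
  have U: "set U \<subseteq> U0" and V: "set V \<subseteq> V0" and sV: "sorted_wrt (\<lambda>j j'. lc j < lc j') V"
    and dw: "distinct w" and sw: "set w = lr ` (U0 - set U) \<union> lc ` (V0 - set V)"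
    and rw: "runs (lr ` U0) z w"
    and ent: "\<And>i j. i \<in> U0 \<Longrightarrow> j \<in> V0 \<Longrightarrow> (i, j) \<in> cells sh \<Longrightarrow> i \<notin> set U \<or> j \<notin> set V \<Longrightarrow>
        ((i, j) \<in> T \<longleftrightarrow> pos w (lr i) < pos w (lc j))"
    using p by (auto simp: partly_read_def)
  have CV: "set C \<subseteq> set V" "set V' = set V - set C" by (auto simp: C_def V'_def)
  have r_in: "lr i \<in> set w \<longleftrightarrow> i \<notin> set U" if "i \<in> U0" for i
    using that V lr_eq lr_lc unfolding sw by fastforce
  have c_in: "lc j \<in> set w \<longleftrightarrow> j \<notin> set V" if "j \<in> V0" for j
    using that U lc_eq lr_lc unfolding sw by fastforce
  have sC: "sorted_wrt (<) (map lc C)"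
    unfolding C_def sorted_wrt_map using sV by (rule sorted_wrt_filter)
  have after: "last (z # w) < lc j" if "j \<in> set C" for j
    using nxt that by (auto simp: cols_next_def rows_next_def C_def)
  have "distinct (w @ map lc C)"
    using dw sC c_in CV V by (auto simp: strict_sorted_iff)
  moreover have "set (w @ map lc C) = lr ` (U0 - set U) \<union> lc ` (V0 - set V')"
    using CV V by (auto simp: sw)
  moreover have "runs (lr ` U0) z (w @ map lc C)"
  proof -
    have "set (map lc C) \<inter> lr ` U0 = {}" using CV V lc_not_row by (simp only: set_map) blast
    then have "runs (lr ` U0) (last (z # w)) (map lc C)"
      by (intro runs_ascending) (use sC after in auto)
    then show ?thesis using rw by (simp add: runs_append)
  qed
  moreover have "(i, j) \<in> T \<longleftrightarrow> pos (w @ map lc C) (lr i) < pos (w @ map lc C) (lc j)"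
    if ij: "i \<in> U0" "j \<in> V0" "(i, j) \<in> cells sh" "i \<notin> set U \<or> j \<notin> set V'" for i j
  proof (cases "i \<notin> set U \<or> j \<notin> set V")
    case True
    then have "lr i \<in> set w \<or> lc j \<in> set w" using r_in c_in ij by auto
    then show ?thesis using ent[OF ij(1-3) True] by (simp add: pos_append_less_iff)
  next
    case False
    then have "j \<in> set C" "i \<in> set U" using ij CV by auto
    then have "(i, j) \<notin> T" using ij by (auto simp: C_def one_free_def)
    moreover have "lr i \<notin> set (w @ map lc C)" using r_in ij \<open>i \<in> set U\<close> CV V lr_lc by auto
    ultimately show ?thesis using pos_le[of "w @ map lc C" "lc j"] by (simp add: pos_notin)
  qed
  moreover have "sorted_wrt (\<lambda>j j'. lc j < lc j') V'" unfolding V'_def using sV by (rule sorted_wrt_filter)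
  ultimately have "partly_read (U, V', w @ map lc C)"
    using p CV by (auto simp: partly_read_def)
  moreover have "rows_next (U, V', w @ map lc C)"
  proof -
    have "lr i < last (z # w @ map lc C)" if i: "i \<in> set U" "zero_free V' i" for i
    proof (cases "C = []")
      case True
      then have V'V: "V' = V" unfolding C_def V'_def by (metis (mono_tags, lifting) filter_True filter_empty_conv)
      then have "\<not> cols_next (U, V, w)" using i by (auto simp: cols_next_def)
      then show ?thesis using nxt i V'V True by (auto simp: rows_next_def)
    next
      case False
      then have "cols_next (U, V, w)" using nxt by (auto simp: C_def rows_next_def filter_empty_conv)
      then have "\<not> zero_free V i" using i by (auto simp: cols_next_def)
      then obtain j where j: "j \<in> set C" "(i, j) \<in> cells sh" using i CV by (auto simp: zero_free_def)
      have "lr i < lc j" using lab_cell[of i j] j i(1) U V CV by blast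
      also have "lc j \<le> last (map lc C)"
        using sorted_wrt_last[OF sC, of "lc j"] j(1) by auto
      finally show ?thesis using False by simp
    qed
    then show ?thesis by (auto simp: rows_next_def V'_def)
  qed
  ultimately show ?thesis by (simp only: step)
qed

text \<open>
  Dually, a column that loses its last 1 meets a row just read, whose label is at least
  the last letter of the decreasing block.
\<close>
lemma row_step_partly_read:
  assumes p: "partly_read (U, V, w)" and nxt: "rows_next (U, V, w)"
  shows "partly_read (row_step (U, V, w)) \<and> cols_next (row_step (U, V, w))"
proof -
  define R where "R = filter (zero_free V) U"
  define U' where "U' = filter (\<lambda>i. \<not> zero_free V i) U"
  have step: "row_step (U, V, w) = (U', V, w @ map lr R)" by (simp add: R_def U'_def)
  have U: "set U \<subseteq> U0" and V: "set V \<subseteq> V0" and sU: "sorted_wrt (\<lambda>i i'. lr i > lr i') U"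
    and dw: "distinct w" and sw: "set w = lr ` (U0 - set U) \<union> lc ` (V0 - set V)"
    and rw: "runs (lr ` U0) z w"
    and ent: "\<And>i j. i \<in> U0 \<Longrightarrow> j \<in> V0 \<Longrightarrow> (i, j) \<in> cells sh \<Longrightarrow> i \<notin> set U \<or> j \<notin> set V \<Longrightarrow>
        ((i, j) \<in> T \<longleftrightarrow> pos w (lr i) < pos w (lc j))"
    using p by (auto simp: partly_read_def)
  have RU: "set R \<subseteq> set U" "set U' = set U - set R" by (auto simp: R_def U'_def)
  have r_in: "lr i \<in> set w \<longleftrightarrow> i \<notin> set U" if "i \<in> U0" for i
    using that V lr_eq lr_lc unfolding sw by fastforce
  have c_in: "lc j \<in> set w \<longleftrightarrow> j \<notin> set V" if "j \<in> V0" for j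
    using that U lc_eq lr_lc unfolding sw by fastforce
  have sR: "sorted_wrt (>) (map lr R)"
    unfolding R_def sorted_wrt_map using sU by (rule sorted_wrt_filter)
  have after: "lr i < last (z # w)" if "i \<in> set R" for i
    using nxt that by (auto simp: rows_next_def R_def)
  have "distinct (map lr R)"
    using sR by (auto simp: distinct_conv_nth sorted_wrt_iff_nth_less) (metis less_irrefl linorder_neqE_nat)
  then have "distinct (w @ map lr R)"
    using dw r_in RU U by auto
  moreover have "set (w @ map lr R) = lr ` (U0 - set U') \<union> lc ` (V0 - set V)"
    using RU U by (auto simp: sw)
  moreover have "runs (lr ` U0) z (w @ map lr R)"
  proof -
    have "runs (lr ` U0) (last (z # w)) (map lr R)"
      by (rule runs_descending) (use sR after RU U in auto)
    then show ?thesis using rw by (simp add: runs_append)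
  qed
  moreover have "(i, j) \<in> T \<longleftrightarrow> pos (w @ map lr R) (lr i) < pos (w @ map lr R) (lc j)"
    if ij: "i \<in> U0" "j \<in> V0" "(i, j) \<in> cells sh" "i \<notin> set U' \<or> j \<notin> set V" for i j
  proof (cases "i \<notin> set U \<or> j \<notin> set V")
    case True
    then have "lr i \<in> set w \<or> lc j \<in> set w" using r_in c_in ij by auto
    then show ?thesis using ent[OF ij(1-3) True] by (simp add: pos_append_less_iff)
  next
    case False
    then have "i \<in> set R" "j \<in> set V" using ij RU by auto
    then have "(i, j) \<in> T" using ij by (auto simp: R_def zero_free_def)
    moreover have "lc j \<notin> lr ` set R" using lc_not_row[OF ij(2)] RU U by blast
    then have "lc j \<notin> set (w @ map lr R)" using c_in ij \<open>j \<in> set V\<close> by auto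
    moreover have "lr i \<in> set (w @ map lr R)" using \<open>i \<in> set R\<close> by auto
    ultimately show ?thesis using pos_less[of "lr i" "w @ map lr R"] by (simp only: pos_notin simp_thms)
  qed
  moreover have "sorted_wrt (\<lambda>i i'. lr i > lr i') U'" unfolding U'_def using sU by (rule sorted_wrt_filter)
  ultimately have "partly_read (U', V, w @ map lr R)"
    using p RU by (auto simp: partly_read_def)
  moreover have "cols_next (U', V, w @ map lr R)"
  proof -
    have "last (z # w @ map lr R) < lc j" if j: "j \<in> set V" "one_free U' j" for j
    proof -
      have "\<not> one_free U j" using nxt j by (auto simp: rows_next_def)
      then obtain i where i: "i \<in> set R" "(i, j) \<in> cells sh" using j RU by (auto simp: one_free_def)
      then have ne: "map lr R \<noteq> []" by auto
      have "last (map lr R) \<le> lr i"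
        using sorted_wrt_last[OF sR, of "lr i"] i(1) by auto
      also have "lr i < lc j" using lab_cell[of i j] j(1) i U V RU by blast
      finally show ?thesis using ne by simp
    qed
    then show ?thesis by (auto simp: cols_next_def U'_def)
  qed
  ultimately show ?thesis by (simp only: step)
qed

lemma psi_round_partly_read:
  assumes "partly_read s" "cols_next s \<or> rows_next s"
  shows "partly_read (psi_round lab (sh, T) s) \<and> cols_next (psi_round lab (sh, T) s)"
proof -
  obtain U V w where s: "s = (U, V, w)" by (cases s)
  obtain U' V' w' where s': "col_step s = (U', V', w')" by (cases "col_step s")
  have "partly_read (U', V', w') \<and> rows_next (U', V', w')"
    using col_step_partly_read[of U V w] assms unfolding s[symmetric] s'[symmetric] by blast
  then show ?thesis using row_step_partly_read[of U' V' w'] unfolding psi_round_eq s' by blast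
qed

lemma psi_round_decreases:
  assumes p: "partly_read (U, V, w)" and ne: "U \<noteq> [] \<or> V \<noteq> []"
    and eq: "psi_round lab (sh, T) (U, V, w) = (U', V', w')"
  shows "length U' + length V' < length U + length V"
proof -
  have V': "V' = filter (\<lambda>j. \<not> one_free U j) V" and U': "U' = filter (\<lambda>i. \<not> zero_free V' i) U"
    using eq unfolding psi_round_eq by auto
  have le: "length V' \<le> length V" "length U' \<le> length U" by (simp_all add: V' U')
  moreover have "\<not> (length V' = length V \<and> length U' = length U)"
  proof
    assume l: "length V' = length V \<and> length U' = length U"
    have one: "\<not> one_free U j" if "j \<in> set V" for j
      using l that unfolding V' by (metis (mono_tags, lifting) length_filter_less less_irrefl)
    then have V'V: "V' = V" unfolding V' by (simp add: filter_id_conv)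
    have zero: "\<not> zero_free V i" if "i \<in> set U" for i
      using l that unfolding U' V'V by (metis (mono_tags, lifting) length_filter_less less_irrefl)
    have "U \<noteq> []"
    proof
      assume "U = []"
      then obtain j where "j \<in> set V" using ne by (cases V) auto
      then show False using one[of j] \<open>U = []\<close> by (auto simp: one_free_def)
    qed
    moreover have "\<exists>j\<in>set V. (i, j) \<in> cells sh - T" if "i \<in> set U" for i
      using zero[OF that] by (auto simp: zero_free_def)
    moreover have "\<exists>i\<in>set U. (i, j) \<in> T" if "j \<in> set V" for j
      using one[OF that] by (auto simp: one_free_def)
    ultimately show False using no_bad_rectangle_acyclic[OF sh nb T, of "set U" "set V"] by auto
  qed
  ultimately show ?thesis by linarith
qed

lemma psi_loop_reads:
  assumes p: "partly_read (U, V, w)" and nxt: "cols_next (U, V, w) \<or> rows_next (U, V, w)"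
  shows "reads (lr ` U0) entry z (psi_loop lab (sh, T) (U, V, w)) \<and>
    set (psi_loop lab (sh, T) (U, V, w)) = lr ` U0 \<union> lc ` V0"
proof -
  let ?b = "\<lambda>(U, V, w). U \<noteq> [] \<or> V \<noteq> []"
  have "(\<lambda>(U, V, w). partly_read (U, V, w) \<and> U = [] \<and> V = [])
      (while ?b (psi_round lab (sh, T)) (U, V, w))"
  proof (rule while_rule[where P = "\<lambda>s. partly_read s \<and> (cols_next s \<or> rows_next s)"
        and r = "measure (\<lambda>(U, V, w). length U + length V)"])
    fix s assume "partly_read s \<and> (cols_next s \<or> rows_next s)" "?b s"
    then show "(psi_round lab (sh, T) s, s) \<in> measure (\<lambda>(U, V, w). length U + length V)"
      using psi_round_decreases[of "fst s" "fst (snd s)" "snd (snd s)"]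
      by (cases s; cases "psi_round lab (sh, T) s") auto
  qed (use p nxt psi_round_partly_read in auto)
  then obtain w' where w': "while ?b (psi_round lab (sh, T)) (U, V, w) = ([], [], w')"
      and p': "partly_read ([], [], w')" by auto
  have "psi_loop lab (sh, T) (U, V, w) = w'" using w' by (simp add: psi_loop_def)
  moreover have "set w' = lr ` U0 \<union> lc ` V0" using p' by (simp add: partly_read_def)
  moreover have "reads (lr ` U0) entry z w'"
    unfolding reads_def
  proof (intro conjI ballI impI)
    show "distinct (z # w')" using p' z by (auto simp: partly_read_def)
    show "runs (lr ` U0) z w'" using p' by (simp add: partly_read_def)
    fix r c assume r: "r \<in> set w' \<inter> lr ` U0" and c: "c \<in> set w' - lr ` U0" and "r < c"
    obtain i where i: "i \<in> U0" "r = lr i" using r by auto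
    obtain j where j: "j \<in> V0" "c = lc j" using c \<open>set w' = _\<close> by auto
    have "(i, j) \<in> cells sh" using lab_cell[OF i(1) j(1)] \<open>r < c\<close> i j by simp
    then show "entry r c \<longleftrightarrow> pos w' r < pos w' c"
      using p' i j entry_iff by (auto simp: partly_read_def)
  qed
  ultimately show ?thesis by simp
qed

end

section \<open>EW- and NEW-tableaux as permutations\<close>

text \<open>
  EW-tableaux for \<open>k = 1\<close> and NEW-tableaux for \<open>k = 0\<close>, where \<open>k\<close> is the number of top rows
  filled with 1s that are left out of the reading.
\<close>
definition rect_tableaux :: "nat \<Rightarrow> nat \<Rightarrow> tableau set" where
  "rect_tableaux k n = {(sh, T). filling (sh, T) \<and> no_bad_rectangle (sh, T) \<and>
     nrows sh + ncols sh = n + k \<and> (\<forall>i<k. \<forall>j<ncols sh. (i, j) \<in> T) \<and>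
     (if k = 1 then \<forall>i<nrows sh. 0 < i \<longrightarrow> (\<exists>j < sh ! i. (i, j) \<notin> T)
      else \<forall>j<ncols sh. \<exists>i. (i, j) \<in> T)}"

text \<open>
  In both cases the border steps to be read have the labels \<open>1\<close> to \<open>n\<close>; for \<open>k = 1\<close> the label
  0 belongs to the top row.
\<close>
definition lab_from :: "nat \<Rightarrow> shape \<Rightarrow> border_step \<Rightarrow> nat" where
  "lab_from k sh s = label0 sh s + (1 - k)"

definition Psi_from :: "nat \<Rightarrow> tableau \<Rightarrow> nat list" where
  "Psi_from k = (\<lambda>(sh, T). psi_loop (lab_from k sh) (sh, T)
     (rev [k..<nrows sh], rev [0..<ncols sh], []))"

text \<open>
  The virtual letter before the word. The reading of an EW-tableau begins with a column, which
  has to be an ascent, and that of a NEW-tableau with a row, which has to be a descent.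
\<close>
definition start_letter :: "nat \<Rightarrow> nat \<Rightarrow> nat" where
  "start_letter k n = (if k = 1 then 0 else Suc n)"

lemma Psi_EW_eq_Psi_from: "Psi_EW = Psi_from 1"
proof -
  have "lab_from 1 sh = label0 sh" for sh by (simp add: lab_from_def fun_eq_iff)
  then show ?thesis by (simp add: Psi_EW_def Psi_from_def)
qed

lemma Psi_NEW_eq_Psi_from: "Psi_NEW = Psi_from 0"
proof -
  have "lab_from 0 sh = label1 sh" for sh by (simp add: lab_from_def label1_def fun_eq_iff)
  then show ?thesis by (simp add: Psi_NEW_def Psi_from_def)
qed

lemma NEW_tableaux_eq_rect: "NEW_tableaux n = rect_tableaux 0 n"
  by (auto simp: NEW_tableaux_def NEW_tableau_def rect_tableaux_def)

text \<open>
  The rows of an EW-tableau are required to be nonempty; for the lower rows this follows from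
  their 0s, and the first row could be empty only in the tableau of size 0.
\<close>
lemma EW_tableaux_eq_rect:
  assumes "n \<ge> 1"
  shows "EW_tableaux n = rect_tableaux 1 n"
proof -
  have "(sh, T) \<in> EW_tableaux n \<longleftrightarrow> (sh, T) \<in> rect_tableaux 1 n" for sh T
  proof
    assume "(sh, T) \<in> EW_tableaux n"
    then show "(sh, T) \<in> rect_tableaux 1 n"
      using assms by (auto simp: EW_tableaux_def EW_tableau_def rect_tableaux_def)
  next
    assume a: "(sh, T) \<in> rect_tableaux 1 n"
    then have zero: "\<exists>j < sh ! i. (i, j) \<notin> T" if "0 < i" "i < nrows sh" for i
      using that by (auto simp: rect_tableaux_def)
    have sz: "nrows sh + ncols sh = n + 1" and f: "ferrers sh"
      using a by (auto simp: rect_tableaux_def filling_def)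
    have pos: "0 < sh ! i" if "0 < i" "i < nrows sh" for i using zero[OF that] by auto
    have "0 < ncols sh"
    proof (rule ccontr)
      assume "\<not> 0 < ncols sh"
      then have "1 < nrows sh" "ncols sh = 0" using sz assms by auto
      then show False using pos[of 1] ferrers_nth_le[OF f, of 1] by simp
    qed
    then have "0 < sh ! 0" by (cases sh) (auto simp: ncols_def)
    then have "0 < sh ! i" if "i < nrows sh" for i using pos that by (cases "i = 0") auto
    then show "(sh, T) \<in> EW_tableaux n"
      using a by (auto simp: EW_tableaux_def EW_tableau_def rect_tableaux_def nonempty_rows_def)
  qed
  then show ?thesis by auto
qed

lemma label0_image: "ferrers sh \<Longrightarrow> label0 sh ` set (border sh) = {..<nrows sh + ncols sh}"
proof -
  assume f: "ferrers sh"
  have "p \<in> label0 sh ` set (border sh)" if "p < length (border sh)" for p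
    using label0_border[OF f that] nth_mem[OF that] by (metis imageI)
  then show ?thesis using label0_less[of _ sh] length_border[OF f] by auto
qed

lemma label_image:
  assumes f: "ferrers sh" "sh \<noteq> []" and k: "k \<le> 1" and n: "nrows sh + ncols sh = n + k"
  shows "(lab_from k sh) ` (Row ` {k..<nrows sh} \<union> Col ` {..<ncols sh}) = {1..n}"
proof (cases "k = 0")
  case True
  have "(\<lambda>s. label0 sh s + 1) ` set (border sh) = (\<lambda>l. l + 1) ` {..<n}"
    using label0_image[OF f(1)] n True by (simp add: image_image[symmetric])
  also have "\<dots> = {1..n}" by (simp add: lessThan_atLeast0 image_Suc_atLeastLessThan atLeastLessThanSuc_atLeastAtMost)
  finally show ?thesis using True set_border[OF f(1)] by (simp add: lab_from_def[abs_def] lessThan_atLeast0)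
next
  case False
  then have k1: "k = 1" using k by simp
  let ?B = "Row ` {1..<nrows sh} \<union> Col ` {..<ncols sh}"
  have "{..<nrows sh} = insert 0 {1..<nrows sh}" using f(2) by (auto simp: nrows_def)
  then have B: "set (border sh) = insert (Row 0) ?B" using set_border[OF f(1)] by auto
  have "inj_on (label0 sh) (set (border sh))" using label0_inj by (auto simp: inj_on_def)
  then have "label0 sh ` (set (border sh) - {Row 0}) = label0 sh ` set (border sh) - {label0 sh (Row 0)}"
    using B by (subst inj_on_image_set_diff[of _ "set (border sh)"]) auto
  moreover have "set (border sh) - {Row 0} = ?B" using B by auto
  moreover have "{..<n + 1} - {0} = {1..n}" by auto
  ultimately show ?thesis
    using label0_image[OF f(1)] n k1 label0_Row0[OF f(2)] by (simp add: lab_from_def[abs_def])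
qed

lemma lab_from_eq_iff:
  assumes "ferrers sh" "s \<in> Row ` {k..<nrows sh} \<union> Col ` {..<ncols sh}" "t \<in> Row ` {k..<nrows sh} \<union> Col ` {..<ncols sh}"
  shows "lab_from k sh s = lab_from k sh t \<longleftrightarrow> s = t"
proof -
  have "s \<in> set (border sh)" "t \<in> set (border sh)" using assms by (auto simp: set_border)
  then show ?thesis using label0_inj by (simp add: lab_from_def)
qed

text \<open>
  The row labels among \<open>1\<close> to \<open>n\<close> determine the border, hence the shape. The subtraction
  \<open>l - (1 - k)\<close> turns a label into an index of the list \<open>border sh\<close>.
\<close>
lemma row_label_iff:
  assumes f: "ferrers sh" "sh \<noteq> []" and k: "k \<le> 1" and n: "nrows sh + ncols sh = n + k"
    and l: "l \<in> {1..n}"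
  shows "l \<in> (\<lambda>i. lab_from k sh (Row i)) ` {k..<nrows sh} \<longleftrightarrow> is_row (border sh ! (l - (1 - k)))"
proof -
  have "l \<in> lab_from k sh ` (Row ` {k..<nrows sh} \<union> Col ` {..<ncols sh})"
    unfolding label_image[OF f k n] by (rule l)
  then obtain s where s: "s \<in> Row ` {k..<nrows sh} \<union> Col ` {..<ncols sh}" "l = lab_from k sh s"
    by (rule imageE) simp
  have sb: "s \<in> set (border sh)" using s set_border[OF f(1)] by auto
  have bs: "border sh ! (l - (1 - k)) = s" using s border_label0[OF sb] by (simp add: lab_from_def)
  have "l \<in> (\<lambda>i. lab_from k sh (Row i)) ` {k..<nrows sh} \<longleftrightarrow> (\<exists>i\<in>{k..<nrows sh}. s = Row i)"
    using lab_from_eq_iff[OF f(1) s(1)] unfolding s(2) by (auto simp: image_iff)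
  then show ?thesis using bs s(1) by auto
qed

lemma psi_setting_rect:
  assumes X: "(sh, T) \<in> rect_tableaux k n" and k: "k \<le> 1" and ne: "sh \<noteq> []"
  shows "psi_setting sh T (lab_from k sh) {k..<nrows sh} {..<ncols sh} (start_letter k n)"
proof
  have f: "ferrers sh" and n: "nrows sh + ncols sh = n + k"
    using X by (auto simp: rect_tableaux_def filling_def)
  show "ferrers sh" "no_bad_rectangle (sh, T)" "T \<subseteq> cells sh"
    using X by (auto simp: rect_tableaux_def filling_def)
  show "inj_on (lab_from k sh) (Row ` {k..<nrows sh} \<union> Col ` {..<ncols sh})"
    by (rule inj_onI) (simp only: lab_from_eq_iff[OF f])
  show "(i, j) \<in> cells sh \<longleftrightarrow> lab_from k sh (Row i) < lab_from k sh (Col j)"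
    if "i \<in> {k..<nrows sh}" "j \<in> {..<ncols sh}" for i j
    using label0_cell[OF f, of i j] that by (simp add: lab_from_def)
  show "start_letter k n \<notin> (lab_from k sh) ` (Row ` {k..<nrows sh} \<union> Col ` {..<ncols sh})"
    unfolding label_image[OF f ne k n] by (simp add: start_letter_def)
qed

lemma Psi_from_reads:
  assumes X: "(sh, T) \<in> rect_tableaux k n" and k: "k \<le> 1" and ne: "sh \<noteq> []"
  shows "reads ((\<lambda>i. lab_from k sh (Row i)) ` {k..<nrows sh})
      (psi_setting.entry T (lab_from k sh) {k..<nrows sh} {..<ncols sh})
      (start_letter k n) (Psi_from k (sh, T))"
    and "set (Psi_from k (sh, T)) = {1..n}"
proof -
  interpret psi_setting sh T "lab_from k sh" "{k..<nrows sh}" "{..<ncols sh}" "start_letter k n"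
    by (rule psi_setting_rect[OF assms])
  have n: "nrows sh + ncols sh = n + k" using X by (auto simp: rect_tableaux_def)
  have image: "lr ` {k..<nrows sh} \<union> lc ` {..<ncols sh} = {1..n}"
    using label_image[OF sh ne k n] by (simp add: image_Un image_image)
  let ?s = "(rev [k..<nrows sh], rev [0..<ncols sh], [])"
  have "sorted_wrt (\<lambda>i i'. lr i < lr i') [k..<nrows sh]"
    using label0_Row_mono[OF sh] by (simp add: sorted_wrt_iff_nth_less lab_from_def)
  moreover have "sorted_wrt (\<lambda>j j'. lc j > lc j') [0..<ncols sh]"
    using label0_Col_antimono[OF sh] by (simp add: sorted_wrt_iff_nth_less lab_from_def)
  ultimately have p: "partly_read ?s"
    by (auto simp: partly_read_def sorted_wrt_rev)
  have nxt: "cols_next ?s \<or> rows_next ?s"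
  proof (cases "k = 1")
    case True
    have "\<not> zero_free (rev [0..<ncols sh]) i" if i: "i \<in> {k..<nrows sh}" for i
    proof -
      obtain j where "j < sh ! i" "(i, j) \<notin> T" using X True i by (auto simp: rect_tableaux_def)
      then show ?thesis using i ferrers_nth_le[OF sh, of i]
        by (auto simp: zero_free_def cells_def nrows_def)
    qed
    moreover have "start_letter k n < lc j" if "j < ncols sh" for j
      using image that True by (force simp: start_letter_def)
    ultimately have "cols_next ?s" by (auto simp: cols_next_def)
    then show ?thesis by simp
  next
    case False
    then have "k = 0" using k by simp
    have "\<not> one_free (rev [k..<nrows sh]) j" if j: "j < ncols sh" for j
    proof -
      obtain i where "(i, j) \<in> T" using X False j by (auto simp: rect_tableaux_def)
      then have "(i, j) \<in> cells sh" "i \<in> set (rev [k..<nrows sh])"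
        using T \<open>k = 0\<close> by (auto simp: cells_def nrows_def)
      then show ?thesis using \<open>(i, j) \<in> T\<close> unfolding one_free_def by blast
    qed
    moreover have "lr i < start_letter k n" if "i \<in> {k..<nrows sh}" for i
    proof -
      have "lr i \<in> {1..n}" unfolding image[symmetric] using that by blast
      then show ?thesis using False by (simp add: start_letter_def)
    qed
    ultimately have "rows_next ?s" by (auto simp: rows_next_def)
    then show ?thesis by simp
  qed
  have Psi: "Psi_from k (sh, T) = psi_loop (lab_from k sh) (sh, T) ?s"
    by (simp add: Psi_from_def)
  show "reads (lr ` {k..<nrows sh}) entry (start_letter k n) (Psi_from k (sh, T))"
    and "set (Psi_from k (sh, T)) = {1..n}"
    using psi_loop_reads[OF p nxt] unfolding Psi image by simp_all
qed

lemma rect_nonempty: "(sh, T) \<in> rect_tableaux k n \<Longrightarrow> n \<ge> 1 \<Longrightarrow> sh \<noteq> []"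
  by (auto simp: rect_tableaux_def nrows_def)

lemma border_0: "sh \<noteq> [] \<Longrightarrow> border sh ! 0 = Row 0"
  by (cases sh) (simp_all add: border_def ncols_def)

lemma Psi_from_inj:
  assumes k: "k \<le> 1" and n1: "n \<ge> 1"
  shows "inj_on (Psi_from k) (rect_tableaux k n)"
proof (rule inj_onI, clarify)
  fix sh T sh' T'
  assume X: "(sh, T) \<in> rect_tableaux k n" and X': "(sh', T') \<in> rect_tableaux k n"
    and eq: "Psi_from k (sh, T) = Psi_from k (sh', T')"
  note ne = rect_nonempty[OF X n1] and ne' = rect_nonempty[OF X' n1]
  interpret A: psi_setting sh T "lab_from k sh" "{k..<nrows sh}" "{..<ncols sh}" "start_letter k n"
    by (rule psi_setting_rect[OF X k ne])
  interpret B: psi_setting sh' T' "lab_from k sh'" "{k..<nrows sh'}" "{..<ncols sh'}" "start_letter k n"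
    by (rule psi_setting_rect[OF X' k ne'])
  have N: "nrows sh + ncols sh = n + k" and N': "nrows sh' + ncols sh' = n + k"
    using X X' by (auto simp: rect_tableaux_def)
  note rd = Psi_from_reads[OF X k ne] and rd' = Psi_from_reads[OF X' k ne']
  have R: "l \<in> A.lr ` {k..<nrows sh} \<longleftrightarrow> l \<in> B.lr ` {k..<nrows sh'}" if "l \<in> {1..n}" for l
    using runs_unique[of _ "start_letter k n" "Psi_from k (sh, T)" _ l] rd rd' eq that by (auto simp: reads_def)
  have "is_row (border sh ! p) = is_row (border sh' ! p)" if p: "p < n + k" for p
  proof (cases "k = 1 \<and> p = 0")
    case True
    then show ?thesis using border_0 ne ne' by simp
  next
    case False
    then have "p + (1 - k) \<in> {1..n}" using p k by auto
    then show ?thesis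
      using R[of "p + (1 - k)"] row_label_iff[OF A.sh ne k N, of "p + (1 - k)"]
        row_label_iff[OF B.sh ne' k N', of "p + (1 - k)"] by simp
  qed
  then have "map is_row (border sh) = map is_row (border sh')"
    by (intro nth_equalityI) (simp_all add: length_border A.sh B.sh N N')
  then have ss: "sh = sh'" by (rule shape_unique[OF A.sh B.sh])
  have "(i, j) \<in> T \<longleftrightarrow> (i, j) \<in> T'" if "(i, j) \<in> cells sh" for i j
  proof -
    have ij: "i < nrows sh" "j < ncols sh"
      using that ferrers_nth_le[OF A.sh, of i] by (auto simp: cells_def nrows_def)
    show ?thesis
    proof (cases "i < k")
      case True
      then show ?thesis using X X' ij ss by (auto simp: rect_tableaux_def)
    next
      case False
      then have i: "i \<in> {k..<nrows sh}" and j: "j \<in> {..<ncols sh}" using ij by auto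
      let ?w = "Psi_from k (sh, T)"
      have less: "A.lr i < A.lc j" using A.lab_cell[OF i j] that by simp
      have mem: "A.lr i \<in> set ?w \<inter> A.lr ` {k..<nrows sh}" "A.lc j \<in> set ?w - A.lr ` {k..<nrows sh}"
        using label_image[OF A.sh ne k N] i j A.lc_not_row[OF j] unfolding rd(2) by blast+
      have "A.entry (A.lr i) (A.lc j) \<longleftrightarrow> pos ?w (A.lr i) < pos ?w (A.lc j)"
        using rd(1) mem less unfolding reads_def by blast
      moreover have "reads (A.lr ` {k..<nrows sh})
          (psi_setting.entry T' (lab_from k sh) {k..<nrows sh} {..<ncols sh}) (start_letter k n) ?w"
        using rd'(1) unfolding eq[symmetric] unfolding ss[symmetric] .
      then have "psi_setting.entry T' (lab_from k sh) {k..<nrows sh} {..<ncols sh} (A.lr i) (A.lc j)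
          \<longleftrightarrow> pos ?w (A.lr i) < pos ?w (A.lc j)"
        using mem less unfolding reads_def by blast
      ultimately show ?thesis
        using A.entry_iff[OF i j] B.entry_iff[unfolded ss[symmetric], OF i j] by simp
    qed
  qed
  then have "T = T'" using A.T B.T ss by auto
  then show "sh = sh' \<and> T = T'" using ss by simp
qed

text \<open>
  The ascents and descents of \<open>\<pi>\<close> determine the shape, and a cell gets a 1 iff its row precedes
  its column. A bad rectangle would make positions increase along a closed cycle of length four. As
  \<open>\<pi>\<close> is compatible with the resulting tableau, the algorithm returns \<open>\<pi>\<close> by uniqueness.
\<close>
lemma Psi_from_surj:
  assumes k: "k \<le> 1" and n1: "n \<ge> 1" and \<pi>: "\<pi> \<in> permutations_of_set {1..n}"
  shows "\<exists>X \<in> rect_tableaux k n. Psi_from k X = \<pi>"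
proof -
  define z where "z = start_letter k n"
  have set\<pi>: "set \<pi> = {1..n}" and d\<pi>: "distinct \<pi>" using \<pi> by (auto simp: permutations_of_set_def)
  have dz: "distinct (z # \<pi>)" using set\<pi> d\<pi> by (simp add: z_def start_letter_def)
  obtain R where R: "R \<subseteq> {1..n}" "runs R z \<pi>" using runs_exists[OF d\<pi>] set\<pi> by metis
  have prefix: "\<exists>v b. \<pi> = v @ l # b \<and> runs R z (v @ [l]) \<and> distinct (z # v @ [l]) \<and> set v \<subseteq> {1..n}"
    if l: "l \<in> {1..n}" for l
  proof -
    obtain v b where v: "\<pi> = v @ l # b" using l set\<pi> by (metis split_list)
    have "\<pi> = (v @ [l]) @ b" using v by simp
    then have "runs R z (v @ [l])" using R(2) by (metis runs_append)
    moreover have "distinct (z # v @ [l])" using dz v by simp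
    moreover have "set v \<subseteq> {1..n}" using set\<pi> v by auto
    ultimately show ?thesis using v by blast
  qed
  \<comment> \<open>For \<open>k = 1\<close> the label 0 belongs to the top row; this is the reason for \<open>insert 0 R\<close>.\<close>
  define bs where "bs = map (\<lambda>p. p + (1 - k) \<in> insert 0 R) [0..<n + k]"
  have "hd bs"
  proof (cases "k = 1")
    case False
    then have k0: "k = 0" using k by simp
    obtain v where v: "runs R z (v @ [1])" "distinct (z # v @ [1])" "set v \<subseteq> {1..n}"
      using prefix[of 1] n1 by auto
    have "1 \<in> R"
    proof (rule ccontr)
      assume "1 \<notin> R"
      then show False using col_run[OF v(1) _ v(2)] v(3) k0 by (force simp: z_def start_letter_def)
    qed
    then show ?thesis using k0 n1 by (simp add: bs_def hd_map del: upt_Suc)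
  qed (simp add: bs_def hd_map del: upt_Suc)
  moreover have "bs \<noteq> []" using n1 by (simp add: bs_def)
  ultimately obtain sh where sh: "ferrers sh" "sh \<noteq> []" "map is_row (border sh) = bs"
    using shape_exists by blast
  have N: "nrows sh + ncols sh = n + k"
    using length_border[OF sh(1)] arg_cong[OF sh(3), of length] by (simp add: bs_def)
  let ?lab = "lab_from k sh"
  have Rrow: "(\<lambda>i. ?lab (Row i)) ` {k..<nrows sh} = R"
  proof -
    have "l \<in> (\<lambda>i. ?lab (Row i)) ` {k..<nrows sh} \<longleftrightarrow> l \<in> R" if l: "l \<in> {1..n}" for l
    proof -
      have p: "l - (1 - k) < n + k" "l - (1 - k) + (1 - k) = l" using l k by auto
      have "is_row (border sh ! (l - (1 - k))) = bs ! (l - (1 - k))"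
        using p length_border[OF sh(1)] N by (simp add: sh(3)[symmetric])
      also have "\<dots> \<longleftrightarrow> l \<in> R" using p l k by (cases k) (auto simp: bs_def simp del: upt_Suc)
      finally show ?thesis using row_label_iff[OF sh(1,2) k N l] by simp
    qed
    moreover have "(\<lambda>i. ?lab (Row i)) ` {k..<nrows sh} \<subseteq> {1..n}"
      using label_image[OF sh(1,2) k N] by blast
    ultimately show ?thesis using R(1) by blast
  qed
  have im: "?lab ` (Row ` {k..<nrows sh} \<union> Col ` {..<ncols sh}) = {1..n}"
    by (rule label_image[OF sh(1,2) k N])
  have col: "\<exists>j<ncols sh. c = ?lab (Col j)" if c: "c \<in> {1..n}" "c \<notin> R" for c
  proof -
    have "c \<in> ?lab ` (Row ` {k..<nrows sh} \<union> Col ` {..<ncols sh})" using im c by simp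
    then show ?thesis using Rrow c(2) by auto
  qed
  define before where "before = (\<lambda>i j. pos \<pi> (?lab (Row i)) < pos \<pi> (?lab (Col j)))"
  define T where "T = {(i, j) \<in> cells sh. i < k \<or> before i j}"
  have cell: "(i, j) \<in> cells sh \<longleftrightarrow> ?lab (Row i) < ?lab (Col j)" if "i < nrows sh" "j < ncols sh" for i j
    using label0_cell[OF sh(1) that] by (simp add: lab_from_def)
  have "filling (sh, T)" using sh(1) by (auto simp: filling_def T_def)
  moreover have "no_bad_rectangle (sh, T)"
    unfolding no_bad_rectangle_def prod.case
  proof (intro allI impI)
    fix i i' j j'
    assume a: "i < i' \<and> j < j' \<and> {(i, j), (i, j'), (i', j), (i', j')} \<subseteq> cells sh"
    then have "\<not> i' < k" using k by auto
    then have "(i, j) \<in> T \<longleftrightarrow> i < k \<or> before i j" "(i, j') \<in> T \<longleftrightarrow> i < k \<or> before i j'"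
      "(i', j) \<in> T \<longleftrightarrow> before i' j" "(i', j') \<in> T \<longleftrightarrow> before i' j'"
      using a by (auto simp: T_def)
    then show "\<not> ((i, j) \<notin> T \<and> (i', j') \<notin> T \<and> (i, j') \<in> T \<and> (i', j) \<in> T) \<and>
       \<not> ((i, j) \<in> T \<and> (i', j') \<in> T \<and> (i, j') \<notin> T \<and> (i', j) \<notin> T)"
      unfolding before_def by linarith
  qed
  moreover have "\<forall>i<k. \<forall>j<ncols sh. (i, j) \<in> T"
  proof (intro allI impI)
    fix i j assume "i < k" "j < ncols sh"
    moreover from this have "i = 0" using k by simp
    ultimately show "(i, j) \<in> T" using sh(2) by (simp add: T_def cells_def ncols_nth)
  qed
  moreover have "\<exists>j < sh ! i. (i, j) \<notin> T" if k1: "k = 1" and i: "i < nrows sh" "0 < i" for i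
  proof -
    define r where "r = ?lab (Row i)"
    have "i \<in> {k..<nrows sh}" using i k1 by simp
    then have r: "r \<in> {1..n}" "r \<in> R" using Rrow R(1) unfolding r_def by blast+
    obtain v b where v: "\<pi> = v @ r # b" "runs R z (v @ [r])" "distinct (z # v @ [r])" "set v \<subseteq> {1..n}"
      using prefix[OF r(1)] by blast
    have "z = 0" using k1 by (simp add: z_def start_letter_def)
    then obtain c where c: "c \<in> set v" "c \<notin> R" "r < c" using row_run[OF v(2) r(2) v(3)] by auto
    obtain j where j: "j < ncols sh" "c = ?lab (Col j)" using col[of c] c v(4) by blast
    have "j < sh ! i" using cell[OF i(1) j(1)] c j by (simp add: r_def cells_def)
    moreover have "pos \<pi> c < pos \<pi> r" using c v by (auto simp: pos_append pos_less)
    then have "(i, j) \<notin> T" using i k1 j by (auto simp: T_def before_def r_def)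
    ultimately show ?thesis by blast
  qed
  moreover have "\<exists>i. (i, j) \<in> T" if k1: "k \<noteq> 1" and j: "j < ncols sh" for j
  proof -
    define c where "c = ?lab (Col j)"
    have c: "c \<in> {1..n}" using im j unfolding c_def by blast
    have "c \<notin> R"
    proof
      assume "c \<in> R"
      then obtain i where "i < nrows sh" "?lab (Row i) = ?lab (Col j)" using Rrow unfolding c_def by auto
      then show False using label0_inj[of "Row i" sh "Col j"] j set_border[OF sh(1)] by (auto simp: lab_from_def)
    qed
    obtain v b where v: "\<pi> = v @ c # b" "runs R z (v @ [c])" "distinct (z # v @ [c])" "set v \<subseteq> {1..n}"
      using prefix[OF c] by blast
    have "\<not> z < c" using k1 c by (simp add: z_def start_letter_def)
    then obtain r where r: "r \<in> set v" "r \<in> R" "r < c" using col_run[OF v(2) \<open>c \<notin> R\<close> v(3)] by auto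
    obtain i where i: "i < nrows sh" "r = ?lab (Row i)" using r Rrow by auto
    have "(i, j) \<in> cells sh" using cell[OF i(1) j] r i by (simp add: c_def)
    moreover have "pos \<pi> r < pos \<pi> c" using r v by (auto simp: pos_append pos_less)
    ultimately show ?thesis using i by (auto simp: T_def before_def c_def)
  qed
  ultimately have X: "(sh, T) \<in> rect_tableaux k n"
    using N unfolding rect_tableaux_def by simp
  note ne = sh(2)
  interpret psi_setting sh T "lab_from k sh" "{k..<nrows sh}" "{..<ncols sh}" "start_letter k n"
    by (rule psi_setting_rect[OF X k ne])
  note rd = Psi_from_reads[OF X k ne]
  have "reads (lr ` {k..<nrows sh}) entry (start_letter k n) \<pi>"
    unfolding reads_def
  proof (intro conjI ballI impI)
    show "distinct (start_letter k n # \<pi>)" using dz by (simp add: z_def)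
    show "runs (lr ` {k..<nrows sh}) (start_letter k n) \<pi>" using R(2) Rrow by (simp add: z_def)
    fix r c assume r: "r \<in> set \<pi> \<inter> lr ` {k..<nrows sh}" and c: "c \<in> set \<pi> - lr ` {k..<nrows sh}" and "r < c"
    obtain i where i: "i \<in> {k..<nrows sh}" "r = lr i" using r by auto
    obtain j where j: "j \<in> {..<ncols sh}" "c = lc j"
      using col[of c] c set\<pi> Rrow by auto
    have "(i, j) \<in> cells sh" using lab_cell[OF i(1) j(1)] \<open>r < c\<close> i j by simp
    then show "entry r c \<longleftrightarrow> pos \<pi> r < pos \<pi> c"
      using entry_iff[OF i(1) j(1)] i j by (auto simp: T_def before_def)
  qed
  then have "Psi_from k (sh, T) = \<pi>" using reads_unique[OF rd(1)] rd(2) set\<pi> by simp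
  then show ?thesis using X by blast
qed

theorem Psi_from_bij:
  assumes "k \<le> 1" "n \<ge> 1"
  shows "bij_betw (Psi_from k) (rect_tableaux k n) (permutations_of_set {1..n})"
  unfolding bij_betw_def
proof
  show "inj_on (Psi_from k) (rect_tableaux k n)" by (rule Psi_from_inj[OF assms])
  have "Psi_from k X \<in> permutations_of_set {1..n}" if "X \<in> rect_tableaux k n" for X
    using that Psi_from_reads[of "fst X" "snd X" k n] rect_nonempty[of "fst X" "snd X" k n] assms
    by (auto simp: permutations_of_set_def reads_def)
  then show "Psi_from k ` rect_tableaux k n = permutations_of_set {1..n}"
    using Psi_from_surj[OF assms] by blast
qed

section \<open>The composed bijections\<close>

lemma right_shift_bij:
  assumes "n \<ge> 1"
  shows "bij_betw right_shift (permutations_of_set {1..n}) (permutations_of_set {1..n})"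
proof -
  let ?S = "permutations_of_set {1..n}"
  have ne: "w \<noteq> []" if "w \<in> ?S" for w
    using perm_length[OF that] assms by auto
  have "inj_on right_shift ?S"
  proof (rule inj_onI)
    fix u w assume "u \<in> ?S" "w \<in> ?S" "right_shift u = right_shift w"
    then show "u = w" using ne append_butlast_last_id unfolding right_shift_def
      by (metis list.inject)
  qed
  moreover have "set (right_shift w) = set w \<and> (distinct (right_shift w) \<longleftrightarrow> distinct w)" if "w \<noteq> []" for w
    using that by (cases w rule: rev_cases) (auto simp: right_shift_def)
  then have "right_shift ` ?S \<subseteq> ?S"
    using ne unfolding permutations_of_set_def by blast
  ultimately show ?thesis using endo_inj_surj[of ?S right_shift] by (simp add: bij_betw_def)
qed

lemma down_shift_bij:
  assumes "n \<ge> 1"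
  shows "bij_betw down_shift (permutations_of_set {1..n}) (permutations_of_set {1..n})"
proof -
  let ?S = "permutations_of_set {1..n}"
  define g where "g = (\<lambda>x. if x - 1 = 0 then n else x - 1 :: nat)"
  have g: "inj_on g {1..n}" by (auto simp: g_def inj_on_def split: if_splits)
  have gS: "g ` {1..n} \<subseteq> {1..n}" using assms by (auto simp: g_def)
  have gS': "g ` {1..n} = {1..n}" using endo_inj_surj[OF _ gS g] by simp
  have ds: "down_shift w = map g w" if "w \<in> ?S" for w
    using perm_length[OF that] by (simp add: down_shift_def g_def)
  have "inj_on down_shift ?S"
  proof (rule inj_onI)
    fix u w assume uw: "u \<in> ?S" "w \<in> ?S" "down_shift u = down_shift w"
    then have "inj_on g (set u \<union> set w)" using g by (simp add: permutations_of_set_def)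
    then show "u = w" using uw ds map_inj_on[of g u w] by simp
  qed
  moreover have "down_shift ` ?S \<subseteq> ?S"
  proof (rule image_subsetI)
    fix w assume w: "w \<in> ?S"
    then show "down_shift w \<in> ?S"
      using ds[OF w] g gS' by (auto simp: permutations_of_set_def distinct_map)
  qed
  ultimately show ?thesis using endo_inj_surj[of ?S down_shift] by (simp add: bij_betw_def)
qed

lemma Delta_bij:
  assumes "n \<ge> 1"
  shows "bij_betw (Delta n) (EW_tableaux n) (Le_tableaux n)"
proof -
  have "bij_betw Psi_EW (EW_tableaux n) (permutations_of_set {1..n})"
    using Psi_from_bij[of 1 n] assms by (simp add: EW_tableaux_eq_rect Psi_EW_eq_Psi_from)
  from bij_betw_trans[OF bij_betw_trans[OF bij_betw_trans[OF this DE_bij] right_shift_bij[OF assms]]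
      bij_betw_inv_into[OF Phi_bij]]
  show ?thesis by (simp only: Delta_def comp_assoc)
qed

lemma Gamma_bij:
  assumes "n \<ge> 1"
  shows "bij_betw (Gamma n) (NEW_tableaux n) (Le_tableaux n)"
proof -
  have "bij_betw Psi_NEW (NEW_tableaux n) (permutations_of_set {1..n})"
    using Psi_from_bij[of 0 n] assms by (simp add: NEW_tableaux_eq_rect Psi_NEW_eq_Psi_from)
  from bij_betw_trans[OF bij_betw_trans[OF bij_betw_trans[OF this DE_bij] down_shift_bij[OF assms]]
      bij_betw_inv_into[OF Phi_bij]]
  show ?thesis by (simp only: Gamma_def comp_assoc)
qed

theorem mainTheorem5:
  fixes n :: nat
  assumes "n \<ge> 1"
  shows "bij_betw (inv_into (EW_tableaux n) (Delta n) \<circ> F_map) (tree_tableaux n) (EW_tableaux n)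
       \<and> bij_betw (inv_into (NEW_tableaux n) (Gamma n) \<circ> F_map) (tree_tableaux n) (NEW_tableaux n)"
proof
  note F = F_bij[OF assms]
  show "bij_betw (inv_into (EW_tableaux n) (Delta n) \<circ> F_map) (tree_tableaux n) (EW_tableaux n)"
    by (rule bij_betw_trans[OF F bij_betw_inv_into[OF Delta_bij[OF assms]]])
  show "bij_betw (inv_into (NEW_tableaux n) (Gamma n) \<circ> F_map) (tree_tableaux n) (NEW_tableaux n)"
    by (rule bij_betw_trans[OF F bij_betw_inv_into[OF Gamma_bij[OF assms]]])
qed

end
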